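(* (Condensate Lifting Lemma, CLL.) Let $\lambda$ and $\mu$ be infinite cardinals, let $\Lambda=(\mathcal{A},\mathcal{B},\mathcal{S},\mathcal{A}^\dagger,\mathcal{B}^\dagger,\mathcal{S}^{\Rightarrow},\Phi,\Psi)$ be a $(\lambda,\mu)$-larder at an object $B$ of $\mathcal{B}$, and let $P$ be a poset with a $\lambda$-lifter $(X,\mathbf{X})$. Suppose that we are given: (a) a $P$-indexed diagram $\overrightarrow{A}=(A_p,\alpha_p^q\mid p\le q\text{ in }P)$ in $\mathcal{A}$ such that $A_p$ belongs to $\mathcal{A}^\dagger$ for each non-maximal $p\in P$; (b) a double arrow $\chi\colon\Psi(B)\Rightarrow\Phi\bigl(\mathbf{F}(X)\otimes\overrightarrow{A}\bigr)$ in $\mathcal{S}$. Suppose that at least one of the following holds: (i) $\mu=\aleph_0$ and $\mathbf{X}^{=}$ is lower finite; (ii) $\mu=\mathrm{cf}(\lambda)$ and $\mathbf{X}^{=}$ is well-founded; (iii) $\mu=\mathrm{cf}(\lambda)$ and $\Lambda$ is strong. Then there are a $P$-indexed diagram $\overrightarrow{B}$ in $\mathcal{B}$ and a double arrow $\overrightarrow{\chi}\colon\Psi\overrightarrow{B}\Rightarrow\Phi\overrightarrow{A}$ in $\mathcal{S}^P$ (i.e., a natural transformation all of whose components are double arrows) such that $B_p\in\mathcal{B}^\dagger$ for each non-maximal $p\in P$ while $B_p=B$ for each maximal $p\in P$. Furthermore, if $\Lambda$ is projectable, then there are a $P$-indexed diagram $\overrightarrow{B}'$ in $\mathcal{B}$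 and a natural equivalence $\overrightarrow{\chi}'\colon\Psi\overrightarrow{B}'\to\Phi\overrightarrow{A}$, and there exists a natural transformation from $\overrightarrow{B}$ to $\overrightarrow{B}'$ all of whose components are epimorphisms.
   Context: **Posets.** All posets are nonempty. A set is $\kappa$-small if its cardinality is $<\kappa$; $[X]^{<\kappa}$ is the set of all $\kappa$-small subsets of $X$. For a poset $P$: $P\downarrow a=\{p\in P\mid p\le a\}$; for $Y\subseteq P$, $\nabla Y$ is the set of all minimal elements of the set of upper bounds of $Y$ in $P$, and $u\mathbin{\nabla}v=\nabla\{u,v\}$. $P$ is a *pseudo join-semilattice* if for every $Y\subseteq P$ that is empty or has two elements, the set of upper bounds of $Y$ is of the form $\{p\mid (\exists f\in F)(f\le p)\}$ for a finite $F\subseteq P$. $Z\subseteq P$ is *$\nabla$-closed* if $\nabla Y\subseteq Z$ for each finite $Y\subseteq Z$; $P$ is *supported* if it is a pseudo join-semilattice and the $\nabla$-closure (least $\nabla$-closed superset) of each finite subset is finite. $P$ is *lower finite* if all $P\downarrow a$ are finite; *lower $\kappa$-small* if all $P\downarrow a$ are $\kappa$-small; *well-founded* if each nonempty subset has a minimal element. An *ideal* of a poset is a nonempty directed lower subset. A poset-indexed diagram is a functor from the poset, viewed as a category. **Lifters.** A *norm-covering* of $P$ is a pair $(X,\partial)$ (written $X$) with $X$ a pseudo join-semilattice and $\partial\colon X\to P$ isotone. An ideal $\mathbf{u}$ of $X$ is *sharp* if $\{\partial x\mid x\in\mathbf{u}\}$ has a largest element, denoted $\partial\mathbf{u}$;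 $\mathrm{Id}_s X$ is the set of sharp ideals, ordered by inclusion. A *$\lambda$-lifter* of $P$ is a pair $(X,\mathbf{X})$, $X$ a norm-covering of $P$, $\mathbf{X}\subseteq\mathrm{Id}_sX$, such that, setting $\mathbf{X}^{=}=\{\mathbf{x}\in\mathbf{X}\mid\partial\mathbf{x}\text{ not maximal in }P\}$: (1) $\{\mathbf y\in\mathbf X\mid\mathbf y\subseteq\mathbf x\}$ is $\mathrm{cf}(\lambda)$-small for each $\mathbf x\in\mathbf X^{=}$; (2) for each map $S\colon\mathbf{X}^{=}\to[X]^{<\lambda}$ there is an isotone $\sigma\colon P\to\mathbf{X}$ with $\partial\sigma(p)=p$ for all $p$ and $S(\sigma(a))\cap\sigma(b)\subseteq\sigma(a)$ for all $a<b$ in $P$; (3) if $\lambda=\aleph_0$ then $X$ is supported. **$P$-scaled Boolean algebras.** An object of $\mathbf{Bool}_P$ is $\mathbf{A}=(A,(A^{(p)}\mid p\in P))$ with $A$ a Boolean algebra, each $A^{(p)}$ an ideal of $A$, such that $A=\bigvee_{p}A^{(p)}$ and $A^{(p)}\cap A^{(q)}=\bigvee_{r\ge p,q}A^{(r)}$ for all $p,q$ (joins in the ideal lattice of $A$). A morphism $\mathbf{A}\to\mathbf{B}$ is a Boolean homomorphism $f$ with $f(A^{(p)})\subseteq B^{(p)}$ for all $p$. For an atom $a$ of $A$, $\{p\mid a\in A^{(p)}\}$ is an ideal of $P$; $|a|$ denotes its largest element if it exists. $\mathbf{A}$ is *compact* if $A$ is finite and $|a|$ exists for each atom $a$. Every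 object of $\mathbf{Bool}_P$ is a directed colimit of compact ones, and the compact objects are exactly the finitely presented ones. **$\mathbf F(X)$.** For a norm-covering $X$ of $P$, $\mathrm F(X)$ is the Boolean algebra with generators $\tilde u$ ($u\in X$) and relations $\tilde v\le\tilde u$ for $u\le v$; $\tilde u\wedge\tilde v=\bigvee\{\tilde w\mid w\in u\mathbin{\nabla}v\}$; $1=\bigvee\{\tilde u\mid u\text{ minimal in }X\}$. $\mathrm F(X)^{(p)}$ is the ideal generated by $\{\tilde u\mid p\le\partial u\}$, and $\mathbf F(X)=(\mathrm F(X),(\mathrm F(X)^{(p)}\mid p\in P))\in\mathbf{Bool}_P$. **Condensates.** Let $\mathcal A$ be a category with all small directed colimits and binary products, $\overrightarrow A$ a $P$-indexed diagram in $\mathcal A$. For compact $\mathbf A$, $\mathbf A\otimes\overrightarrow A=\prod(A_{|u|}\mid u\text{ atom of }A)$; for a morphism $\varphi\colon\mathbf A\to\mathbf B$ of compact objects, $\varphi\otimes\overrightarrow A$ is the morphism whose component at an atom $v$ of $B$ is the projection to $A_{|u|}$ followed by $\alpha_{|u|}^{|v|}$, where $u$ is the unique atom of $A$ with $v\le\varphi(u)$. This functor extends, uniquely up to isomorphism, to a functor $-\otimes\overrightarrow A\colon\mathbf{Bool}_P\to\mathcal A$ preserving all small directed colimits. **Categorical notions.** An *extended projection* in $\mathcal A$ is a directed colimit, in the category of arrows of $\mathcal A$ (induced by directed colimits, over the same directed poset, of source and target diagrams), of canonical projections from nonempty finite products to one of their factors. An object $A$ of a category $\mathcal{C}$ is *weakly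 $\kappa$-presented* if for every set $\Omega$ and every colimit $B=\varinjlim_{X\in[\Omega]^{<\kappa}}B_X$ in $\mathcal C$ of a continuous diagram (i.e., preserving all existing directed suprema of $[\Omega]^{<\kappa}$ as colimits), every morphism $A\to B$ factors through some limiting morphism $B_X\to B$. For a full subcategory $\mathcal B^\dagger$, objects of $\mathcal B^\dagger\downarrow B$ are morphisms $C\to B$ with $C\in\mathcal B^\dagger$; "monic object" means that the morphism is monic in $\mathcal B$; $\gamma\trianglelefteq\gamma'$ means that $\gamma$ factors through $\gamma'$. A *projectability witness* for $\varphi\colon\Psi(C)\to S$ (with respect to $\Psi\colon\mathcal B\to\mathcal S$) is a pair $(a,\varepsilon)$ with $a\colon C\to\overline C$ an epimorphism in $\mathcal B$, $\varepsilon\colon\Psi(\overline C)\to S$ an isomorphism, $\varphi=\varepsilon\circ\Psi(a)$, and such that for every $f\colon C\to Y$ in $\mathcal B$ and $\eta\colon\Psi(\overline C)\to\Psi(Y)$ with $\Psi(f)=\eta\circ\Psi(a)$ there is $g\colon\overline C\to Y$ with $f=g\circ a$ and $\eta=\Psi(g)$. **Larders.** $\Lambda$ as in the claim is a *$(\lambda,\mu)$-larder at $B$* if $\mathcal A,\mathcal B,\mathcal S$ are categories, $B\in\mathcal B$, $\Phi\colon\mathcal A\to\mathcal S$ and $\Psi\colon\mathcal B\to\mathcal S$ are functors, $\mathcal A^\dagger\subseteq\mathcal A$ and $\mathcal B^\dagger\subseteq\mathcal B$ are full subcategories, $\mathcal S^{\Rightarrow}$ is a subcategory of $\mathcal S$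 (its arrows are the *double arrows*, written $\Rightarrow$), and: $\mathcal A$ has all small directed colimits; any two objects of $\mathcal A$ have a product; $\Phi$ preserves all small directed colimits; $\Phi(f)$ is a double arrow for each extended projection $f$ of $\mathcal A$; $\Psi(C)$ is weakly $\lambda$-presented in $\mathcal S$ for each $C\in\mathcal B^\dagger$; and $(\mathrm{LS}_\mu(B))$: for each $S=\Phi(A)$ with $A\in\mathcal A^\dagger$, each double arrow $\psi\colon\Psi(B)\Rightarrow S$, each $\mu$-small set $I$ and each family $(\gamma_i\colon C_i\rightarrowtail B\mid i\in I)$ of monic objects of $\mathcal B^\dagger\downarrow B$, there is a monic object $\gamma\colon C\rightarrowtail B$ of $\mathcal B^\dagger\downarrow B$ with $\gamma_i\trianglelefteq\gamma$ for all $i\in I$ and $\psi\circ\Psi(\gamma)$ a double arrow. $\Lambda$ is *strong* if: every diagram in $\mathcal B^\dagger$ indexed by a $\mu$-small directed poset has a colimit in $\mathcal B$ whose underlying object is in $\mathcal B^\dagger$; $\mathcal S^{\Rightarrow}$ is right closed under $\mu$-small directed colimits, i.e., for each colimit $(S,s_i\mid i\in I)$ in $\mathcal S$ of a diagram indexed by a $\mu$-small directed poset $I$ and each $f\colon S\to T$ in $\mathcal S$, if all $f\circ s_i$ are double arrows then so is $f$; and $\Psi$ preserves all $\mu$-small directed colimits. $\Lambda$ is *projectable* if every double arrow $\Psi(C)\Rightarrow S$ (with $C\in\mathcal B$, $S\in\mathcal S$) has a projectability witness. *)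

theory Defs
  imports Main "HOL-Library.FuncSet"
begin

unbundle cardinal_syntax

section \<open>Posets\<close>

text \<open>A poset is a relation \<open>r\<close> with carrier \<open>Field r\<close>; by reflexivity, the carrier is nonempty
  exactly if \<open>r\<close> is.\<close>

definition poset :: "'a rel \<Rightarrow> bool" where
  "poset r \<longleftrightarrow> Partial_order r \<and> r \<noteq> {}"

definition directed :: "'a rel \<Rightarrow> bool" where
  "directed r \<longleftrightarrow> poset r \<and>
     (\<forall>x\<in>Field r. \<forall>y\<in>Field r. \<exists>z. (x, z) \<in> r \<and> (y, z) \<in> r)"

definition incl_rel :: "'a set set \<Rightarrow> 'a set rel" where
  "incl_rel F = {(U, V). U \<in> F \<and> V \<in> F \<and> U \<subseteq> V}"

definition small_subsets :: "'l rel \<Rightarrow> 'a set \<Rightarrow> 'a set set" where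
  "small_subsets \<kappa> A = {Z. Z \<subseteq> A \<and> |Z| <o \<kappa>}"

text \<open>The cofinality of an infinite cardinal. The library's \<open>cofinal\<close> asks for strict upper
  bounds, which makes no difference for orders without a largest element.\<close>

definition cf :: "'l rel \<Rightarrow> 'l rel" where
  "cf r = |SOME A. A \<subseteq> Field r \<and> cofinal A r \<and>
             (\<forall>A'. A' \<subseteq> Field r \<and> cofinal A' r \<longrightarrow> |A| \<le>o |A'| )|"

definition maximal_in :: "'a rel \<Rightarrow> 'a \<Rightarrow> bool" where
  "maximal_in r p \<longleftrightarrow> p \<in> Field r \<and> (\<forall>q. (p, q) \<in> r \<longrightarrow> q = p)"

definition minimal_elems :: "'a rel \<Rightarrow> 'a set \<Rightarrow> 'a set" where
  "minimal_elems r U = {m \<in> U. \<forall>u\<in>U. (u, m) \<in> r \<longrightarrow> u = m}"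

definition greatest_in :: "'a rel \<Rightarrow> 'a set \<Rightarrow> 'a \<Rightarrow> bool" where
  "greatest_in r U m \<longleftrightarrow> m \<in> U \<and> (\<forall>u\<in>U. (u, m) \<in> r)"

definition upper_bounds :: "'a rel \<Rightarrow> 'a set \<Rightarrow> 'a set" where
  "upper_bounds r Y = {p \<in> Field r. \<forall>y\<in>Y. (y, p) \<in> r}"

definition is_sup :: "'a rel \<Rightarrow> 'a set \<Rightarrow> 'a \<Rightarrow> bool" where
  "is_sup r Y s \<longleftrightarrow> s \<in> upper_bounds r Y \<and> (\<forall>t\<in>upper_bounds r Y. (s, t) \<in> r)"

definition nabla :: "'a rel \<Rightarrow> 'a set \<Rightarrow> 'a set" where
  "nabla r Y = minimal_elems r (upper_bounds r Y)"

definition pseudo_join_semilattice :: "'a rel \<Rightarrow> bool" where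
  "pseudo_join_semilattice r \<longleftrightarrow> poset r \<and>
     (\<forall>Y \<subseteq> Field r. Y = {} \<or> card Y = 2 \<longrightarrow>
        (\<exists>F \<subseteq> Field r. finite F \<and> upper_bounds r Y = {p. \<exists>f\<in>F. (f, p) \<in> r}))"

definition nabla_closed :: "'a rel \<Rightarrow> 'a set \<Rightarrow> bool" where
  "nabla_closed r Z \<longleftrightarrow> Z \<subseteq> Field r \<and> (\<forall>Y \<subseteq> Z. finite Y \<longrightarrow> nabla r Y \<subseteq> Z)"

definition nabla_closure :: "'a rel \<Rightarrow> 'a set \<Rightarrow> 'a set" where
  "nabla_closure r Y = \<Inter>{Z. nabla_closed r Z \<and> Y \<subseteq> Z}"

definition supported :: "'a rel \<Rightarrow> bool" where
  "supported r \<longleftrightarrow> pseudo_join_semilattice r \<and>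
     (\<forall>Y \<subseteq> Field r. finite Y \<longrightarrow> finite (nabla_closure r Y))"

definition lower_finite :: "'a rel \<Rightarrow> bool" where
  "lower_finite r \<longleftrightarrow> (\<forall>a\<in>Field r. finite {p. (p, a) \<in> r})"

definition well_founded :: "'a rel \<Rightarrow> bool" where
  "well_founded r \<longleftrightarrow> (\<forall>U \<subseteq> Field r. U \<noteq> {} \<longrightarrow> minimal_elems r U \<noteq> {})"

definition poset_ideal :: "'a rel \<Rightarrow> 'a set \<Rightarrow> bool" where
  "poset_ideal r I \<longleftrightarrow> I \<subseteq> Field r \<and> I \<noteq> {} \<and>
     (\<forall>x\<in>I. \<forall>y. (y, x) \<in> r \<longrightarrow> y \<in> I) \<and>
     (\<forall>x\<in>I. \<forall>y\<in>I. \<exists>z\<in>I. (x, z) \<in> r \<and> (y, z) \<in> r)"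

section \<open>Lifters\<close>

definition norm_covering :: "'p rel \<Rightarrow> 'x rel \<Rightarrow> ('x \<Rightarrow> 'p) \<Rightarrow> bool" where
  "norm_covering P X d \<longleftrightarrow> pseudo_join_semilattice X \<and>
     d ` Field X \<subseteq> Field P \<and> (\<forall>(u, v)\<in>X. (d u, d v) \<in> P)"

definition sharp_ideals :: "'p rel \<Rightarrow> 'x rel \<Rightarrow> ('x \<Rightarrow> 'p) \<Rightarrow> 'x set set" where
  "sharp_ideals P X d = {I. poset_ideal X I \<and> (\<exists>m. greatest_in P (d ` I) m)}"

definition ideal_norm :: "'p rel \<Rightarrow> ('x \<Rightarrow> 'p) \<Rightarrow> 'x set \<Rightarrow> 'p" where
  "ideal_norm P d I = (THE m. greatest_in P (d ` I) m)"

definition nonmax_part :: "'p rel \<Rightarrow> ('x \<Rightarrow> 'p) \<Rightarrow> 'x set set \<Rightarrow> 'x set set" where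
  "nonmax_part P d XX = {I \<in> XX. \<not> maximal_in P (ideal_norm P d I)}"

definition is_lifter ::
  "'l rel \<Rightarrow> 'p rel \<Rightarrow> 'x rel \<Rightarrow> ('x \<Rightarrow> 'p) \<Rightarrow> 'x set set \<Rightarrow> bool" where
  "is_lifter lam P X d XX \<longleftrightarrow>
     norm_covering P X d \<and> XX \<subseteq> sharp_ideals P X d \<and>
     (\<forall>I\<in>nonmax_part P d XX. |{J \<in> XX. J \<subseteq> I}| <o cf lam) \<and>
     (\<forall>S. (\<forall>I\<in>nonmax_part P d XX. S I \<in> small_subsets lam (Field X)) \<longrightarrow>
        (\<exists>\<sigma>. (\<forall>p\<in>Field P. \<sigma> p \<in> XX \<and> ideal_norm P d (\<sigma> p) = p) \<and>
             (\<forall>(p, q)\<in>P. \<sigma> p \<subseteq> \<sigma> q) \<and>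
             (\<forall>(a, b)\<in>P. a \<noteq> b \<longrightarrow> S (\<sigma> a) \<inter> \<sigma> b \<subseteq> \<sigma> a))) \<and>
     (lam =o natLeq \<longrightarrow> supported X)"

section \<open>Categories and functors\<close>

record ('o, 'a) cat =
  Obj :: "'o set"
  Arr :: "'a set"
  Dom :: "'a \<Rightarrow> 'o"
  Cod :: "'a \<Rightarrow> 'o"
  Ident :: "'o \<Rightarrow> 'a"
  Cmp :: "'a \<Rightarrow> 'a \<Rightarrow> 'a"   \<comment> \<open>\<open>Cmp C g f\<close> is \<open>g\<close> after \<open>f\<close>\<close>

definition hom :: "('o, 'a) cat \<Rightarrow> 'o \<Rightarrow> 'o \<Rightarrow> 'a set" where
  "hom C x y = {f \<in> Arr C. Dom C f = x \<and> Cod C f = y}"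

definition category :: "('o, 'a) cat \<Rightarrow> bool" where
  "category C \<longleftrightarrow>
     (\<forall>f\<in>Arr C. Dom C f \<in> Obj C \<and> Cod C f \<in> Obj C) \<and>
     (\<forall>x\<in>Obj C. Ident C x \<in> hom C x x) \<and>
     (\<forall>f\<in>Arr C. \<forall>g\<in>Arr C. Cod C f = Dom C g \<longrightarrow> Cmp C g f \<in> hom C (Dom C f) (Cod C g)) \<and>
     (\<forall>f\<in>Arr C. Cmp C f (Ident C (Dom C f)) = f \<and> Cmp C (Ident C (Cod C f)) f = f) \<and>
     (\<forall>f\<in>Arr C. \<forall>g\<in>Arr C. \<forall>h\<in>Arr C. Cod C f = Dom C g \<and> Cod C g = Dom C h \<longrightarrow>
        Cmp C h (Cmp C g f) = Cmp C (Cmp C h g) f)"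

definition subcategory :: "('o, 'a) cat \<Rightarrow> ('o, 'a) cat \<Rightarrow> bool" where
  "subcategory D C \<longleftrightarrow> category D \<and> Obj D \<subseteq> Obj C \<and> Arr D \<subseteq> Arr C \<and>
     (\<forall>f\<in>Arr D. Dom D f = Dom C f \<and> Cod D f = Cod C f) \<and>
     (\<forall>x\<in>Obj D. Ident D x = Ident C x) \<and>
     (\<forall>f\<in>Arr D. \<forall>g\<in>Arr D. Cod D f = Dom D g \<longrightarrow> Cmp D g f = Cmp C g f)"

definition full_subcategory :: "('o, 'a) cat \<Rightarrow> ('o, 'a) cat \<Rightarrow> bool" where
  "full_subcategory D C \<longleftrightarrow> subcategory D C \<and>
     (\<forall>x\<in>Obj D. \<forall>y\<in>Obj D. hom D x y = hom C x y)"

definition monic :: "('o, 'a) cat \<Rightarrow> 'a \<Rightarrow> bool" where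
  "monic C f \<longleftrightarrow> f \<in> Arr C \<and>
     (\<forall>g\<in>Arr C. \<forall>h\<in>Arr C. Dom C g = Dom C h \<and> Cod C g = Dom C f \<and> Cod C h = Dom C f \<and>
        Cmp C f g = Cmp C f h \<longrightarrow> g = h)"

definition epic :: "('o, 'a) cat \<Rightarrow> 'a \<Rightarrow> bool" where
  "epic C f \<longleftrightarrow> f \<in> Arr C \<and>
     (\<forall>g\<in>Arr C. \<forall>h\<in>Arr C. Cod C g = Cod C h \<and> Dom C g = Cod C f \<and> Dom C h = Cod C f \<and>
        Cmp C g f = Cmp C h f \<longrightarrow> g = h)"

definition isomorphism :: "('o, 'a) cat \<Rightarrow> 'a \<Rightarrow> bool" where
  "isomorphism C f \<longleftrightarrow> f \<in> Arr C \<and>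
     (\<exists>g\<in>hom C (Cod C f) (Dom C f).
        Cmp C g f = Ident C (Dom C f) \<and> Cmp C f g = Ident C (Cod C f))"

record ('o1, 'a1, 'o2, 'a2) cfunctor =
  FO :: "'o1 \<Rightarrow> 'o2"
  FA :: "'a1 \<Rightarrow> 'a2"

definition is_functor ::
  "('o1, 'a1) cat \<Rightarrow> ('o2, 'a2) cat \<Rightarrow> ('o1, 'a1, 'o2, 'a2) cfunctor \<Rightarrow> bool" where
  "is_functor C D F \<longleftrightarrow> category C \<and> category D \<and>
     (\<forall>x\<in>Obj C. FO F x \<in> Obj D \<and> FA F (Ident C x) = Ident D (FO F x)) \<and>
     (\<forall>f\<in>Arr C. FA F f \<in> hom D (FO F (Dom C f)) (FO F (Cod C f))) \<and>
     (\<forall>f\<in>Arr C. \<forall>g\<in>Arr C. Cod C f = Dom C g \<longrightarrow>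
        FA F (Cmp C g f) = Cmp D (FA F g) (FA F f))"

definition functor_comp ::
  "('o2, 'a2, 'o3, 'a3) cfunctor \<Rightarrow> ('o1, 'a1, 'o2, 'a2) cfunctor \<Rightarrow>
   ('o1, 'a1, 'o3, 'a3) cfunctor" where
  "functor_comp G F = \<lparr>FO = FO G \<circ> FO F, FA = FA G \<circ> FA F\<rparr>"

definition nat_trans ::
  "('o1, 'a1) cat \<Rightarrow> ('o2, 'a2) cat \<Rightarrow> ('o1, 'a1, 'o2, 'a2) cfunctor \<Rightarrow>
   ('o1, 'a1, 'o2, 'a2) cfunctor \<Rightarrow> ('o1 \<Rightarrow> 'a2) \<Rightarrow> bool" where
  "nat_trans C D F G \<eta> \<longleftrightarrow> is_functor C D F \<and> is_functor C D G \<and>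
     (\<forall>x\<in>Obj C. \<eta> x \<in> hom D (FO F x) (FO G x)) \<and>
     (\<forall>f\<in>Arr C. Cmp D (\<eta> (Cod C f)) (FA F f) = Cmp D (FA G f) (\<eta> (Dom C f)))"

definition poset_cat :: "'i rel \<Rightarrow> ('i, 'i \<times> 'i) cat" where
  "poset_cat r = \<lparr>Obj = Field r, Arr = r, Dom = fst, Cod = snd,
     Ident = (\<lambda>x. (x, x)), Cmp = (\<lambda>g f. (fst f, snd g))\<rparr>"

type_synonym ('i, 'o, 'a) diagram = "('i, 'i \<times> 'i, 'o, 'a) cfunctor"

section \<open>Limits and colimits\<close>

definition is_product ::
  "('o, 'a) cat \<Rightarrow> 'k set \<Rightarrow> ('k \<Rightarrow> 'o) \<Rightarrow> 'o \<Rightarrow> ('k \<Rightarrow> 'a) \<Rightarrow> bool" where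
  "is_product C K F c pr \<longleftrightarrow> c \<in> Obj C \<and> (\<forall>k\<in>K. F k \<in> Obj C \<and> pr k \<in> hom C c (F k)) \<and>
     (\<forall>c'\<in>Obj C. \<forall>q. (\<forall>k\<in>K. q k \<in> hom C c' (F k)) \<longrightarrow>
        (\<exists>!h. h \<in> hom C c' c \<and> (\<forall>k\<in>K. Cmp C (pr k) h = q k)))"

definition has_binary_products :: "('o, 'a) cat \<Rightarrow> bool" where
  "has_binary_products C \<longleftrightarrow> (\<forall>x\<in>Obj C. \<forall>y\<in>Obj C.
     \<exists>c pr. is_product C (UNIV :: bool set) (\<lambda>k. if k then x else y) c pr)"

definition is_cocone ::
  "('j, 'b) cat \<Rightarrow> ('o, 'a) cat \<Rightarrow> ('j, 'b, 'o, 'a) cfunctor \<Rightarrow> 'o \<Rightarrow> ('j \<Rightarrow> 'a) \<Rightarrow> bool" where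
  "is_cocone J C D c s \<longleftrightarrow> c \<in> Obj C \<and> (\<forall>i\<in>Obj J. s i \<in> hom C (FO D i) c) \<and>
     (\<forall>f\<in>Arr J. Cmp C (s (Cod J f)) (FA D f) = s (Dom J f))"

definition is_colimit ::
  "('j, 'b) cat \<Rightarrow> ('o, 'a) cat \<Rightarrow> ('j, 'b, 'o, 'a) cfunctor \<Rightarrow> 'o \<Rightarrow> ('j \<Rightarrow> 'a) \<Rightarrow> bool" where
  "is_colimit J C D c s \<longleftrightarrow> is_functor J C D \<and> is_cocone J C D c s \<and>
     (\<forall>c' s'. is_cocone J C D c' s' \<longrightarrow>
        (\<exists>!h. h \<in> hom C c c' \<and> (\<forall>i\<in>Obj J. Cmp C h (s i) = s' i)))"

text \<open>Smallness is relative to a type \<open>'v\<close>: a small set is a subset of \<open>'v\<close>, up to bijection. For a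
  lifter carried by a type \<open>'x\<close>, the type \<open>'x bterm set\<close> of the elements of \<open>F(X)\<close>, defined
  below, can serve as \<open>'v\<close>; and \<open>'x\<close> may be any type containing a copy of \<open>X\<close>.\<close>

definition has_small_directed_colimits :: "'v itself \<Rightarrow> ('o, 'a) cat \<Rightarrow> bool" where
  "has_small_directed_colimits V C \<longleftrightarrow> (\<forall>(r :: 'v rel) D.
     directed r \<and> is_functor (poset_cat r) C D \<longrightarrow> (\<exists>c s. is_colimit (poset_cat r) C D c s))"

definition preserves_colimits_over ::
  "'i rel set \<Rightarrow> ('o1, 'a1) cat \<Rightarrow> ('o2, 'a2) cat \<Rightarrow> ('o1, 'a1, 'o2, 'a2) cfunctor \<Rightarrow> bool" where
  "preserves_colimits_over R C E F \<longleftrightarrow> (\<forall>r\<in>R. \<forall>D c s. is_colimit (poset_cat r) C D c s \<longrightarrow>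
     is_colimit (poset_cat r) E (functor_comp F D) (FO F c) (FA F \<circ> s))"

definition preserves_small_directed_colimits ::
  "'v itself \<Rightarrow> ('o1, 'a1) cat \<Rightarrow> ('o2, 'a2) cat \<Rightarrow> ('o1, 'a1, 'o2, 'a2) cfunctor \<Rightarrow> bool" where
  "preserves_small_directed_colimits V C E F \<longleftrightarrow>
     preserves_colimits_over {r :: 'v rel. directed r} C E F"

definition extended_projection :: "'v itself \<Rightarrow> ('o, 'a) cat \<Rightarrow> 'a \<Rightarrow> bool" where
  "extended_projection V C f \<longleftrightarrow> f \<in> Arr C \<and>
     (\<exists>(r :: 'v rel) D E \<pi> s t.
        directed r \<and> nat_trans (poset_cat r) C D E \<pi> \<and>
        (\<forall>i\<in>Field r. \<exists>(K :: nat set) F pr. finite K \<and> K \<noteq> {} \<and>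
           is_product C K F (FO D i) pr \<and> (\<exists>k\<in>K. FO E i = F k \<and> \<pi> i = pr k)) \<and>
        is_colimit (poset_cat r) C D (Dom C f) s \<and>
        is_colimit (poset_cat r) C E (Cod C f) t \<and>
        (\<forall>i\<in>Field r. Cmp C f (s i) = Cmp C (t i) (\<pi> i)))"

definition continuous_diagram :: "'i rel \<Rightarrow> ('o, 'a) cat \<Rightarrow> ('i, 'o, 'a) diagram \<Rightarrow> bool" where
  "continuous_diagram r C D \<longleftrightarrow> is_functor (poset_cat r) C D \<and>
     (\<forall>U w. U \<subseteq> Field r \<and> directed (Restr r U) \<and> is_sup r U w \<longrightarrow>
        is_colimit (poset_cat (Restr r U)) C D (FO D w) (\<lambda>u. FA D (u, w)))"

definition weakly_presented ::
  "'v itself \<Rightarrow> 'l rel \<Rightarrow> ('o, 'a) cat \<Rightarrow> 'o \<Rightarrow> bool" where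
  "weakly_presented V \<kappa> C a \<longleftrightarrow> a \<in> Obj C \<and>
     (\<forall>(\<Omega> :: 'v set) D b s.
        let r = incl_rel (small_subsets \<kappa> \<Omega>) in
        continuous_diagram r C D \<and> is_colimit (poset_cat r) C D b s \<longrightarrow>
        (\<forall>f\<in>hom C a b. \<exists>Z\<in>small_subsets \<kappa> \<Omega>. \<exists>g\<in>hom C a (FO D Z). f = Cmp C (s Z) g))"

section \<open>Scaled Boolean algebras\<close>

record 'v balg =
  bcarrier :: "'v set"
  bmeet :: "'v \<Rightarrow> 'v \<Rightarrow> 'v"
  bjoin :: "'v \<Rightarrow> 'v \<Rightarrow> 'v"
  bneg :: "'v \<Rightarrow> 'v"
  bzero :: "'v"
  bone :: "'v"

definition boolean_alg :: "('v, 'z) balg_scheme \<Rightarrow> bool" where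
  "boolean_alg A \<longleftrightarrow>
     bzero A \<in> bcarrier A \<and> bone A \<in> bcarrier A \<and>
     (\<forall>x\<in>bcarrier A. bneg A x \<in> bcarrier A \<and>
        bmeet A x (bone A) = x \<and> bjoin A x (bzero A) = x \<and>
        bmeet A x (bneg A x) = bzero A \<and> bjoin A x (bneg A x) = bone A) \<and>
     (\<forall>x\<in>bcarrier A. \<forall>y\<in>bcarrier A. bmeet A x y \<in> bcarrier A \<and> bjoin A x y \<in> bcarrier A \<and>
        bmeet A x y = bmeet A y x \<and> bjoin A x y = bjoin A y x) \<and>
     (\<forall>x\<in>bcarrier A. \<forall>y\<in>bcarrier A. \<forall>z\<in>bcarrier A.
        bmeet A x (bjoin A y z) = bjoin A (bmeet A x y) (bmeet A x z) \<and>
        bjoin A x (bmeet A y z) = bmeet A (bjoin A x y) (bjoin A x z))"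

definition ble :: "('v, 'z) balg_scheme \<Rightarrow> 'v \<Rightarrow> 'v \<Rightarrow> bool" where
  "ble A x y \<longleftrightarrow> bmeet A x y = x"

definition boolean_hom :: "('v, 'z) balg_scheme \<Rightarrow> ('w, 'y) balg_scheme \<Rightarrow> ('v \<Rightarrow> 'w) \<Rightarrow> bool" where
  "boolean_hom A B f \<longleftrightarrow> f ` bcarrier A \<subseteq> bcarrier B \<and>
     f (bzero A) = bzero B \<and> f (bone A) = bone B \<and>
     (\<forall>x\<in>bcarrier A. f (bneg A x) = bneg B (f x)) \<and>
     (\<forall>x\<in>bcarrier A. \<forall>y\<in>bcarrier A.
        f (bmeet A x y) = bmeet B (f x) (f y) \<and> f (bjoin A x y) = bjoin B (f x) (f y))"

definition boolean_ideal :: "('v, 'z) balg_scheme \<Rightarrow> 'v set \<Rightarrow> bool" where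
  "boolean_ideal A I \<longleftrightarrow> I \<subseteq> bcarrier A \<and> bzero A \<in> I \<and>
     (\<forall>x\<in>I. \<forall>y\<in>I. bjoin A x y \<in> I) \<and> (\<forall>x\<in>I. \<forall>y\<in>bcarrier A. ble A y x \<longrightarrow> y \<in> I)"

definition ideal_gen :: "('v, 'z) balg_scheme \<Rightarrow> 'v set \<Rightarrow> 'v set" where
  "ideal_gen A U = \<Inter>{I. boolean_ideal A I \<and> U \<subseteq> I}"

definition atoms :: "('v, 'z) balg_scheme \<Rightarrow> 'v set" where
  "atoms A = {a \<in> bcarrier A. a \<noteq> bzero A \<and>
     (\<forall>x\<in>bcarrier A. ble A x a \<longrightarrow> x = bzero A \<or> x = a)}"

record ('v, 'p) sbalg = "'v balg" +
  level :: "'p \<Rightarrow> 'v set"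

definition scaled_boolean_alg :: "'p rel \<Rightarrow> ('v, 'p) sbalg \<Rightarrow> bool" where
  "scaled_boolean_alg P A \<longleftrightarrow> boolean_alg A \<and>
     (\<forall>p\<in>Field P. boolean_ideal A (level A p)) \<and>
     bcarrier A = ideal_gen A (\<Union>p\<in>Field P. level A p) \<and>
     (\<forall>p\<in>Field P. \<forall>q\<in>Field P. level A p \<inter> level A q =
        ideal_gen A (\<Union>r\<in>upper_bounds P {p, q}. level A r))"

text \<open>An arrow is a triple of source, underlying map (restricted to the carrier), and target.\<close>

definition Bool_cat :: "'p rel \<Rightarrow>
    (('v, 'p) sbalg, ('v, 'p) sbalg \<times> ('v \<Rightarrow> 'v) \<times> ('v, 'p) sbalg) cat" where
  "Bool_cat P = \<lparr>Obj = {A. scaled_boolean_alg P A},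
     Arr = {(A, f, B). scaled_boolean_alg P A \<and> scaled_boolean_alg P B \<and>
              f \<in> extensional (bcarrier A) \<and> boolean_hom A B f \<and>
              (\<forall>p\<in>Field P. f ` level A p \<subseteq> level B p)},
     Dom = fst, Cod = snd \<circ> snd,
     Ident = (\<lambda>A. (A, \<lambda>x\<in>bcarrier A. x, A)),
     Cmp = (\<lambda>(B, g, C) (A, f, B'). (A, compose (bcarrier A) g f, C))\<rparr>"

text \<open>The trivial algebra has no atoms, so its tensor product with a diagram would be a terminal
  object, which need not exist when only binary products are assumed. The tensor functor is
  therefore considered on the nontrivial algebras. This is harmless for \<open>F(X)\<close>, which is
  nontrivial, since algebras mapping to a nontrivial one are nontrivial.\<close>

definition Bool_cat_nt :: "'p rel \<Rightarrow>
    (('v, 'p) sbalg, ('v, 'p) sbalg \<times> ('v \<Rightarrow> 'v) \<times> ('v, 'p) sbalg) cat" where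
  "Bool_cat_nt P = (Bool_cat P)
     \<lparr>Obj := {A \<in> Obj (Bool_cat P). bzero A \<noteq> bone A},
      Arr := {(A, f, B) \<in> Arr (Bool_cat P). bzero A \<noteq> bone A \<and> bzero B \<noteq> bone B}\<rparr>"

definition atom_norm :: "'p rel \<Rightarrow> ('v, 'p) sbalg \<Rightarrow> 'v \<Rightarrow> 'p" where
  "atom_norm P A a = (THE m. greatest_in P {p \<in> Field P. a \<in> level A p} m)"

definition compact_sbalg :: "'p rel \<Rightarrow> ('v, 'p) sbalg \<Rightarrow> bool" where
  "compact_sbalg P A \<longleftrightarrow> scaled_boolean_alg P A \<and> finite (bcarrier A) \<and>
     (\<forall>a\<in>atoms A. \<exists>m. greatest_in P {p \<in> Field P. a \<in> level A p} m)"

section \<open>The algebra \<open>F(X)\<close>\<close>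

datatype (gens: 'x) bterm = Gen 'x | Zero | One | Neg "'x bterm"
  | Meet "'x bterm" "'x bterm" | Join "'x bterm" "'x bterm"

definition Joins :: "'x bterm list \<Rightarrow> 'x bterm" where
  "Joins ts = foldr Join ts Zero"

text \<open>The congruence on Boolean terms generated by the axioms of Boolean algebras and the defining
  relations of \<open>F(X)\<close>. The finite joins in these relations are rendered by
  lists enumerating the index set.\<close>

inductive F_cong :: "'x rel \<Rightarrow> 'x bterm \<Rightarrow> 'x bterm \<Rightarrow> bool" for X where
  refl: "F_cong X s s"
| sym: "F_cong X s t \<Longrightarrow> F_cong X t s"
| trans: "F_cong X s t \<Longrightarrow> F_cong X t u \<Longrightarrow> F_cong X s u"
| neg: "F_cong X s s' \<Longrightarrow> F_cong X (Neg s) (Neg s')"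
| meet: "F_cong X s s' \<Longrightarrow> F_cong X t t' \<Longrightarrow> F_cong X (Meet s t) (Meet s' t')"
| join: "F_cong X s s' \<Longrightarrow> F_cong X t t' \<Longrightarrow> F_cong X (Join s t) (Join s' t')"
| meet_comm: "F_cong X (Meet s t) (Meet t s)"
| join_comm: "F_cong X (Join s t) (Join t s)"
| meet_one: "F_cong X (Meet s One) s"
| join_zero: "F_cong X (Join s Zero) s"
| meet_neg: "F_cong X (Meet s (Neg s)) Zero"
| join_neg: "F_cong X (Join s (Neg s)) One"
| meet_join: "F_cong X (Meet s (Join t u)) (Join (Meet s t) (Meet s u))"
| join_meet: "F_cong X (Join s (Meet t u)) (Meet (Join s t) (Join s u))"
| gen_le: "(u, v) \<in> X \<Longrightarrow> F_cong X (Meet (Gen v) (Gen u)) (Gen v)"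
| gen_meet: "u \<in> Field X \<Longrightarrow> v \<in> Field X \<Longrightarrow> set ws = nabla X {u, v} \<Longrightarrow>
    F_cong X (Meet (Gen u) (Gen v)) (Joins (map Gen ws))"
| gen_top: "set us = minimal_elems X (Field X) \<Longrightarrow> F_cong X One (Joins (map Gen us))"

definition F_class :: "'x rel \<Rightarrow> 'x bterm \<Rightarrow> 'x bterm set" where
  "F_class X t = {s. gens s \<subseteq> Field X \<and> F_cong X s t}"

definition F_alg :: "'x rel \<Rightarrow> 'x bterm set balg" where
  "F_alg X = \<lparr>bcarrier = F_class X ` {t. gens t \<subseteq> Field X},
     bmeet = (\<lambda>a b. \<Union>s\<in>a. \<Union>t\<in>b. F_class X (Meet s t)),
     bjoin = (\<lambda>a b. \<Union>s\<in>a. \<Union>t\<in>b. F_class X (Join s t)),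
     bneg = (\<lambda>a. \<Union>s\<in>a. F_class X (Neg s)),
     bzero = F_class X Zero,
     bone = F_class X One\<rparr>"

definition F_scaled :: "'p rel \<Rightarrow> 'x rel \<Rightarrow> ('x \<Rightarrow> 'p) \<Rightarrow> ('x bterm set, 'p) sbalg" where
  "F_scaled P X d = balg.extend (F_alg X)
     \<lparr>level = (\<lambda>p. ideal_gen (F_alg X) {F_class X (Gen u) |u. u \<in> Field X \<and> (p, d u) \<in> P})\<rparr>"

section \<open>Condensates\<close>

text \<open>\<open>T\<close> is (a choice of) the functor tensoring with the diagram \<open>D\<close>: on compact algebras it is
  given by the products over atoms, with the projections \<open>pr\<close>, and it preserves all small directed
  colimits. It is determined up to isomorphism by these properties.\<close>

definition is_tensor_functor ::
  "'p rel \<Rightarrow> ('o, 'a) cat \<Rightarrow> ('p, 'o, 'a) diagram \<Rightarrow>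
   (('v, 'p) sbalg, ('v, 'p) sbalg \<times> ('v \<Rightarrow> 'v) \<times> ('v, 'p) sbalg, 'o, 'a) cfunctor \<Rightarrow> bool" where
  "is_tensor_functor P C D T \<longleftrightarrow>
     is_functor (Bool_cat_nt P) C T \<and>
     preserves_small_directed_colimits TYPE('v) (Bool_cat_nt P) C T \<and>
     (\<exists>pr.
        (\<forall>A\<in>Obj (Bool_cat_nt P). compact_sbalg P A \<longrightarrow>
           is_product C (atoms A) (\<lambda>u. FO D (atom_norm P A u)) (FO T A) (pr A)) \<and>
        (\<forall>(A, f, B)\<in>Arr (Bool_cat_nt P). compact_sbalg P A \<and> compact_sbalg P B \<longrightarrow>
           (\<forall>v\<in>atoms B. let u = (THE u. u \<in> atoms A \<and> ble B v (f u)) in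
              Cmp C (pr B v) (FA T (A, f, B)) =
              Cmp C (FA D (atom_norm P A u, atom_norm P B v)) (pr A u))))"

section \<open>Larders\<close>

record ('oa, 'aa, 'ob, 'ab, 'os, 'as) larder =
  catA :: "('oa, 'aa) cat"
  catB :: "('ob, 'ab) cat"
  catS :: "('os, 'as) cat"
  Adag :: "('oa, 'aa) cat"
  Bdag :: "('ob, 'ab) cat"
  Sdbl :: "('os, 'as) cat"   \<comment> \<open>its arrows are the double arrows\<close>
  Phi :: "('oa, 'aa, 'os, 'as) cfunctor"
  Psi :: "('ob, 'ab, 'os, 'as) cfunctor"

definition double_arrow ::
  "('oa, 'aa, 'ob, 'ab, 'os, 'as) larder \<Rightarrow> 'as \<Rightarrow> 'os \<Rightarrow> 'os \<Rightarrow> bool" where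
  "double_arrow L f x y \<longleftrightarrow> f \<in> Arr (Sdbl L) \<and> f \<in> hom (catS L) x y"

definition monic_dagger_object ::
  "('oa, 'aa, 'ob, 'ab, 'os, 'as) larder \<Rightarrow> 'ob \<Rightarrow> 'ab \<Rightarrow> bool" where
  "monic_dagger_object L B \<gamma> \<longleftrightarrow> (\<exists>C\<in>Obj (Bdag L). \<gamma> \<in> hom (catB L) C B) \<and> monic (catB L) \<gamma>"

definition factors_through :: "('o, 'a) cat \<Rightarrow> 'a \<Rightarrow> 'a \<Rightarrow> bool" where
  "factors_through C f g \<longleftrightarrow> (\<exists>h\<in>hom C (Dom C f) (Dom C g). f = Cmp C g h)"

text \<open>Since \<open>Field mu\<close> has cardinality \<open>mu\<close>, every \<open>mu\<close>-small set is in bijection with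
  a subset of \<open>'m\<close>; so no generality is lost by indexing families with subsets of \<open>'m\<close>.\<close>

definition LS :: "'m rel \<Rightarrow> ('oa, 'aa, 'ob, 'ab, 'os, 'as) larder \<Rightarrow> 'ob \<Rightarrow> bool" where
  "LS mu L B \<longleftrightarrow>
     (\<forall>A\<in>Obj (Adag L). \<forall>\<psi>. double_arrow L \<psi> (FO (Psi L) B) (FO (Phi L) A) \<longrightarrow>
        (\<forall>(I :: 'm set) \<gamma>. |I| <o mu \<and> (\<forall>i\<in>I. monic_dagger_object L B (\<gamma> i)) \<longrightarrow>
           (\<exists>\<delta>. monic_dagger_object L B \<delta> \<and>
                (\<forall>i\<in>I. factors_through (catB L) (\<gamma> i) \<delta>) \<and>
                Cmp (catS L) \<psi> (FA (Psi L) \<delta>) \<in> Arr (Sdbl L))))"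

definition is_larder :: "'v itself \<Rightarrow> 'l rel \<Rightarrow> 'm rel \<Rightarrow>
    ('oa, 'aa, 'ob, 'ab, 'os, 'as) larder \<Rightarrow> 'ob \<Rightarrow> bool" where
  "is_larder V lam mu L B \<longleftrightarrow>
     category (catA L) \<and> category (catB L) \<and> category (catS L) \<and> B \<in> Obj (catB L) \<and>
     is_functor (catA L) (catS L) (Phi L) \<and> is_functor (catB L) (catS L) (Psi L) \<and>
     full_subcategory (Adag L) (catA L) \<and> full_subcategory (Bdag L) (catB L) \<and>
     subcategory (Sdbl L) (catS L) \<and>
     has_small_directed_colimits V (catA L) \<and> has_binary_products (catA L) \<and>
     preserves_small_directed_colimits V (catA L) (catS L) (Phi L) \<and>
     (\<forall>f. extended_projection V (catA L) f \<longrightarrow> FA (Phi L) f \<in> Arr (Sdbl L)) \<and>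
     (\<forall>C\<in>Obj (Bdag L). weakly_presented V lam (catS L) (FO (Psi L) C)) \<and>
     LS mu L B"

definition small_directed_posets :: "'m rel \<Rightarrow> 'm rel set" where
  "small_directed_posets mu = {r. directed r \<and> |Field r| <o mu}"

definition strong_larder ::
  "'m rel \<Rightarrow> ('oa, 'aa, 'ob, 'ab, 'os, 'as) larder \<Rightarrow> bool" where
  "strong_larder mu L \<longleftrightarrow>
     (\<forall>r\<in>small_directed_posets mu. \<forall>D. is_functor (poset_cat r) (Bdag L) D \<longrightarrow>
        (\<exists>c s. is_colimit (poset_cat r) (catB L) D c s \<and> c \<in> Obj (Bdag L))) \<and>
     (\<forall>r\<in>small_directed_posets mu. \<forall>D c s. is_colimit (poset_cat r) (catS L) D c s \<longrightarrow>
        (\<forall>f\<in>Arr (catS L). Dom (catS L) f = c \<and>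
           (\<forall>i\<in>Field r. Cmp (catS L) f (s i) \<in> Arr (Sdbl L)) \<longrightarrow> f \<in> Arr (Sdbl L))) \<and>
     preserves_colimits_over (small_directed_posets mu) (catB L) (catS L) (Psi L)"

definition projectability_witness ::
  "('ob, 'ab) cat \<Rightarrow> ('os, 'as) cat \<Rightarrow> ('ob, 'ab, 'os, 'as) cfunctor \<Rightarrow>
   'ob \<Rightarrow> 'os \<Rightarrow> 'as \<Rightarrow> 'ab \<Rightarrow> 'as \<Rightarrow> bool" where
  "projectability_witness B S F C s \<phi> a \<epsilon> \<longleftrightarrow>
     a \<in> Arr B \<and> Dom B a = C \<and> epic B a \<and>
     \<epsilon> \<in> hom S (FO F (Cod B a)) s \<and> isomorphism S \<epsilon> \<and>
     \<phi> = Cmp S \<epsilon> (FA F a) \<and>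
     (\<forall>Y\<in>Obj B. \<forall>f\<in>hom B C Y. \<forall>\<eta>\<in>hom S (FO F (Cod B a)) (FO F Y).
        FA F f = Cmp S \<eta> (FA F a) \<longrightarrow>
        (\<exists>g\<in>hom B (Cod B a) Y. f = Cmp B g a \<and> \<eta> = FA F g))"

definition projectable_larder :: "('oa, 'aa, 'ob, 'ab, 'os, 'as) larder \<Rightarrow> bool" where
  "projectable_larder L \<longleftrightarrow>
     (\<forall>C\<in>Obj (catB L). \<forall>s\<in>Obj (catS L). \<forall>\<phi>. double_arrow L \<phi> (FO (Psi L) C) s \<longrightarrow>
        (\<exists>a \<epsilon>. projectability_witness (catB L) (catS L) (Psi L) C s \<phi> a \<epsilon>))"

end

theory Submission
  imports Defs
begin

text \<open>By the prime ideal theorem, an element of \<open>F(X)\<close> is determined by the set of those ideals of \<open>X\<close>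
  which satisfy it. A locally constant choice of a member of each ideal of \<open>X\<close> yields a finite partition
  of the space of ideals, hence a compact scaled subalgebra of \<open>F(X)\<close>; any two such choices have a common
  refinement, so \<open>F(X)\<close> is the union of a system of compact subalgebras indexed by the finite subsets of
  \<open>X\<close>. Along this system the evaluation of \<open>F(X)\<close> at a sharp ideal \<open>x\<close> becomes a directed colimit of
  projections, so it induces a double arrow \<open>\<phi> x\<close> from \<open>\<Psi>(B)\<close> to \<open>\<Phi>(A\<^bsub>\<partial>x\<^esub>)\<close>. The Loewenheim-Skolem property
  turns the family of all \<open>\<phi> x\<close> into a diagram of arrows \<open>\<gamma> x\<close> into \<open>B\<close> for which \<open>\<phi> x \<circ> \<Psi>(\<gamma> x)\<close> is a double
  arrow (a buttress). By weak presentability, \<open>\<chi> \<circ> \<Psi>(\<gamma> x)\<close> factors through the part of the condensate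
  supported by a small set \<open>S x\<close>. The lifter provides \<open>\<sigma>\<close> with \<open>S (\<sigma> a) \<inter> \<sigma> b \<subseteq> \<sigma> a\<close>, so the evaluations
  at \<open>\<sigma> a\<close> and \<open>\<sigma> b\<close> agree on that part, which is naturality of \<open>\<phi> (\<sigma> p) \<circ> \<Psi>(\<gamma> (\<sigma> p))\<close> in \<open>p\<close>.\<close>

section \<open>Categories and poset-indexed diagrams\<close>

text \<open>Three obstacles shape the construction. The subalgebra of \<open>F(X)\<close> generated
  by a finite set of generators is in general not compact as a scaled algebra: an atom may lie in
  the levels of an ideal of \<open>P\<close> without largest element. A label chosen inside each
  ideal cures this. The fibre over a label \<open>u\<close> lies below the generator of
  \<open>u\<close>, so it may be given the norm \<open>d u\<close>, and this norm never exceeds that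
  of a sharp ideal in the fibre. Labels chosen separately for different finite sets would not be
  comparable, so they are chosen by recursion on finite sets, each one refining all earlier ones.
  Smallness is measured by the type \<open>'x bterm set\<close>. Every index poset that meets a
  preservation hypothesis therefore has to be moved into this type by an injection. Finally, only
  the objects \<open>A p\<close> with \<open>p\<close> not maximal are known to lie in the dagger
  category. Arrows into \<open>B\<close> are chosen for the ideals in \<open>nonmax_part\<close>
  alone, and a maximal \<open>p\<close> receives \<open>B\<close> with its identity. This suffices,
  because the smaller element of a pair \<open>a < b\<close> is never maximal.\<close>

lemma hom_cmp:
  assumes "category C" "f \<in> hom C x y" "g \<in> hom C y z"
  shows "Cmp C g f \<in> hom C x z"
  using assms unfolding category_def hom_def by auto

lemma cmp_assoc:
  assumes "category C" "f \<in> hom C x y" "g \<in> hom C y z" "h \<in> hom C z w"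
  shows "Cmp C h (Cmp C g f) = Cmp C (Cmp C h g) f"
  using assms unfolding category_def hom_def by auto

lemma hom_objs:
  assumes "category C" "f \<in> hom C x y"
  shows "x \<in> Obj C" "y \<in> Obj C"
  using assms unfolding category_def hom_def by auto

lemma ident_hom: "category C \<Longrightarrow> x \<in> Obj C \<Longrightarrow> Ident C x \<in> hom C x x"
  unfolding category_def by blast

lemma cmp_ident:
  assumes "category C" "f \<in> hom C x y"
  shows "Cmp C f (Ident C x) = f" "Cmp C (Ident C y) f = f"
  using assms unfolding category_def hom_def by auto

lemma monic_cancel:
  assumes "monic C f" "f \<in> hom C y z" "g \<in> hom C x y" "h \<in> hom C x y" "Cmp C f g = Cmp C f h"
  shows "g = h"
  using assms unfolding monic_def hom_def by auto

lemma epic_cancel: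
  assumes "epic C f" "f \<in> hom C x y" "g \<in> hom C y z" "h \<in> hom C y z" "Cmp C g f = Cmp C h f"
  shows "g = h"
  using assms unfolding epic_def hom_def by auto

lemma functor_hom:
  assumes "is_functor C D F" "f \<in> hom C x y"
  shows "FA F f \<in> hom D (FO F x) (FO F y)"
  using assms unfolding is_functor_def hom_def by auto

lemma functor_cmp:
  assumes "is_functor C D F" "f \<in> hom C x y" "g \<in> hom C y z"
  shows "FA F (Cmp C g f) = Cmp D (FA F g) (FA F f)"
  using assms unfolding is_functor_def hom_def by auto

lemma functor_cats:
  assumes "is_functor C D F"
  shows "category C" "category D"
  using assms unfolding is_functor_def by auto

lemma functor_obj:
  assumes "is_functor C D F" "x \<in> Obj C"
  shows "FO F x \<in> Obj D" "FA F (Ident C x) = Ident D (FO F x)"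
  using assms unfolding is_functor_def by auto

lemma functor_comp_simps [simp]:
  "FO (functor_comp G F) x = FO G (FO F x)" "FA (functor_comp G F) f = FA G (FA F f)"
  by (simp_all add: functor_comp_def)

lemma is_functor_comp:
  assumes "is_functor C D F" "is_functor D E G"
  shows "is_functor C E (functor_comp G F)"
  using assms unfolding is_functor_def hom_def by auto

lemma poset_cat_simps [simp]:
  "Obj (poset_cat r) = Field r" "Arr (poset_cat r) = r" "Dom (poset_cat r) f = fst f"
  "Cod (poset_cat r) f = snd f" "Ident (poset_cat r) x = (x, x)"
  "Cmp (poset_cat r) g f = (fst f, snd g)"
  by (simp_all add: poset_cat_def)

lemma partial_orderD:
  assumes "Partial_order r"
  shows "x \<in> Field r \<Longrightarrow> (x, x) \<in> r"
    and "(x, y) \<in> r \<Longrightarrow> (y, z) \<in> r \<Longrightarrow> (x, z) \<in> r"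
    and "(x, y) \<in> r \<Longrightarrow> (y, x) \<in> r \<Longrightarrow> x = y"
  using assms unfolding partial_order_on_def preorder_on_def refl_on_def trans_def antisym_def
  by blast+

lemma category_poset_cat: "Partial_order r \<Longrightarrow> category (poset_cat r)"
  unfolding category_def hom_def
  by (auto simp: FieldI1 FieldI2 partial_orderD(1) intro: partial_orderD(2))

text \<open>The working form of functoriality for diagrams: composable arrows of
  \<open>poset_cat r\<close> are chains of three elements, so each later check reduces to
  identities, typing and one composition law.\<close>

lemma is_functor_poset:
  assumes "Partial_order r"
  shows "is_functor (poset_cat r) C D \<longleftrightarrow> category C \<and>
     (\<forall>x\<in>Field r. FO D x \<in> Obj C \<and> FA D (x, x) = Ident C (FO D x)) \<and>
     (\<forall>x y. (x, y) \<in> r \<longrightarrow> FA D (x, y) \<in> hom C (FO D x) (FO D y)) \<and>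
     (\<forall>x y z. (x, y) \<in> r \<longrightarrow> (y, z) \<in> r \<longrightarrow> FA D (x, z) = Cmp C (FA D (y, z)) (FA D (x, y)))"
proof -
  have "(\<forall>f\<in>r. \<forall>g\<in>r. snd f = fst g \<longrightarrow> Q f g) \<longleftrightarrow>
      (\<forall>x y z. (x, y) \<in> r \<longrightarrow> (y, z) \<in> r \<longrightarrow> Q (x, y) (y, z))" for Q
    by (auto simp: Ball_def)
  then show ?thesis
    unfolding is_functor_def poset_cat_simps using category_poset_cat[OF assms]
    by (auto simp: Ball_def)
qed

lemma is_cocone_poset:
  "is_cocone (poset_cat r) C D c s \<longleftrightarrow> c \<in> Obj C \<and> (\<forall>i\<in>Field r. s i \<in> hom C (FO D i) c) \<and>
     (\<forall>i j. (i, j) \<in> r \<longrightarrow> Cmp C (s j) (FA D (i, j)) = s i)"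
  by (auto simp: is_cocone_def)

lemma is_cocone_cong:
  assumes "\<And>i. i \<in> Field r \<Longrightarrow> FO D i = FO D' i" "\<And>i j. (i, j) \<in> r \<Longrightarrow> FA D (i, j) = FA D' (i, j)"
    and "\<And>i. i \<in> Field r \<Longrightarrow> s i = s' i"
  shows "is_cocone (poset_cat r) C D c s \<longleftrightarrow> is_cocone (poset_cat r) C D' c s'"
  unfolding is_cocone_poset using assms by (simp add: FieldI1 FieldI2)

lemma is_functor_poset_cong:
  assumes "Partial_order r"
    and "\<And>i. i \<in> Field r \<Longrightarrow> FO D i = FO D' i" "\<And>i j. (i, j) \<in> r \<Longrightarrow> FA D (i, j) = FA D' (i, j)"
  shows "is_functor (poset_cat r) C D \<longleftrightarrow> is_functor (poset_cat r) C D'"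
proof -
  note t = partial_orderD(2)[OF assms(1)]
  have "FA D (i, i) = FA D' (i, i)" if "i \<in> Field r" for i
    by (rule assms(3)) (rule partial_orderD(1)[OF assms(1) that])
  moreover have "FA D (x, z) = FA D' (x, z)" if "(x, y) \<in> r" "(y, z) \<in> r" for x y z
    by (rule assms(3)) (rule t[OF that])
  ultimately show ?thesis
    unfolding is_functor_poset[OF assms(1)] using assms(2,3)
    by (auto simp: FieldI1 FieldI2)
qed

lemma is_colimit_cong:
  assumes "Partial_order r"
    and "\<And>i. i \<in> Field r \<Longrightarrow> FO D i = FO D' i" "\<And>i j. (i, j) \<in> r \<Longrightarrow> FA D (i, j) = FA D' (i, j)"
    and "\<And>i. i \<in> Field r \<Longrightarrow> s i = s' i"
  shows "is_colimit (poset_cat r) C D c s \<longleftrightarrow> is_colimit (poset_cat r) C D' c s'"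
proof -
  have "is_cocone (poset_cat r) C D c' t \<longleftrightarrow> is_cocone (poset_cat r) C D' c' t" for c' t
    by (rule is_cocone_cong) (use assms in auto)
  moreover have "is_cocone (poset_cat r) C D c s \<longleftrightarrow> is_cocone (poset_cat r) C D' c s'"
    by (rule is_cocone_cong) (use assms in auto)
  ultimately show ?thesis
    unfolding is_colimit_def using is_functor_poset_cong[OF assms(1-3)] assms(4) by simp
qed

section \<open>Transport of diagrams along injections of index posets\<close>

definition reindex :: "('i \<Rightarrow> 'j) \<Rightarrow> ('j, 'o, 'a) diagram \<Rightarrow> ('i, 'o, 'a) diagram" where
  "reindex g D = \<lparr>FO = FO D \<circ> g, FA = FA D \<circ> map_prod g g\<rparr>"

lemma reindex_simps [simp]:
  "FO (reindex g D) i = FO D (g i)" "FA (reindex g D) (i, j) = FA D (g i, g j)"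
  by (simp_all add: reindex_def)

lemma Field_image_rel: "Field (map_prod g g ` r) = g ` Field r"
  by (force simp: Field_def)

lemma image_relE:
  assumes "(x, y) \<in> map_prod g g ` r"
  obtains i j where "x = g i" "y = g j" "(i, j) \<in> r"
  using assms by auto

lemma Partial_order_image_rel:
  assumes "Partial_order r" "inj_on g (Field r)"
  shows "Partial_order (map_prod g g ` r)"
proof -
  note r = partial_orderD[OF assms(1)]
  have "map_prod g g ` r \<subseteq> g ` Field r \<times> g ` Field r" by (auto simp: FieldI1 FieldI2)
  moreover have "\<forall>x\<in>g ` Field r. (x, x) \<in> map_prod g g ` r" using r(1) by force
  moreover have "trans (map_prod g g ` r)"
  proof (rule transI)
    fix x y z assume "(x, y) \<in> map_prod g g ` r" "(y, z) \<in> map_prod g g ` r"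
    then obtain i j j' k where *: "x = g i" "y = g j" "(i, j) \<in> r" "y = g j'" "z = g k" "(j', k) \<in> r"
      by (elim image_relE) blast
    then have "j = j'" using assms(2) by (metis FieldI1 FieldI2 inj_onD)
    then show "(x, z) \<in> map_prod g g ` r" using * r(2) by force
  qed
  moreover have "antisym (map_prod g g ` r)"
  proof (rule antisymI)
    fix x y assume "(x, y) \<in> map_prod g g ` r" "(y, x) \<in> map_prod g g ` r"
    then obtain i j i' j' where *: "x = g i" "y = g j" "(i, j) \<in> r" "y = g j'" "x = g i'" "(j', i') \<in> r"
      by (elim image_relE) blast
    then have "j = j'" "i = i'" using assms(2) by (metis FieldI1 FieldI2 inj_onD)+
    then show "x = y" using * r(3) by force
  qed
  ultimately show ?thesis
    unfolding partial_order_on_def preorder_on_def refl_on_def Field_image_rel by blast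
qed

lemma directed_image_rel:
  assumes "directed r" "inj_on g (Field r)"
  shows "directed (map_prod g g ` r)"
proof -
  have "poset (map_prod g g ` r)"
    using assms Partial_order_image_rel unfolding directed_def poset_def by blast
  moreover have "\<exists>z. (x, z) \<in> map_prod g g ` r \<and> (y, z) \<in> map_prod g g ` r"
    if "x \<in> g ` Field r" "y \<in> g ` Field r" for x y
    using that assms(1) unfolding directed_def by force
  ultimately show ?thesis unfolding directed_def Field_image_rel by blast
qed

lemma all_image_rel:
  "(\<forall>x y. (x, y) \<in> map_prod g g ` r \<longrightarrow> Q x y) \<longleftrightarrow> (\<forall>i j. (i, j) \<in> r \<longrightarrow> Q (g i) (g j))"
  by (metis (no_types, lifting) image_relE map_prod_imageI)

lemma is_functor_reindex:
  assumes "Partial_order r" "inj_on g (Field r)"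
  shows "is_functor (poset_cat (map_prod g g ` r)) C D \<longleftrightarrow> is_functor (poset_cat r) C (reindex g D)"
proof -
  have 1: "(\<forall>x\<in>Field (map_prod g g ` r). Q x) \<longleftrightarrow> (\<forall>i\<in>Field r. Q (g i))" for Q
    by (simp add: Field_image_rel)
  have 3: "(\<forall>x y z. (x, y) \<in> map_prod g g ` r \<longrightarrow> (y, z) \<in> map_prod g g ` r \<longrightarrow> Q x y z) \<longleftrightarrow>
      (\<forall>i j k. (i, j) \<in> r \<longrightarrow> (j, k) \<in> r \<longrightarrow> Q (g i) (g j) (g k))"
    (is "?l \<longleftrightarrow> ?r") for Q :: "'b \<Rightarrow> 'b \<Rightarrow> 'b \<Rightarrow> bool"
  proof
    assume ?l then show ?r by force
  next
    assume R: ?r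
    show ?l
    proof (intro allI impI)
      fix x y z assume "(x, y) \<in> map_prod g g ` r" "(y, z) \<in> map_prod g g ` r"
      then obtain i j j' k where *: "x = g i" "y = g j" "(i, j) \<in> r" "y = g j'" "z = g k" "(j', k) \<in> r"
      by (elim image_relE) blast
      then have "j = j'" using assms(2) by (metis FieldI1 FieldI2 inj_onD)
      then show "Q x y z" using * R by blast
    qed
  qed
  show ?thesis
    unfolding is_functor_poset[OF assms(1)] is_functor_poset[OF Partial_order_image_rel[OF assms]]
      1 all_image_rel 3 by simp
qed

lemma is_cocone_reindex:
  "is_cocone (poset_cat (map_prod g g ` r)) C D c s \<longleftrightarrow>
   is_cocone (poset_cat r) C (reindex g D) c (s \<circ> g)"
  unfolding is_cocone_poset Field_image_rel all_image_rel by simp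

text \<open>Restricting along \<open>g\<close> turns cocones over the image into cocones over
  \<open>r\<close>. Conversely, a family \<open>t\<close> on \<open>Field r\<close> extends to the
  image as \<open>t\<close> after the inverse of \<open>g\<close>, so the two universal properties
  quantify over the same data.\<close>

lemma is_colimit_reindex:
  assumes "Partial_order r" "inj_on g (Field r)"
  shows "is_colimit (poset_cat (map_prod g g ` r)) C D c s \<longleftrightarrow>
         is_colimit (poset_cat r) C (reindex g D) c (s \<circ> g)"
proof -
  have "(\<forall>c' s'. is_cocone (poset_cat r) C (reindex g D) c' (s' \<circ> g) \<longrightarrow>
        (\<exists>!h. h \<in> hom C c c' \<and> (\<forall>i\<in>Field r. Cmp C h (s (g i)) = s' (g i)))) \<longleftrightarrow>
      (\<forall>c' t. is_cocone (poset_cat r) C (reindex g D) c' t \<longrightarrow>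
        (\<exists>!h. h \<in> hom C c c' \<and> (\<forall>i\<in>Field r. Cmp C h (s (g i)) = t i)))" (is "?l \<longleftrightarrow> ?r")
  proof
    assume L: ?l
    show ?r
    proof (intro allI impI)
      fix c' t assume co: "is_cocone (poset_cat r) C (reindex g D) c' t"
      define s' where "s' = t \<circ> inv_into (Field r) g"
      have s': "s' (g i) = t i" if "i \<in> Field r" for i
        using assms(2) that by (simp add: s'_def)
      have "is_cocone (poset_cat r) C (reindex g D) c' (s' \<circ> g)"
        using co by (subst is_cocone_cong) (auto simp: s')
      with L have "\<exists>!h. h \<in> hom C c c' \<and> (\<forall>i\<in>Field r. Cmp C h (s (g i)) = s' (g i))" by blast
      then show "\<exists>!h. h \<in> hom C c c' \<and> (\<forall>i\<in>Field r. Cmp C h (s (g i)) = t i)" by (simp add: s')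
    qed
  next
    assume R: ?r
    show ?l
    proof (intro allI impI)
      fix c' s' assume "is_cocone (poset_cat r) C (reindex g D) c' (s' \<circ> g)"
      from R[rule_format, OF this]
      show "\<exists>!h. h \<in> hom C c c' \<and> (\<forall>i\<in>Field r. Cmp C h (s (g i)) = s' (g i))" by simp
    qed
  qed
  then show ?thesis
    unfolding is_colimit_def is_functor_reindex[OF assms] is_cocone_reindex
    by (simp add: Field_image_rel)
qed

text \<open>The direction used in applications: here \<open>D\<close> is given over
  \<open>r\<close>, and it is carried to the image poset by pulling back along the inverse of
  \<open>g\<close>. Only values on \<open>Field r\<close> matter, where the inverse cancels
  \<open>g\<close>.\<close>

lemma is_colimit_reindex':
  assumes "Partial_order r" "inj_on g (Field r)"
  defines "h \<equiv> inv_into (Field r) g"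
  shows "is_colimit (poset_cat (map_prod g g ` r)) C (reindex h D) c (s \<circ> h) \<longleftrightarrow>
         is_colimit (poset_cat r) C D c s"
    and "is_functor (poset_cat (map_prod g g ` r)) C (reindex h D) \<longleftrightarrow>
         is_functor (poset_cat r) C D"
proof -
  have h: "h (g i) = i" if "i \<in> Field r" for i
    using assms that by (simp add: h_def)
  show "is_colimit (poset_cat (map_prod g g ` r)) C (reindex h D) c (s \<circ> h) \<longleftrightarrow>
         is_colimit (poset_cat r) C D c s"
    unfolding is_colimit_reindex[OF assms(1,2)]
    by (rule is_colimit_cong) (use assms in \<open>auto simp: h FieldI1 FieldI2\<close>)
  show "is_functor (poset_cat (map_prod g g ` r)) C (reindex h D) \<longleftrightarrow>
         is_functor (poset_cat r) C D"
    unfolding is_functor_reindex[OF assms(1,2)]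
    by (rule is_functor_poset_cong) (use assms in \<open>auto simp: h FieldI1 FieldI2\<close>)
qed

text \<open>Preservation is assumed for relations over one fixed type. Moving the diagram to an
  isomorphic copy of its index poset in that type, applying preservation, and moving back extends it
  to index posets over other types.\<close>

lemma preserves_colimits_over_reindex:
  assumes "preserves_colimits_over R C E F" "Partial_order r" "inj_on g (Field r)"
    and "map_prod g g ` r \<in> R" "is_colimit (poset_cat r) C D c s"
  shows "is_colimit (poset_cat r) E (functor_comp F D) (FO F c) (FA F \<circ> s)"
proof -
  define h where "h = inv_into (Field r) g"
  have "is_colimit (poset_cat (map_prod g g ` r)) C (reindex h D) c (s \<circ> h)"
    unfolding h_def by (rule is_colimit_reindex'(1)[OF assms(2,3), THEN iffD2, OF assms(5)])
  then have "is_colimit (poset_cat (map_prod g g ` r)) E (functor_comp F (reindex h D)) (FO F c)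
      (FA F \<circ> (s \<circ> h))"
    using assms(1,4) unfolding preserves_colimits_over_def by blast
  then have "is_colimit (poset_cat (map_prod g g ` r)) E (reindex h (functor_comp F D)) (FO F c)
      ((FA F \<circ> s) \<circ> h)"
    by (subst is_colimit_cong[OF Partial_order_image_rel[OF assms(2,3)]]) auto
  then show ?thesis
    unfolding h_def by (rule is_colimit_reindex'(1)[OF assms(2,3), THEN iffD1])
qed

lemma is_colimit_mediating:
  assumes "is_colimit (poset_cat r) C D c s" "is_cocone (poset_cat r) C D c' s'"
  obtains h where "h \<in> hom C c c'" "\<And>i. i \<in> Field r \<Longrightarrow> Cmp C h (s i) = s' i"
  using assms unfolding is_colimit_def by (metis poset_cat_simps(1))

text \<open>Composing \<open>h\<close> with the legs gives a cocone, and \<open>h\<close> and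
  \<open>h'\<close> both mediate it. This joint epimorphy of the legs is how equations out of a
  colimit are checked later.\<close>

lemma is_colimit_unique:
  assumes col: "is_colimit (poset_cat r) C D c s" and h: "h \<in> hom C c c'" "h' \<in> hom C c c'"
    and eq: "\<And>i. i \<in> Field r \<Longrightarrow> Cmp C h (s i) = Cmp C h' (s i)"
  shows "h = h'"
proof -
  have cat: "category C" and co: "is_cocone (poset_cat r) C D c s"
    and fD: "is_functor (poset_cat r) C D"
    using col functor_cats(2) unfolding is_colimit_def by auto
  have "is_cocone (poset_cat r) C D c' (\<lambda>i. Cmp C h (s i))"
    unfolding is_cocone_poset
  proof (intro conjI allI impI ballI)
    show "c' \<in> Obj C" using hom_objs(2)[OF cat h(1)] .
    show "Cmp C h (s i) \<in> hom C (FO D i) c'" if "i \<in> Field r" for i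
      using co that h(1) cat hom_cmp unfolding is_cocone_poset by fast
    fix i j assume ij: "(i, j) \<in> r"
    have "FA D (i, j) \<in> hom C (FO D i) (FO D j)"
      using functor_hom[OF fD, of "(i, j)" i j] ij by (simp add: hom_def)
    moreover have "s j \<in> hom C (FO D j) c" "Cmp C (s j) (FA D (i, j)) = s i"
      using co ij unfolding is_cocone_poset by (auto simp: FieldI2)
    ultimately show "Cmp C (Cmp C h (s j)) (FA D (i, j)) = Cmp C h (s i)"
      using cmp_assoc[OF cat] h(1) by metis
  qed
  then have "\<exists>!k. k \<in> hom C c c' \<and> (\<forall>i\<in>Field r. Cmp C k (s i) = Cmp C h (s i))"
    using col unfolding is_colimit_def by simp
  then show ?thesis using h eq by metis
qed

text \<open>Any two indices have a common upper bound, and the cocone condition along identities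
  equates the legs there, so all legs of a cocone coincide. It supplies the target diagram when a
  projection of the condensate is shown to be an extended projection.\<close>

lemma is_colimit_const:
  assumes dir: "directed r" and cat: "category C" and c: "c \<in> Obj C"
  shows "is_colimit (poset_cat r) C \<lparr>FO = \<lambda>i. c, FA = \<lambda>f. Ident C c\<rparr> c (\<lambda>i. Ident C c)"
proof -
  have po: "Partial_order r" and ne: "r \<noteq> {}" using dir unfolding directed_def poset_def by auto
  note id = ident_hom[OF cat c]
  have idid: "Cmp C (Ident C c) (Ident C c) = Ident C c" using cmp_ident[OF cat id] by simp
  have "\<exists>!h. h \<in> hom C c c' \<and> (\<forall>i\<in>Field r. Cmp C h (Ident C c) = s' i)"
    if co: "is_cocone (poset_cat r) C \<lparr>FO = \<lambda>i. c, FA = \<lambda>f. Ident C c\<rparr> c' s'" for c' s'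
  proof -
    have hs: "s' i \<in> hom C c c'" if "i \<in> Field r" for i
      using co that unfolding is_cocone_poset by simp
    have step: "s' i = s' j" if "(i, j) \<in> r" for i j
      using co that cmp_ident(1)[OF cat hs[OF FieldI2[OF that]]] unfolding is_cocone_poset by auto
    obtain k where k: "k \<in> Field r" using ne by (auto simp: Field_def)
    have same: "s' i = s' k" if "i \<in> Field r" for i
      using dir that k step unfolding directed_def by metis
    show ?thesis
    proof (rule ex1I[of _ "s' k"])
      show "s' k \<in> hom C c c' \<and> (\<forall>i\<in>Field r. Cmp C (s' k) (Ident C c) = s' i)"
        using hs[OF k] same cmp_ident(1)[OF cat hs[OF k]] by simp
    next
      fix h assume "h \<in> hom C c c' \<and> (\<forall>i\<in>Field r. Cmp C h (Ident C c) = s' i)"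
      then show "h = s' k" using cmp_ident(1)[OF cat] k by metis
    qed
  qed
  then show ?thesis
    unfolding is_colimit_def is_functor_poset[OF po] is_cocone_poset
    using cat c id idid by simp
qed

lemma incl_rel_iff [simp]: "(U, V) \<in> incl_rel F \<longleftrightarrow> U \<in> F \<and> V \<in> F \<and> U \<subseteq> V"
  by (simp add: incl_rel_def)

lemma Field_incl_rel [simp]: "Field (incl_rel F) = F"
  by (auto simp: Field_def incl_rel_def)

lemma Partial_order_incl_rel [simp]: "Partial_order (incl_rel F)"
  unfolding partial_order_on_def preorder_on_def refl_on_def
  by (auto simp: trans_def antisym_def FieldI1 FieldI2)

lemma incl_rel_nonempty [simp]: "incl_rel F = {} \<longleftrightarrow> F = {}"
  unfolding incl_rel_def by auto

lemma directed_incl_relI: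
  assumes "F \<noteq> {}" "\<And>U V. U \<in> F \<Longrightarrow> V \<in> F \<Longrightarrow> \<exists>W\<in>F. U \<subseteq> W \<and> V \<subseteq> W"
  shows "directed (incl_rel F)"
  unfolding directed_def poset_def Field_incl_rel using assms Partial_order_incl_rel[of F]
  by (simp add: Bex_def) blast

section \<open>Stone duality for \<open>F(X)\<close>\<close>

subsection \<open>Prime ideals of Boolean algebras\<close>

context
  fixes A :: "('v, 'z) balg_scheme"
  assumes A: "boolean_alg A"
begin

lemma balg_closed:
  shows "bzero A \<in> bcarrier A" "bone A \<in> bcarrier A"
    and "x \<in> bcarrier A \<Longrightarrow> bneg A x \<in> bcarrier A"
    and "x \<in> bcarrier A \<Longrightarrow> y \<in> bcarrier A \<Longrightarrow> bmeet A x y \<in> bcarrier A"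
    and "x \<in> bcarrier A \<Longrightarrow> y \<in> bcarrier A \<Longrightarrow> bjoin A x y \<in> bcarrier A"
  using A unfolding boolean_alg_def by simp_all

lemma balg_unit:
  assumes "x \<in> bcarrier A"
  shows "bmeet A x (bone A) = x" "bjoin A x (bzero A) = x"
    and "bmeet A x (bneg A x) = bzero A" "bjoin A x (bneg A x) = bone A"
  using A assms unfolding boolean_alg_def by simp_all

lemma balg_comm:
  assumes "x \<in> bcarrier A" "y \<in> bcarrier A"
  shows "bmeet A x y = bmeet A y x" "bjoin A x y = bjoin A y x"
  using A assms unfolding boolean_alg_def by blast+

lemma balg_distrib:
  assumes "x \<in> bcarrier A" "y \<in> bcarrier A" "z \<in> bcarrier A"
  shows "bmeet A x (bjoin A y z) = bjoin A (bmeet A x y) (bmeet A x z)"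
    and "bjoin A x (bmeet A y z) = bmeet A (bjoin A x y) (bjoin A x z)"
  using A assms unfolding boolean_alg_def by blast+

lemma balg_distrib':
  assumes "x \<in> bcarrier A" "y \<in> bcarrier A" "z \<in> bcarrier A"
  shows "bmeet A (bjoin A y z) x = bjoin A (bmeet A y x) (bmeet A z x)"
    and "bjoin A (bmeet A y z) x = bmeet A (bjoin A y x) (bjoin A z x)"
  using assms balg_distrib[OF assms] balg_comm balg_closed(4,5) by metis+

text \<open>\<open>boolean_alg\<close> states Huntington's axioms, among which neither absorption
  nor associativity occurs. Both are derived, beginning with the behaviour of the bounds.\<close>

lemma balg_bounds:
  assumes "x \<in> bcarrier A"
  shows "bjoin A x (bone A) = bone A" "bmeet A x (bzero A) = bzero A"
proof -
  note cl = balg_closed(1,2) balg_closed(3)[OF assms]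
  have "bjoin A x (bone A) = bmeet A (bjoin A x (bone A)) (bjoin A x (bneg A x))"
    by (simp add: balg_unit balg_closed assms)
  also have "\<dots> = bjoin A x (bmeet A (bone A) (bneg A x))"
    by (simp add: balg_distrib(2) balg_closed assms)
  also have "\<dots> = bone A"
    by (simp add: balg_comm(1)[OF cl(2,3)] balg_unit assms cl)
  finally show "bjoin A x (bone A) = bone A" .
  have "bmeet A x (bzero A) = bjoin A (bmeet A x (bzero A)) (bmeet A x (bneg A x))"
    by (simp add: balg_unit balg_closed assms)
  also have "\<dots> = bmeet A x (bjoin A (bzero A) (bneg A x))"
    by (simp add: balg_distrib(1) balg_closed assms)
  also have "\<dots> = bzero A"
    by (simp add: balg_comm(2)[OF cl(1,3)] balg_unit assms cl)
  finally show "bmeet A x (bzero A) = bzero A" .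
qed

lemma balg_absorb:
  assumes "x \<in> bcarrier A" "y \<in> bcarrier A"
  shows "bjoin A x (bmeet A x y) = x" "bmeet A x (bjoin A x y) = x"
proof -
  have "bjoin A x (bmeet A x y) = bmeet A x (bjoin A (bone A) y)"
    using assms by (simp add: balg_distrib(1) balg_unit balg_closed)
  then show "bjoin A x (bmeet A x y) = x"
    using assms by (simp add: balg_comm(2)[of "bone A" y] balg_bounds balg_unit balg_closed)
  have "bmeet A x (bjoin A x y) = bjoin A x (bmeet A (bzero A) y)"
    using assms by (simp add: balg_distrib(2) balg_unit balg_closed)
  then show "bmeet A x (bjoin A x y) = x"
    using assms by (simp add: balg_comm(1)[of "bzero A" y] balg_bounds balg_unit balg_closed)
qed

lemma balg_idem:
  assumes "x \<in> bcarrier A"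
  shows "bmeet A x x = x"
  using balg_absorb(2)[OF assms balg_closed(1)] balg_unit(2)[OF assms] by simp

text \<open>Both sides agree after joining with \<open>x\<close> and after joining with the complement of \<open>x\<close>.\<close>

lemma balg_assoc:
  assumes x: "x \<in> bcarrier A" and y: "y \<in> bcarrier A" and z: "z \<in> bcarrier A"
  shows "bmeet A (bmeet A x y) z = bmeet A x (bmeet A y z)" (is "?L = ?R")
proof -
  let ?x' = "bneg A x"
  note cl = balg_closed(1,2) balg_closed(3)[OF x] balg_closed(4,5)
  have L: "?L \<in> bcarrier A" and R: "?R \<in> bcarrier A" using assms cl by auto
  have "bjoin A x ?L = bmeet A x (bjoin A x z)"
    using assms cl by (simp add: balg_distrib(2)[OF x _ z] balg_absorb(1)[OF x y])
  then have xL: "bjoin A x ?L = x" using assms by (simp add: balg_absorb)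
  have xR: "bjoin A x ?R = x" using assms cl by (simp add: balg_absorb)
  have one: "bjoin A ?x' x = bone A" "\<And>w. w \<in> bcarrier A \<Longrightarrow> bmeet A (bone A) w = w"
    using balg_comm(2)[OF x cl(3)] balg_unit[OF x] balg_unit(1) balg_comm(1)[OF cl(2)] by auto
  have "bjoin A ?x' ?L = bmeet A (bjoin A ?x' y) (bjoin A ?x' z)"
    using assms cl by (simp add: balg_distrib(2) one)
  moreover have "bjoin A ?x' ?R = bmeet A (bjoin A ?x' y) (bjoin A ?x' z)"
    using assms cl by (simp add: balg_distrib(2) one)
  ultimately have x': "bjoin A ?x' ?L = bjoin A ?x' ?R" by simp
  have *: "w = bmeet A (bjoin A x w) (bjoin A ?x' w)" if "w \<in> bcarrier A" for w
  proof -
    have "w = bjoin A w (bmeet A x ?x')" using that x by (simp add: balg_unit)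
    also have "\<dots> = bmeet A (bjoin A w x) (bjoin A w ?x')" using that x cl by (simp add: balg_distrib(2))
    finally show ?thesis using that x cl by (metis balg_comm(2))
  qed
  show ?thesis using *[OF L] *[OF R] xL xR x' by metis
qed

lemma ble_trans:
  assumes "x \<in> bcarrier A" "y \<in> bcarrier A" "z \<in> bcarrier A" "ble A x y" "ble A y z"
  shows "ble A x z"
  using assms balg_assoc[OF assms(1-3)] unfolding ble_def by metis

lemma ble_meet:
  assumes "x \<in> bcarrier A" "y \<in> bcarrier A"
  shows "ble A (bmeet A x y) x" "ble A (bmeet A x y) y"
proof -
  show "ble A (bmeet A x y) y"
    unfolding ble_def using assms by (simp add: balg_assoc balg_idem)
  have "ble A (bmeet A y x) x"
    unfolding ble_def using assms by (simp add: balg_assoc balg_idem)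
  then show "ble A (bmeet A x y) x" by (simp add: balg_comm(1)[OF assms])
qed

lemma ble_meet_mono:
  assumes "x \<in> bcarrier A" "y \<in> bcarrier A" "z \<in> bcarrier A" "ble A x y"
  shows "ble A (bmeet A x z) (bmeet A y z)"
proof -
  have "bmeet A (bmeet A x z) (bmeet A y z) = bmeet A (bmeet A (bmeet A x z) z) y"
    using assms balg_closed(4) by (metis balg_assoc balg_comm(1))
  also have "\<dots> = bmeet A (bmeet A x z) y" using assms by (simp add: balg_assoc balg_idem)
  also have "\<dots> = bmeet A (bmeet A x y) z" using assms by (metis balg_assoc balg_comm(1))
  finally show ?thesis using assms(4) unfolding ble_def by simp
qed

text \<open>Zorn's lemma applies to the ideals that contain \<open>a\<close> and omit the unit: the
  principal ideal of \<open>a\<close> is one of them, and unions of nonempty chains stay in the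
  family. A maximal one is then shown to decide every element.\<close>

lemma prime_ideal_exists:
  assumes a: "a \<in> bcarrier A" "a \<noteq> bone A"
  obtains I where "boolean_ideal A I" "a \<in> I" "bone A \<notin> I"
    "\<And>x. x \<in> bcarrier A \<Longrightarrow> x \<in> I \<or> bneg A x \<in> I"
proof -
  define Q where "Q = {I. boolean_ideal A I \<and> a \<in> I \<and> bone A \<notin> I}"
  have "{x \<in> bcarrier A. ble A x a} \<in> Q"
  proof -
    have "ble A (bjoin A x y) a" if "x \<in> bcarrier A" "y \<in> bcarrier A" "ble A x a" "ble A y a" for x y
      using that a unfolding ble_def by (simp add: balg_distrib'(1))
    moreover have "\<not> ble A (bone A) a"
      using a balg_unit(1) balg_comm(1)[OF balg_closed(2)] unfolding ble_def by metis
    moreover have "ble A (bzero A) a"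
      using a balg_bounds(2) balg_comm(1)[OF balg_closed(1)] unfolding ble_def by metis
    moreover have "ble A a a" using a unfolding ble_def by (simp add: balg_idem)
    ultimately show ?thesis
      unfolding Q_def boolean_ideal_def using a by (auto intro: ble_trans balg_closed)
  qed
  then have ne: "Q \<noteq> {}" by blast
  have chain: "\<Union>C \<in> Q" if C: "C \<noteq> {}" "subset.chain Q C" for C
  proof -
    have CQ: "I \<in> Q" if "I \<in> C" for I using C that by (auto simp: subset.chain_def)
    have "bjoin A x y \<in> \<Union>C" if xy: "x \<in> \<Union>C" "y \<in> \<Union>C" for x y
    proof -
      obtain I J where IJ: "I \<in> C" "x \<in> I" "J \<in> C" "y \<in> J" using xy by blast
      then have "I \<subseteq> J \<or> J \<subseteq> I" using C by (auto simp: subset.chain_def)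
      then obtain K where "K \<in> C" "x \<in> K" "y \<in> K" using IJ by blast
      then show ?thesis using CQ unfolding Q_def boolean_ideal_def by blast
    qed
    moreover have "bzero A \<in> \<Union>C" "a \<in> \<Union>C" "bone A \<notin> \<Union>C" "\<Union>C \<subseteq> bcarrier A"
      using C(1) CQ unfolding Q_def boolean_ideal_def by blast+
    moreover have "\<forall>x\<in>\<Union>C. \<forall>y\<in>bcarrier A. ble A y x \<longrightarrow> y \<in> \<Union>C"
      using CQ unfolding Q_def boolean_ideal_def by blast
    ultimately show ?thesis unfolding Q_def boolean_ideal_def by blast
  qed
  obtain I where I: "I \<in> Q" and max: "\<And>J. J \<in> Q \<Longrightarrow> I \<subseteq> J \<Longrightarrow> J = I"
    using subset_Zorn_nonempty[OF ne chain] by blast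
  have id: "boolean_ideal A I" "a \<in> I" "bone A \<notin> I" using I unfolding Q_def by auto
  have "x \<in> I \<or> bneg A x \<in> I" if x: "x \<in> bcarrier A" for x
  proof -
    have x': "bneg A x \<in> bcarrier A" using x by (rule balg_closed)
    \<comment> \<open>\<open>J\<close> is the ideal generated by \<open>I\<close> and
      \<open>x\<close>, described without joins. If it is proper, maximality gives
      \<open>J = I\<close> and so \<open>x\<close> is in \<open>I\<close>; if it contains the unit,
      its definition says that the complement of \<open>x\<close> is in \<open>I\<close>.\<close>
    define J where "J = {y \<in> bcarrier A. bmeet A y (bneg A x) \<in> I}"
    have J: "boolean_ideal A J"
    proof -
      have "bmeet A (bzero A) (bneg A x) = bzero A"
        using balg_bounds(2)[OF x'] balg_comm(1)[OF x' balg_closed(1)] by simp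
      then have "bzero A \<in> J" using id(1) unfolding J_def boolean_ideal_def by (simp add: balg_closed)
      moreover have "bjoin A y z \<in> J" if "y \<in> J" "z \<in> J" for y z
        using that id(1) x' unfolding J_def boolean_ideal_def
        by (simp add: balg_closed balg_distrib'(1))
      moreover have "z \<in> J" if "y \<in> J" "z \<in> bcarrier A" "ble A z y" for y z
        using that id(1) x' ble_meet_mono[of z y "bneg A x"] balg_closed(4)
        unfolding J_def boolean_ideal_def by blast
      ultimately show ?thesis unfolding boolean_ideal_def J_def by blast
    qed
    have IJ: "I \<subseteq> J"
      using id(1) ble_meet(1)[OF _ x'] balg_closed(4)[OF _ x'] unfolding boolean_ideal_def J_def by blast
    have "x \<in> J" unfolding J_def using x id(1) by (simp add: balg_unit boolean_ideal_def)
    show ?thesis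
    proof (cases "bone A \<in> J")
      case True
      then have "bneg A x \<in> I"
        unfolding J_def using balg_comm(1)[OF x' balg_closed(2)] balg_unit(1)[OF x'] by simp
      then show ?thesis ..
    next
      case False
      then have "J \<in> Q" using J IJ id(2) unfolding Q_def by blast
      then show ?thesis using max IJ \<open>x \<in> J\<close> by blast
    qed
  qed
  then show ?thesis using that id by blast
qed

context
  fixes I
  assumes I: "boolean_ideal A I" "bone A \<notin> I" and prime: "\<And>x. x \<in> bcarrier A \<Longrightarrow> x \<in> I \<or> bneg A x \<in> I"
begin

text \<open>With the next two lemmas: non-membership in a prime ideal is a homomorphism to the
  two-element algebra, that is, a point of the Stone space.\<close>

lemma prime_ideal_neg:
  assumes x: "x \<in> bcarrier A"
  shows "bneg A x \<in> I \<longleftrightarrow> x \<notin> I"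
  using prime[OF x] I balg_unit(4)[OF x] unfolding boolean_ideal_def by metis

lemma prime_ideal_join:
  assumes "x \<in> bcarrier A" "y \<in> bcarrier A"
  shows "bjoin A x y \<in> I \<longleftrightarrow> x \<in> I \<and> y \<in> I"
proof -
  have "ble A x (bjoin A x y)" "ble A y (bjoin A x y)"
    using assms balg_absorb(2)[of x y] balg_absorb(2)[of y x] balg_comm(2)[of x y]
    unfolding ble_def by simp_all
  then show ?thesis using I(1) assms unfolding boolean_ideal_def by blast
qed

lemma prime_ideal_meet:
  assumes xy: "x \<in> bcarrier A" "y \<in> bcarrier A"
  shows "bmeet A x y \<in> I \<longleftrightarrow> x \<in> I \<or> y \<in> I"
proof
  assume m: "bmeet A x y \<in> I"
  show "x \<in> I \<or> y \<in> I"
  proof (rule ccontr)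
    assume n: "\<not> (x \<in> I \<or> y \<in> I)"
    then have x': "bneg A x \<in> I" using prime xy by blast
    \<comment> \<open>Joining the meet with the complement of \<open>x\<close> removes
      \<open>x\<close> from it. The result still lies in \<open>I\<close> and is above
      \<open>y\<close>, which contradicts the assumption that \<open>y\<close> is outside
      \<open>I\<close>.\<close>
    have "bjoin A (bmeet A x y) (bneg A x) = bmeet A (bone A) (bjoin A y (bneg A x))"
      using xy by (simp add: balg_distrib'(2) balg_closed balg_unit)
    also have "\<dots> = bjoin A y (bneg A x)"
      using xy by (simp add: balg_comm(1)[of "bone A"] balg_closed balg_unit)
    finally have "bjoin A y (bneg A x) \<in> I" using m x' I(1) unfolding boolean_ideal_def by metis
    then show False using prime_ideal_join xy n balg_closed(3) by blast
  qed
next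
  assume "x \<in> I \<or> y \<in> I"
  then show "bmeet A x y \<in> I"
    using ble_meet[OF xy] balg_closed(4)[OF xy] I(1) unfolding boolean_ideal_def by blast
qed

end

end

subsection \<open>Minimal upper bounds\<close>

lemma finite_minimal:
  assumes "Partial_order r" "finite F" "F \<noteq> {}"
  shows "\<exists>m\<in>F. \<forall>y\<in>F. (y, m) \<in> r \<longrightarrow> y = m"
  using assms(2,3)
proof (induction rule: finite_ne_induct)
  case (insert x F)
  then obtain m where m: "m \<in> F" "\<forall>y\<in>F. (y, m) \<in> r \<longrightarrow> y = m" by blast
  show ?case
  proof (cases "(x, m) \<in> r")
    case True
    then have "\<forall>y\<in>F. (y, x) \<in> r \<longrightarrow> y = x" using m partial_orderD(2,3)[OF assms(1)] by metis
    then show ?thesis by blast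
  next
    case False
    then show ?thesis using m by blast
  qed
qed simp

text \<open>Every element of \<open>U\<close> has a member of \<open>F\<close> below it, so minimal
  elements of \<open>U\<close> are members of \<open>F\<close>. Below \<open>z\<close>, a minimal
  one among the members of \<open>F\<close> under \<open>z\<close> is minimal in all of
  \<open>U\<close>: an element of \<open>U\<close> under it dominates some member of
  \<open>F\<close>, which must be the same one.\<close>

lemma minimal_elems_finitely_generated:
  assumes po: "Partial_order r" and F: "finite F" "F \<subseteq> Field r" "U = {p. \<exists>f\<in>F. (f, p) \<in> r}"
  shows "finite (minimal_elems r U)" and "z \<in> U \<Longrightarrow> \<exists>m\<in>minimal_elems r U. (m, z) \<in> r"
proof -
  have FU: "F \<subseteq> U" using F partial_orderD(1)[OF po] by blast
  have "minimal_elems r U \<subseteq> F"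
    using F(3) FU unfolding minimal_elems_def by blast
  then show "finite (minimal_elems r U)" using F(1) finite_subset by blast
  assume "z \<in> U"
  then have "{f \<in> F. (f, z) \<in> r} \<noteq> {}" using F by blast
  then obtain m where m: "m \<in> F" "(m, z) \<in> r" "\<And>y. y \<in> F \<Longrightarrow> (y, z) \<in> r \<Longrightarrow> (y, m) \<in> r \<Longrightarrow> y = m"
    using finite_minimal[OF po, of "{f \<in> F. (f, z) \<in> r}"] F(1) by auto
  have "u = m" if u: "u \<in> U" "(u, m) \<in> r" for u
  proof -
    obtain f where f: "f \<in> F" "(f, u) \<in> r" using u F(3) by blast
    then have "(f, m) \<in> r" "(f, z) \<in> r" using u m(2) partial_orderD(2)[OF po] by blast+
    then have "f = m" using m(3) f by blast
    then show ?thesis using f u partial_orderD(3)[OF po] by blast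
  qed
  then have "m \<in> minimal_elems r U" using m FU unfolding minimal_elems_def by blast
  then show "\<exists>m\<in>minimal_elems r U. (m, z) \<in> r" using m by blast
qed

context
  fixes X :: "'x rel"
  assumes pjs: "pseudo_join_semilattice X"
begin

lemma pjs_Partial_order: "Partial_order X"
  using pjs unfolding pseudo_join_semilattice_def poset_def by blast

text \<open>The definition speaks of the empty set and of two-element sets, whereas the relations of
  \<open>F(X)\<close> also involve \<open>{u, v}\<close> with \<open>u = v\<close>. In that case
  \<open>u\<close> itself generates the upper bounds.\<close>

lemma pjs_upper_bounds:
  assumes "Y = {} \<or> (\<exists>u\<in>Field X. \<exists>v\<in>Field X. Y = {u, v})"
  shows "\<exists>F. finite F \<and> F \<subseteq> Field X \<and> upper_bounds X Y = {p. \<exists>f\<in>F. (f, p) \<in> X}"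
proof (cases "\<exists>u\<in>Field X. Y = {u}")
  case True
  then obtain u where u: "u \<in> Field X" "Y = {u}" by blast
  then have "upper_bounds X Y = {p. \<exists>f\<in>{u}. (f, p) \<in> X}"
    unfolding upper_bounds_def by (auto simp: FieldI2)
  then show ?thesis using u by blast
next
  case False
  then have "Y = {} \<or> card Y = 2" "Y \<subseteq> Field X" using assms by (auto simp: card_2_iff)
  then show ?thesis using pjs unfolding pseudo_join_semilattice_def by blast
qed

lemma finite_nabla:
  assumes "Y = {} \<or> (\<exists>u\<in>Field X. \<exists>v\<in>Field X. Y = {u, v})"
  shows "finite (nabla X Y)"
  unfolding nabla_def
  using pjs_upper_bounds[OF assms] minimal_elems_finitely_generated(1)[OF pjs_Partial_order] by blast

lemma nabla_below:
  assumes "Y = {} \<or> (\<exists>u\<in>Field X. \<exists>v\<in>Field X. Y = {u, v})" "z \<in> upper_bounds X Y"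
  shows "\<exists>m\<in>nabla X Y. (m, z) \<in> X"
proof -
  obtain F where "finite F" "F \<subseteq> Field X" "upper_bounds X Y = {p. \<exists>f\<in>F. (f, p) \<in> X}"
    using pjs_upper_bounds[OF assms(1)] by blast
  from minimal_elems_finitely_generated(2)[OF pjs_Partial_order this assms(2)]
  show ?thesis unfolding nabla_def .
qed

lemma nabla_upper: "m \<in> nabla X Y \<Longrightarrow> y \<in> Y \<Longrightarrow> (y, m) \<in> X"
  unfolding nabla_def minimal_elems_def upper_bounds_def by blast

lemma nabla_empty: "nabla X {} = minimal_elems X (Field X)"
  unfolding nabla_def upper_bounds_def by simp

lemma ideal_lower: "poset_ideal X I \<Longrightarrow> u \<in> I \<Longrightarrow> (v, u) \<in> X \<Longrightarrow> v \<in> I"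
  unfolding poset_ideal_def by blast

text \<open>A common upper bound inside the ideal dominates a minimal upper bound, which the ideal
  contains as a lower set. This makes the relation \<open>gen_meet\<close> true at every ideal;
  \<open>ideal_minimal\<close> does the same for \<open>gen_top\<close>.\<close>

lemma ideal_nabla:
  assumes I: "poset_ideal X I" and uv: "u \<in> I" "v \<in> I"
  shows "\<exists>w\<in>nabla X {u, v}. w \<in> I"
proof -
  obtain z where z: "z \<in> I" "(u, z) \<in> X" "(v, z) \<in> X" using I uv unfolding poset_ideal_def by blast
  have "u \<in> Field X" "v \<in> Field X" "z \<in> upper_bounds X {u, v}"
    using z FieldI1[OF z(2)] FieldI1[OF z(3)] FieldI2[OF z(2)] unfolding upper_bounds_def by simp_all
  then show ?thesis using nabla_below[of "{u, v}" z] ideal_lower[OF I z(1)] by blast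
qed

lemma ideal_minimal:
  assumes I: "poset_ideal X I"
  shows "\<exists>w\<in>minimal_elems X (Field X). w \<in> I"
proof -
  obtain z where z: "z \<in> I" "z \<in> Field X" using I unfolding poset_ideal_def by blast
  then have "z \<in> upper_bounds X {}" unfolding upper_bounds_def by simp
  then show ?thesis using nabla_below[of "{}" z] ideal_lower[OF I z(1)] nabla_empty by auto
qed

lemma principal_ideal:
  assumes "u \<in> Field X"
  shows "poset_ideal X {v. (v, u) \<in> X}"
  unfolding poset_ideal_def
proof (intro conjI ballI allI impI)
  have u: "(u, u) \<in> X" using partial_orderD(1)[OF pjs_Partial_order assms] .
  then show "{v. (v, u) \<in> X} \<noteq> {}" by blast
  show "{v. (v, u) \<in> X} \<subseteq> Field X" by (auto simp: FieldI1)
  show "y \<in> {v. (v, u) \<in> X}" if "x \<in> {v. (v, u) \<in> X}" "(y, x) \<in> X" for x y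
    using that partial_orderD(2)[OF pjs_Partial_order] by simp
  show "\<exists>z\<in>{v. (v, u) \<in> X}. (x, z) \<in> X \<and> (y, z) \<in> X"
    if "x \<in> {v. (v, u) \<in> X}" "y \<in> {v. (v, u) \<in> X}" for x y
    using that u by blast
qed

end

subsection \<open>Elements of \<open>F(X)\<close> as sets of ideals of \<open>X\<close>\<close>

primrec sat :: "'x set \<Rightarrow> 'x bterm \<Rightarrow> bool" where
  "sat I (Gen u) \<longleftrightarrow> u \<in> I"
| "sat I Zero \<longleftrightarrow> False"
| "sat I One \<longleftrightarrow> True"
| "sat I (Neg s) \<longleftrightarrow> \<not> sat I s"
| "sat I (Meet s t) \<longleftrightarrow> sat I s \<and> sat I t"
| "sat I (Join s t) \<longleftrightarrow> sat I s \<or> sat I t"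

lemma sat_Joins [simp]: "sat I (Joins ts) \<longleftrightarrow> (\<exists>t\<in>set ts. sat I t)"
  unfolding Joins_def by (induction ts) auto

lemma gens_Joins [simp]: "gens (Joins ts) = (\<Union>t\<in>set ts. gens t)"
  unfolding Joins_def by (induction ts) auto

lemma sat_cong: "I \<inter> gens t = J \<inter> gens t \<Longrightarrow> sat I t \<longleftrightarrow> sat J t"
proof (induction t)
  case (Meet s t)
  then have "I \<inter> gens s = J \<inter> gens s" "I \<inter> gens t = J \<inter> gens t" by auto
  then show ?case using Meet by simp
next
  case (Join s t)
  then have "I \<inter> gens s = J \<inter> gens s" "I \<inter> gens t = J \<inter> gens t" by auto
  then show ?case using Join by simp
qed auto

text \<open>The Stone transform of \<open>a\<close>: a clopen subset of the space of ideals of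
  \<open>X\<close>. For elements of \<open>F(X)\<close> the choice of a representative is immaterial
  by \<open>F_cong_sat\<close>.\<close>

definition val :: "'x rel \<Rightarrow> 'x bterm set \<Rightarrow> 'x set set" where
  "val X a = {I. poset_ideal X I \<and> (\<exists>t\<in>a. sat I t)}"

context
  fixes X :: "'x rel"
  assumes pjs: "pseudo_join_semilattice X"
begin

text \<open>Soundness, by induction on the congruence. An ideal is a lower set, directed and
  nonempty, and these properties validate \<open>gen_le\<close>, \<open>gen_meet\<close> and
  \<open>gen_top\<close> respectively.\<close>

lemma F_cong_sat:
  assumes "F_cong X s t" "poset_ideal X I"
  shows "sat I s \<longleftrightarrow> sat I t"
  using assms
proof induction
  case (gen_le u v)
  then show ?case using ideal_lower[OF pjs] by auto
next
  case (gen_meet u v ws)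
  then show ?case using ideal_nabla[OF pjs] ideal_lower[OF pjs] nabla_upper[OF pjs]
    by (auto simp: image_iff)
next
  case (gen_top us)
  then show ?case using ideal_minimal[OF pjs] by auto
qed auto

lemma F_class_eq: "gens s \<subseteq> Field X \<Longrightarrow> F_class X s = F_class X t \<longleftrightarrow> F_cong X s t"
  unfolding F_class_def using F_cong.refl F_cong.sym F_cong.trans by blast

lemma F_class_self: "gens s \<subseteq> Field X \<Longrightarrow> s \<in> F_class X s"
  unfolding F_class_def using F_cong.refl by blast

text \<open>The operations of \<open>F_alg\<close> are unions over all representatives. As
  \<open>F_cong\<close> is a congruence, all sets in such a union are equal, and there is at least
  one because a class contains its own term.\<close>

lemma F_alg_simps:
  shows "bzero (F_alg X) = F_class X Zero" "bone (F_alg X) = F_class X One"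
    and "gens s \<subseteq> Field X \<Longrightarrow> bneg (F_alg X) (F_class X s) = F_class X (Neg s)"
    and "gens s \<subseteq> Field X \<Longrightarrow> gens t \<subseteq> Field X \<Longrightarrow>
      bmeet (F_alg X) (F_class X s) (F_class X t) = F_class X (Meet s t)"
    and "gens s \<subseteq> Field X \<Longrightarrow> gens t \<subseteq> Field X \<Longrightarrow>
      bjoin (F_alg X) (F_class X s) (F_class X t) = F_class X (Join s t)"
proof -
  show "bzero (F_alg X) = F_class X Zero" "bone (F_alg X) = F_class X One" by (simp_all add: F_alg_def)
  have in_cl: "gens s' \<subseteq> Field X" "F_cong X s' s" if "s' \<in> F_class X s" for s s'
    using that unfolding F_class_def by auto
  {
    assume s: "gens s \<subseteq> Field X"
    have "F_class X (Neg s') = F_class X (Neg s)" if "s' \<in> F_class X s" for s'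
      using in_cl[OF that] F_cong.neg by (subst F_class_eq) auto
    then have "(\<Union>s'\<in>F_class X s. F_class X (Neg s')) = (\<Union>s'\<in>F_class X s. F_class X (Neg s))"
      by (intro SUP_cong) auto
    then show "bneg (F_alg X) (F_class X s) = F_class X (Neg s)"
      using F_class_self[OF s] unfolding F_alg_def by auto
    assume t: "gens t \<subseteq> Field X"
    have "F_class X (Meet s' t') = F_class X (Meet s t)" "F_class X (Join s' t') = F_class X (Join s t)"
      if "s' \<in> F_class X s" "t' \<in> F_class X t" for s' t'
      using in_cl[OF that(1)] in_cl[OF that(2)] F_cong.meet F_cong.join
      by (simp_all add: F_class_eq)
    then have
      "(\<Union>s'\<in>F_class X s. \<Union>t'\<in>F_class X t. F_class X (Meet s' t')) =
       (\<Union>s'\<in>F_class X s. \<Union>t'\<in>F_class X t. F_class X (Meet s t))"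
      "(\<Union>s'\<in>F_class X s. \<Union>t'\<in>F_class X t. F_class X (Join s' t')) =
       (\<Union>s'\<in>F_class X s. \<Union>t'\<in>F_class X t. F_class X (Join s t))"
      by (intro SUP_cong; blast)+
    then show "bmeet (F_alg X) (F_class X s) (F_class X t) = F_class X (Meet s t)"
      "bjoin (F_alg X) (F_class X s) (F_class X t) = F_class X (Join s t)"
      using F_class_self[OF s] F_class_self[OF t] unfolding F_alg_def by auto
  }
qed

lemma F_carrier: "bcarrier (F_alg X) = F_class X ` {t. gens t \<subseteq> Field X}"
  by (simp add: F_alg_def)

lemma F_carrierI: "gens t \<subseteq> Field X \<Longrightarrow> F_class X t \<in> bcarrier (F_alg X)"
  unfolding F_carrier by blast

lemma F_carrierE:
  assumes "a \<in> bcarrier (F_alg X)"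
  obtains t where "gens t \<subseteq> Field X" "a = F_class X t"
  using assms unfolding F_carrier by blast

lemma boolean_alg_F: "boolean_alg (F_alg X)"
  unfolding boolean_alg_def F_carrier
  by (auto simp: F_alg_simps F_class_eq intro!: imageI F_cong.intros)

lemma val_class: "gens t \<subseteq> Field X \<Longrightarrow> val X (F_class X t) = {I. poset_ideal X I \<and> sat I t}"
  unfolding val_def F_class_def using F_cong_sat F_cong.refl by blast

lemma val_simps:
  shows "val X (bzero (F_alg X)) = {}" "val X (bone (F_alg X)) = {I. poset_ideal X I}"
    and "a \<in> bcarrier (F_alg X) \<Longrightarrow> val X (bneg (F_alg X) a) = {I. poset_ideal X I} - val X a"
    and "a \<in> bcarrier (F_alg X) \<Longrightarrow> b \<in> bcarrier (F_alg X) \<Longrightarrow>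
      val X (bmeet (F_alg X) a b) = val X a \<inter> val X b"
    and "a \<in> bcarrier (F_alg X) \<Longrightarrow> b \<in> bcarrier (F_alg X) \<Longrightarrow>
      val X (bjoin (F_alg X) a b) = val X a \<union> val X b"
  by (auto simp: F_alg_simps val_class elim!: F_carrierE)

text \<open>Completeness, the converse of \<open>F_cong_sat\<close>: a point of the Stone space is
  evaluation at the set \<open>I\<close> of generators it makes true. The defining relations, read
  at this point, force \<open>I\<close> to be nonempty, lower and directed; finiteness of the sets
  of minimal upper bounds is what provides the lists in these relations.\<close>

lemma prime_ideal_poset_ideal:
  assumes Q: "boolean_ideal (F_alg X) Q" "bone (F_alg X) \<notin> Q"
    and prime: "\<And>x. x \<in> bcarrier (F_alg X) \<Longrightarrow> x \<in> Q \<or> bneg (F_alg X) x \<in> Q"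
  defines "I \<equiv> {u \<in> Field X. F_class X (Gen u) \<notin> Q}"
  shows "gens t \<subseteq> Field X \<Longrightarrow> F_class X t \<notin> Q \<longleftrightarrow> sat I t" and "poset_ideal X I"
proof -
  note pr = prime_ideal_neg[OF boolean_alg_F Q prime] prime_ideal_meet[OF boolean_alg_F Q prime]
    prime_ideal_join[OF boolean_alg_F Q prime]
  have sat: "F_class X t \<notin> Q \<longleftrightarrow> sat I t" if "gens t \<subseteq> Field X" for t
    using that
  proof (induction t)
    case Zero
    then show ?case using Q(1) by (simp add: boolean_ideal_def flip: F_alg_simps(1))
  next
    case One
    then show ?case using Q(2) by (simp flip: F_alg_simps(2))
  next
    case (Neg t)
    then show ?case using pr(1)[of "F_class X t"] by (simp add: F_carrierI F_alg_simps)
  next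
    case (Meet s t)
    then show ?case using pr(2)[of "F_class X s" "F_class X t"] by (simp add: F_carrierI F_alg_simps)
  next
    case (Join s t)
    then show ?case using pr(3)[of "F_class X s" "F_class X t"] by (simp add: F_carrierI F_alg_simps)
  qed (simp add: I_def)
  then show "gens t \<subseteq> Field X \<Longrightarrow> F_class X t \<notin> Q \<longleftrightarrow> sat I t" .
  have transfer: "sat I s \<longleftrightarrow> sat I t"
    if "F_cong X s t" "gens s \<subseteq> Field X" "gens t \<subseteq> Field X" for s t
    using sat that F_class_eq by metis
  have "I \<noteq> {}"
  proof -
    obtain us where us: "set us = minimal_elems X (Field X)"
      using finite_nabla[OF pjs, of "{}"] nabla_empty[OF pjs] finite_list by metis
    then have "set us \<subseteq> Field X" by (auto simp: minimal_elems_def)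
    then have "sat I (Joins (map Gen us))" using transfer[OF F_cong.gen_top[OF us]] by auto
    then show ?thesis by auto
  qed
  moreover have "v \<in> I" if "u \<in> I" "(v, u) \<in> X" for u v
    using transfer[OF F_cong.gen_le[OF that(2)]] that by (auto simp: FieldI1 FieldI2)
  moreover have "\<exists>w\<in>I. (u, w) \<in> X \<and> (v, w) \<in> X" if uv: "u \<in> I" "v \<in> I" for u v
  proof -
    have F: "u \<in> Field X" "v \<in> Field X" using uv by (auto simp: I_def)
    then obtain ws where ws: "set ws = nabla X {u, v}"
      using finite_nabla[OF pjs, of "{u, v}"] finite_list by blast
    then have "set ws \<subseteq> Field X" by (auto simp: minimal_elems_def nabla_def upper_bounds_def)
    then have "sat I (Joins (map Gen ws))" using transfer[OF F_cong.gen_meet[OF F ws]] F uv by auto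
    then obtain w where "w \<in> I" "w \<in> nabla X {u, v}" using ws by auto
    then show ?thesis using nabla_upper[OF pjs, of w "{u, v}"] by blast
  qed
  moreover have "I \<subseteq> Field X" by (auto simp: I_def)
  ultimately show "poset_ideal X I" unfolding poset_ideal_def by (intro conjI) blast+
qed

text \<open>If \<open>c\<close> is not zero, its complement lies in a prime ideal that omits
  \<open>c\<close>, and the corresponding ideal of \<open>X\<close> belongs to
  \<open>val X c\<close>. Applied to the differences of \<open>a\<close> and \<open>b\<close>, this
  gives equality, so all computations in \<open>F(X)\<close> can be done with sets of
  ideals.\<close>

lemma val_inj:
  assumes a: "a \<in> bcarrier (F_alg X)" and b: "b \<in> bcarrier (F_alg X)" and eq: "val X a = val X b"
  shows "a = b"
proof (rule ccontr)
  let ?F = "F_alg X"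
  note B = boolean_alg_F
  note cl = balg_closed[OF B]
  have zero: "c = bzero ?F" if c: "c \<in> bcarrier ?F" and v: "val X c = {}" for c
  proof (rule ccontr)
    assume nz: "c \<noteq> bzero ?F"
    have "bneg ?F c \<noteq> bone ?F" using balg_unit(1,3)[OF B c] nz by metis
    then obtain Q where Q: "boolean_ideal ?F Q" "bneg ?F c \<in> Q" "bone ?F \<notin> Q"
      and prime: "\<And>x. x \<in> bcarrier ?F \<Longrightarrow> x \<in> Q \<or> bneg ?F x \<in> Q"
      using prime_ideal_exists[OF B cl(3)[OF c]] by blast
    have "c \<notin> Q" using prime_ideal_neg[OF B Q(1,3) prime c] Q(2) by blast
    moreover obtain t where t: "gens t \<subseteq> Field X" "c = F_class X t" using c by (rule F_carrierE)
    ultimately show False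
      using prime_ideal_poset_ideal[OF Q(1,3) prime] v val_class[OF t(1)] by blast
  qed
  have le: "bmeet ?F x y = x"
    if x: "x \<in> bcarrier ?F" and y: "y \<in> bcarrier ?F" and e: "val X x = val X y" for x y
  proof -
    have "bmeet ?F x (bneg ?F y) = bzero ?F"
      by (rule zero) (use x y e in \<open>auto simp: cl val_simps\<close>)
    moreover have "x = bjoin ?F (bmeet ?F x y) (bmeet ?F x (bneg ?F y))"
      using balg_distrib(1)[OF B x y cl(3)[OF y]] balg_unit[OF B] x y by simp
    ultimately show ?thesis using balg_unit(2)[OF B cl(4)[OF x y]] by simp
  qed
  assume "a \<noteq> b"
  then show False using le[OF a b eq] le[OF b a eq[symmetric]] balg_comm(1)[OF B a b] by simp
qed

lemma ble_F:
  assumes "a \<in> bcarrier (F_alg X)" "b \<in> bcarrier (F_alg X)"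
  shows "ble (F_alg X) a b \<longleftrightarrow> val X a \<subseteq> val X b"
proof -
  have "bmeet (F_alg X) a b = a \<longleftrightarrow> val X a \<inter> val X b = val X a"
    using val_inj[OF balg_closed(4)[OF boolean_alg_F assms] assms(1)] val_simps(4)[OF assms] by metis
  then show ?thesis unfolding ble_def by blast
qed

end

section \<open>Scaled subalgebras of \<open>F(X)\<close>\<close>

lemma Bool_cat_nt_hom:
  "f \<in> hom (Bool_cat_nt P) A B \<longleftrightarrow> (\<exists>g. f = (A, g, B) \<and> scaled_boolean_alg P A \<and>
     scaled_boolean_alg P B \<and> g \<in> extensional (bcarrier A) \<and> boolean_hom A B g \<and>
     (\<forall>p\<in>Field P. g ` level A p \<subseteq> level B p) \<and> bzero A \<noteq> bone A \<and> bzero B \<noteq> bone B)"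
  unfolding hom_def Bool_cat_nt_def Bool_cat_def by auto

lemma Bool_cat_nt_simps:
  "A \<in> Obj (Bool_cat_nt P) \<longleftrightarrow> scaled_boolean_alg P A \<and> bzero A \<noteq> bone A"
  "Cmp (Bool_cat_nt P) (B, g, C) (A, f, B') = (A, compose (bcarrier A) g f, C)"
  "Ident (Bool_cat_nt P) A = (A, \<lambda>x\<in>bcarrier A. x, A)"
  unfolding Bool_cat_nt_def Bool_cat_def by auto

lemma ideal_gen_ideal:
  assumes "boolean_alg A" "U \<subseteq> bcarrier A"
  shows "boolean_ideal A (ideal_gen A U)" "U \<subseteq> ideal_gen A U"
proof -
  have "boolean_ideal A (bcarrier A)"
    using balg_closed[OF assms(1)] unfolding boolean_ideal_def by auto
  then have "ideal_gen A U \<subseteq> bcarrier A" unfolding ideal_gen_def using assms(2) by blast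
  then show "boolean_ideal A (ideal_gen A U)"
    unfolding boolean_ideal_def ideal_gen_def by (intro conjI) blast+
  show "U \<subseteq> ideal_gen A U" unfolding ideal_gen_def by blast
qed

lemma ideal_gen_least: "boolean_ideal A J \<Longrightarrow> U \<subseteq> J \<Longrightarrow> ideal_gen A U \<subseteq> J"
  unfolding ideal_gen_def by blast

locale covering =
  fixes P :: "'p rel" and X :: "'x rel" and d :: "'x \<Rightarrow> 'p"
  assumes poset_P: "poset P" and covering: "norm_covering P X d"
begin

abbreviation BC :: "(('x bterm set, 'p) sbalg,
    ('x bterm set, 'p) sbalg \<times> ('x bterm set \<Rightarrow> 'x bterm set) \<times> ('x bterm set, 'p) sbalg) cat" where
  "BC \<equiv> Bool_cat_nt P"
abbreviation F where "F \<equiv> F_alg X"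
abbreviation pts where "pts \<equiv> {I. poset_ideal X I}"

lemma pjs: "pseudo_join_semilattice X"
  and d_field: "u \<in> Field X \<Longrightarrow> d u \<in> Field P"
  and d_mono: "(u, v) \<in> X \<Longrightarrow> (d u, d v) \<in> P"
  using covering unfolding norm_covering_def by auto

lemmas P_order = partial_orderD[of P]
lemma P_po: "Partial_order P" using poset_P unfolding poset_def by blast
lemma X_po: "Partial_order X" using pjs_Partial_order[OF pjs] .

lemma pts_nonempty: "pts \<noteq> {}"
proof -
  have "X \<noteq> {}" using pjs unfolding pseudo_join_semilattice_def poset_def by blast
  then obtain u where "u \<in> Field X" by (auto simp: Field_def)
  then show ?thesis using principal_ideal[OF pjs] by blast
qed

text \<open>A principal ideal of \<open>X\<close> separates zero from one. All subalgebras share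
  these two elements, so all of them are objects of \<open>Bool_cat_nt\<close>.\<close>

lemma zero_one: "bzero F \<noteq> bone F"
  using val_simps(1,2)[OF pjs] pts_nonempty by metis

lemma F_closed:
  shows "bzero F \<in> bcarrier F" "bone F \<in> bcarrier F" "x \<in> bcarrier F \<Longrightarrow> bneg F x \<in> bcarrier F"
    and "x \<in> bcarrier F \<Longrightarrow> y \<in> bcarrier F \<Longrightarrow> bmeet F x y \<in> bcarrier F"
    and "x \<in> bcarrier F \<Longrightarrow> y \<in> bcarrier F \<Longrightarrow> bjoin F x y \<in> bcarrier F"
  using balg_closed[OF boolean_alg_F[OF pjs]] by auto

lemmas F_val = val_simps[OF pjs]
lemmas F_inj = val_inj[OF pjs]

text \<open>The operations are those of \<open>F\<close> on the whole type, not cut down to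
  \<open>K\<close>. Algebras of this form differ only in carrier and levels, and the morphisms
  between them used below are mostly inclusions.\<close>

definition sub :: "'x bterm set set \<Rightarrow> ('p \<Rightarrow> 'x bterm set set) \<Rightarrow> ('x bterm set, 'p) sbalg" where
  "sub K l = \<lparr>bcarrier = K, bmeet = bmeet F, bjoin = bjoin F, bneg = bneg F,
     bzero = bzero F, bone = bone F, level = l\<rparr>"

lemma sub_simps [simp]:
  "bcarrier (sub K l) = K" "bmeet (sub K l) = bmeet F" "bjoin (sub K l) = bjoin F"
  "bneg (sub K l) = bneg F" "bzero (sub K l) = bzero F" "bone (sub K l) = bone F"
  "level (sub K l) = l" "ble (sub K l) = ble F"
  by (simp_all add: sub_def ble_def fun_eq_iff)

definition subalg where
  "subalg K \<longleftrightarrow> K \<subseteq> bcarrier F \<and> bzero F \<in> K \<and> bone F \<in> K \<and> (\<forall>a\<in>K. bneg F a \<in> K) \<and>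
     (\<forall>a\<in>K. \<forall>b\<in>K. bmeet F a b \<in> K \<and> bjoin F a b \<in> K)"

lemma boolean_alg_sub:
  assumes "subalg K"
  shows "boolean_alg (sub K l)"
proof -
  note B = boolean_alg_F[OF pjs]
  have K: "a \<in> bcarrier F" if "a \<in> K" for a using assms that unfolding subalg_def by blast
  have K': "bzero F \<in> K" "bone F \<in> K" "\<And>a. a \<in> K \<Longrightarrow> bneg F a \<in> K"
    "\<And>a b. a \<in> K \<Longrightarrow> b \<in> K \<Longrightarrow> bmeet F a b \<in> K" "\<And>a b. a \<in> K \<Longrightarrow> b \<in> K \<Longrightarrow> bjoin F a b \<in> K"
    using assms unfolding subalg_def by blast+
  show ?thesis
    unfolding boolean_alg_def sub_simps
    by (intro conjI ballI; (rule K' balg_unit[OF B K] balg_comm[OF B K K] balg_distrib[OF B K K K]; assumption?))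
qed

definition SA where
  "SA = {A. \<exists>K l. A = sub K l \<and> subalg K \<and> scaled_boolean_alg P A}"

definition le :: "('x bterm set, 'p) sbalg \<Rightarrow> ('x bterm set, 'p) sbalg \<Rightarrow> bool" where
  "le A B \<longleftrightarrow> bcarrier A \<subseteq> bcarrier B \<and> (\<forall>p\<in>Field P. level A p \<subseteq> level B p)"

definition incl :: "('x bterm set, 'p) sbalg \<Rightarrow> ('x bterm set, 'p) sbalg \<Rightarrow> _" where
  "incl A B = (A, \<lambda>x\<in>bcarrier A. x, B)"

lemma SA_subalg: "A \<in> SA \<Longrightarrow> subalg (bcarrier A)"
  and SA_scaled: "A \<in> SA \<Longrightarrow> scaled_boolean_alg P A"
  and SA_carrier: "A \<in> SA \<Longrightarrow> bcarrier A \<subseteq> bcarrier F"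
  and SA_ops: "A \<in> SA \<Longrightarrow> bmeet A = bmeet F" "A \<in> SA \<Longrightarrow> bjoin A = bjoin F"
    "A \<in> SA \<Longrightarrow> bneg A = bneg F" "A \<in> SA \<Longrightarrow> bzero A = bzero F" "A \<in> SA \<Longrightarrow> bone A = bone F"
    "A \<in> SA \<Longrightarrow> ble A = ble F"
  unfolding SA_def subalg_def by auto

lemma SA_boolean: "A \<in> SA \<Longrightarrow> boolean_alg A"
  using SA_scaled unfolding scaled_boolean_alg_def by blast

lemma SA_level: "A \<in> SA \<Longrightarrow> p \<in> Field P \<Longrightarrow> level A p \<subseteq> bcarrier A"
  using SA_scaled[of A] unfolding scaled_boolean_alg_def boolean_ideal_def by blast

lemma SA_obj: "A \<in> SA \<Longrightarrow> A \<in> Obj BC"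
  using SA_scaled SA_ops zero_one by (auto simp: Bool_cat_nt_simps)

lemma incl_hom:
  assumes A: "A \<in> SA" and B: "B \<in> SA" and le: "le A B"
  shows "incl A B \<in> hom BC A B"
proof -
  have "boolean_hom A B (\<lambda>x\<in>bcarrier A. x)"
    using balg_closed[OF SA_boolean[OF A]] SA_ops[OF A] SA_ops[OF B] le
    unfolding boolean_hom_def le_def by auto
  moreover have "(\<lambda>x\<in>bcarrier A. x) ` level A p \<subseteq> level B p" if "p \<in> Field P" for p
    using le SA_level[OF A that] that unfolding le_def by force
  ultimately show ?thesis
    using SA_scaled A B SA_ops zero_one unfolding Bool_cat_nt_hom incl_def by auto
qed

lemma incl_cmp:
  assumes "le A B"
  shows "Cmp BC (B, g, C) (incl A B) = (A, \<lambda>x\<in>bcarrier A. g x, C)"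
  using assms unfolding incl_def Bool_cat_nt_simps compose_def le_def
  by (auto simp: restrict_def fun_eq_iff)

lemma incl_incl:
  assumes "le A B" "le B C"
  shows "Cmp BC (incl B C) (incl A B) = incl A C"
  using assms unfolding incl_def Bool_cat_nt_simps compose_def le_def
  by (auto simp: restrict_def fun_eq_iff)

definition diag :: "('i \<Rightarrow> ('x bterm set, 'p) sbalg) \<Rightarrow> ('i, ('x bterm set, 'p) sbalg, _) diagram" where
  "diag G = \<lparr>FO = G, FA = \<lambda>(i, j). incl (G i) (G j)\<rparr>"

lemma diag_simps [simp]: "FO (diag G) = G" "FA (diag G) (i, j) = incl (G i) (G j)"
  by (simp_all add: diag_def)

lemma diag_functor:
  assumes "Partial_order r" "category BC"
    and "\<And>i. i \<in> Field r \<Longrightarrow> G i \<in> SA" "\<And>i j. (i, j) \<in> r \<Longrightarrow> le (G i) (G j)"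
  shows "is_functor (poset_cat r) BC (diag G)"
  unfolding is_functor_poset[OF assms(1)]
proof (intro conjI allI impI ballI)
  show "category BC" by fact
  show "FO (diag G) x \<in> Obj BC"
    "FA (diag G) (x, x) = Ident BC (FO (diag G) x)"
    if "x \<in> Field r" for x
    using SA_obj assms(3) that by (auto simp: incl_def Bool_cat_nt_simps)
  show "FA (diag G) (x, y) \<in> hom BC (FO (diag G) x) (FO (diag G) y)"
    if "(x, y) \<in> r" for x y
    using incl_hom assms(3,4) FieldI1[OF that] FieldI2[OF that] that by simp
  show "FA (diag G) (x, z) = Cmp BC (FA (diag G) (y, z)) (FA (diag G) (x, y))"
    if "(x, y) \<in> r" "(y, z) \<in> r" for x y z
    using incl_incl assms(4) that by simp
qed

section \<open>Directed unions of scaled subalgebras\<close>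

context
  fixes r :: "'i rel" and G A
  assumes dir: "directed r" and G: "\<And>i. i \<in> Field r \<Longrightarrow> G i \<in> SA"
    and mono: "\<And>i j. (i, j) \<in> r \<Longrightarrow> le (G i) (G j)"
    and A: "A = sub (bcarrier A) (level A)" "bcarrier A = (\<Union>i\<in>Field r. bcarrier (G i))"
      "\<And>p. p \<in> Field P \<Longrightarrow> level A p = (\<Union>i\<in>Field r. level (G i) p)"
begin

private lemma po: "Partial_order r" and ne: "Field r \<noteq> {}"
  using dir unfolding directed_def poset_def by (auto simp: Field_def)

private lemma two:
  assumes "i \<in> Field r" "j \<in> Field r"
  obtains k where "k \<in> Field r" "le (G i) (G k)" "le (G j) (G k)"
  using assms dir mono FieldI2 unfolding directed_def by metis

private lemma ops: "bmeet A = bmeet F" "bjoin A = bjoin F"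
    "bneg A = bneg F" "bzero A = bzero F" "bone A = bone F" "ble A = ble F"
  by (subst A(1), simp)+

lemma union_carrier2:
  assumes "x \<in> bcarrier A" "y \<in> bcarrier A"
  obtains k where "k \<in> Field r" "x \<in> bcarrier (G k)" "y \<in> bcarrier (G k)"
proof -
  obtain i j where ij: "i \<in> Field r" "x \<in> bcarrier (G i)" "j \<in> Field r" "y \<in> bcarrier (G j)"
    using assms A(2) by auto
  obtain k where "k \<in> Field r" "le (G i) (G k)" "le (G j) (G k)" using two ij by metis
  then show ?thesis using that ij unfolding le_def by blast
qed

lemma union_subalg: "subalg (bcarrier A)"
proof -
  have s: "subalg (bcarrier (G i))" if "i \<in> Field r" for i using SA_subalg G that by blast
  have "bmeet F x y \<in> bcarrier A \<and> bjoin F x y \<in> bcarrier A"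
    if xy: "x \<in> bcarrier A" "y \<in> bcarrier A" for x y
  proof -
    obtain k where k: "k \<in> Field r" "x \<in> bcarrier (G k)" "y \<in> bcarrier (G k)"
      using union_carrier2[OF xy] .
    then have "bmeet F x y \<in> bcarrier (G k) \<and> bjoin F x y \<in> bcarrier (G k)"
      using s[OF k(1)] unfolding subalg_def by blast
    then show ?thesis using k(1) A(2) by blast
  qed
  moreover have "bcarrier A \<subseteq> bcarrier F" "bzero F \<in> bcarrier A" "bone F \<in> bcarrier A"
    "\<forall>a\<in>bcarrier A. bneg F a \<in> bcarrier A"
    using s ne unfolding subalg_def A(2) by blast+
  ultimately show ?thesis unfolding subalg_def by blast
qed

private lemma restrict_ideal:
  assumes J: "boolean_ideal A J" and i: "i \<in> Field r"
  shows "boolean_ideal (G i) (J \<inter> bcarrier (G i))"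
proof -
  have "subalg (bcarrier (G i))" "bcarrier (G i) \<subseteq> bcarrier A" using SA_subalg[OF G[OF i]] A(2) i by auto
  then show ?thesis
    using J unfolding boolean_ideal_def ops subalg_def SA_ops[OF G[OF i]]
    by (intro conjI ballI impI) auto
qed

text \<open>Every ideal of the union restricts to an ideal of each stage by
  \<open>restrict_ideal\<close>, so whatever is generated at a stage is generated in the union. The
  axioms on joins of levels pass to the union in this way.\<close>

private lemma ideal_gen_restrict:
  assumes i: "i \<in> Field r" and U: "U \<subseteq> bcarrier (G i)" "U \<subseteq> V"
  shows "ideal_gen (G i) U \<subseteq> ideal_gen A V"
proof -
  have "ideal_gen (G i) U \<subseteq> J" if "boolean_ideal A J" "V \<subseteq> J" for J
    using ideal_gen_least[OF restrict_ideal[OF that(1) i]] that(2) U by blast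
  then show ?thesis unfolding ideal_gen_def[of A V] by blast
qed

lemma union_level_ideal:
  assumes p: "p \<in> Field P"
  shows "boolean_ideal A (level A p)"
proof -
  have lev: "boolean_ideal (G i) (level (G i) p)" if "i \<in> Field r" for i
    using SA_scaled[OF G[OF that]] p unfolding scaled_boolean_alg_def by blast
  have "bzero F \<in> level A p" using lev ne SA_ops(4)[OF G] A(3)[OF p] unfolding boolean_ideal_def by auto
  moreover have "level A p \<subseteq> bcarrier A" using SA_level[OF G p] unfolding A(2) A(3)[OF p] by blast
  moreover have "bjoin F x y \<in> level A p" if xy: "x \<in> level A p" "y \<in> level A p" for x y
  proof -
    obtain i j where ij: "i \<in> Field r" "x \<in> level (G i) p" "j \<in> Field r" "y \<in> level (G j) p"
      using xy A(3)[OF p] by auto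
    obtain k where k: "k \<in> Field r" "le (G i) (G k)" "le (G j) (G k)" using two ij by metis
    then have "x \<in> level (G k) p" "y \<in> level (G k) p" using ij p unfolding le_def by auto
    then have "bjoin F x y \<in> level (G k) p"
      using lev[OF k(1)] SA_ops(2)[OF G[OF k(1)]] unfolding boolean_ideal_def by auto
    then show ?thesis using k A(3)[OF p] by auto
  qed
  moreover have "y \<in> level A p" if x: "x \<in> level A p" and y: "y \<in> bcarrier A" "ble F y x" for x y
  proof -
    obtain i j where ij: "i \<in> Field r" "x \<in> level (G i) p" "j \<in> Field r" "y \<in> bcarrier (G j)"
      using x y A(2) A(3)[OF p] by auto
    obtain k where k: "k \<in> Field r" "le (G i) (G k)" "le (G j) (G k)" using two ij by metis
    then have "x \<in> level (G k) p" "y \<in> bcarrier (G k)" using ij p unfolding le_def by auto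
    then have "y \<in> level (G k) p"
      using lev[OF k(1)] SA_ops(6)[OF G[OF k(1)]] y(2) unfolding boolean_ideal_def by auto
    then show ?thesis using k A(3)[OF p] by auto
  qed
  ultimately show ?thesis unfolding boolean_ideal_def ops by blast
qed

text \<open>Each axiom of a scaled algebra concerns at most two elements or two levels at a time.
  Directedness brings these into one stage, where the axiom is known.\<close>

lemma union_SA: "A \<in> SA"
proof -
  have bA: "boolean_alg A" using boolean_alg_sub[OF union_subalg] A(1) by metis
  have sc: "scaled_boolean_alg P (G i)" if "i \<in> Field r" for i
    using SA_scaled[OF G[OF that]] .
  note lid = union_level_ideal
  have lsub: "level A p \<subseteq> bcarrier A" if "p \<in> Field P" for p
    using lid[OF that] unfolding boolean_ideal_def by blast
  have glsub: "level (G i) p \<subseteq> bcarrier (G i)" "level (G i) p \<subseteq> level A p"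
    if "p \<in> Field P" "i \<in> Field r" for p i
    using that SA_level[OF G] A(3) by auto
  have "bcarrier A = ideal_gen A (\<Union>p\<in>Field P. level A p)"
  proof
    show "ideal_gen A (\<Union>p\<in>Field P. level A p) \<subseteq> bcarrier A"
      using ideal_gen_ideal(1)[OF bA, of "\<Union>p\<in>Field P. level A p"] lsub
      unfolding boolean_ideal_def by blast
    show "bcarrier A \<subseteq> ideal_gen A (\<Union>p\<in>Field P. level A p)"
    proof
      fix x assume "x \<in> bcarrier A"
      then obtain i where i: "i \<in> Field r" "x \<in> bcarrier (G i)" using A(2) by blast
      then have "x \<in> ideal_gen (G i) (\<Union>p\<in>Field P. level (G i) p)"
        using sc unfolding scaled_boolean_alg_def by blast
      moreover have "ideal_gen (G i) (\<Union>p\<in>Field P. level (G i) p) \<subseteq> ideal_gen A (\<Union>p\<in>Field P. level A p)"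
        by (rule ideal_gen_restrict[OF i(1)]) (intro UN_least UN_mono subset_refl glsub i(1); assumption)+
      ultimately show "x \<in> ideal_gen A (\<Union>p\<in>Field P. level A p)" by (rule subsetD[rotated])
    qed
  qed
  moreover have "level A p \<inter> level A q = ideal_gen A (\<Union>s\<in>upper_bounds P {p, q}. level A s)"
    if pq: "p \<in> Field P" "q \<in> Field P" for p q
  proof
    let ?U = "upper_bounds P {p, q}"
    have U: "s \<in> Field P" if "s \<in> ?U" for s using that unfolding upper_bounds_def by blast
    have Gpq: "level (G i) p \<inter> level (G i) q = ideal_gen (G i) (\<Union>s\<in>?U. level (G i) s)"
      if "i \<in> Field r" for i
      using sc[OF that] pq unfolding scaled_boolean_alg_def by blast
    show "level A p \<inter> level A q \<subseteq> ideal_gen A (\<Union>s\<in>?U. level A s)"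
    proof
      fix x assume "x \<in> level A p \<inter> level A q"
      then obtain i j where ij: "i \<in> Field r" "x \<in> level (G i) p" "j \<in> Field r" "x \<in> level (G j) q"
        using A(3) pq by auto
      obtain k where k: "k \<in> Field r" "le (G i) (G k)" "le (G j) (G k)" using two ij by metis
      then have "x \<in> level (G k) p \<inter> level (G k) q" using ij pq unfolding le_def by auto
      then have "x \<in> ideal_gen (G k) (\<Union>s\<in>?U. level (G k) s)" unfolding Gpq[OF k(1)] .
      moreover have "ideal_gen (G k) (\<Union>s\<in>?U. level (G k) s) \<subseteq> ideal_gen A (\<Union>s\<in>?U. level A s)"
        by (rule ideal_gen_restrict[OF k(1)])
          (intro UN_least UN_mono subset_refl glsub k(1); erule U)+
      ultimately show "x \<in> ideal_gen A (\<Union>s\<in>?U. level A s)" by (rule subsetD[rotated])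
    qed
    have "level A s \<subseteq> level A p \<inter> level A q" if s: "s \<in> ?U" for s
    proof
      fix x assume "x \<in> level A s"
      then obtain i where i: "i \<in> Field r" "x \<in> level (G i) s" using A(3)[OF U[OF s]] by blast
      have "(\<Union>s\<in>?U. level (G i) s) \<subseteq> bcarrier (G i)" using glsub(1) U i(1) by blast
      then have "x \<in> ideal_gen (G i) (\<Union>s\<in>?U. level (G i) s)"
        using ideal_gen_ideal(2)[OF SA_boolean[OF G[OF i(1)]]] i(2) s by blast
      then have "x \<in> level (G i) p \<inter> level (G i) q" using Gpq[OF i(1)] by blast
      then show "x \<in> level A p \<inter> level A q" using glsub(2) pq i(1) by blast
    qed
    moreover have "boolean_ideal A (level A p \<inter> level A q)"
      using lid[OF pq(1)] lid[OF pq(2)] unfolding boolean_ideal_def by (intro conjI) blast+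
    ultimately show "ideal_gen A (\<Union>s\<in>?U. level A s) \<subseteq> level A p \<inter> level A q"
      by (intro ideal_gen_least) blast+
  qed
  ultimately have "scaled_boolean_alg P A"
    unfolding scaled_boolean_alg_def using bA lid by blast
  then show ?thesis unfolding SA_def using A(1) union_subalg by blast
qed

lemma union_le: "i \<in> Field r \<Longrightarrow> le (G i) A"
  unfolding le_def using A(2,3) by blast

text \<open>A cocone is a family of maps that agree on overlaps, since two stages lie in a third.
  They glue to one map on the union; it is a morphism because each equation and each level condition
  can be tested at a stage.\<close>

lemma union_colimit:
  assumes cat: "category BC"
  shows "is_colimit (poset_cat r) BC (diag G) A (\<lambda>i. incl (G i) A)"
proof -
  let ?C = BC
  have "is_cocone (poset_cat r) ?C (diag G) A (\<lambda>i. incl (G i) A)"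
    unfolding is_cocone_poset diag_simps
    using SA_obj[OF union_SA] incl_hom[OF G union_SA union_le] incl_incl[OF mono union_le] FieldI2
    by fast
  moreover have "\<exists>!h. h \<in> hom ?C A c \<and> (\<forall>i\<in>Field r. Cmp ?C h (incl (G i) A) = s i)"
    if co: "is_cocone (poset_cat r) ?C (diag G) c s" for c s
  proof -
    define f where "f i = fst (snd (s i))" for i
    have sh: "s i \<in> hom ?C (G i) c" if "i \<in> Field r" for i
      using co that unfolding is_cocone_poset by simp
    have s: "s i = (G i, f i, c)" "f i \<in> extensional (bcarrier (G i))" "boolean_hom (G i) c (f i)"
      "\<And>p. p \<in> Field P \<Longrightarrow> f i ` level (G i) p \<subseteq> level c p" if i: "i \<in> Field r" for i
    proof -
      obtain g where g: "s i = (G i, g, c)" "g \<in> extensional (bcarrier (G i))" "boolean_hom (G i) c g"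
        "\<forall>p\<in>Field P. g ` level (G i) p \<subseteq> level c p"
        using sh[OF i] unfolding Bool_cat_nt_hom by blast
      have "f i = g" by (simp add: f_def g(1))
      then show "s i = (G i, f i, c)" "f i \<in> extensional (bcarrier (G i))" "boolean_hom (G i) c (f i)"
        "\<And>p. p \<in> Field P \<Longrightarrow> f i ` level (G i) p \<subseteq> level c p"
        using g by blast+
    qed
    have c: "scaled_boolean_alg P c" "bzero c \<noteq> bone c"
      using sh ne unfolding Bool_cat_nt_hom by blast+
    have ff: "f i x = f j x" if ij: "(i, j) \<in> r" and x: "x \<in> bcarrier (G i)" for i j x
    proof -
      have F: "i \<in> Field r" "j \<in> Field r" using ij FieldI1 FieldI2 by fast+
      have "Cmp ?C (s j) (incl (G i) (G j)) = s i" using co ij unfolding is_cocone_poset by simp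
      then have "(\<lambda>x\<in>bcarrier (G i). f j x) = f i"
        unfolding s(1)[OF F(1)] s(1)[OF F(2)] incl_cmp[OF mono[OF ij]] by simp
      then show ?thesis using x by (metis restrict_apply')
    qed
    have f2: "f i x = f j x"
      if ij: "i \<in> Field r" "j \<in> Field r" and x: "x \<in> bcarrier (G i)" "x \<in> bcarrier (G j)" for i j x
      using ij dir ff x unfolding directed_def by metis
    \<comment> \<open>The stage is an arbitrary one containing \<open>x\<close>; \<open>f2\<close>
      makes the value independent of it. The default of \<open>restrict\<close> outside the carrier
      is needed for uniqueness, as arrows have extensional underlying maps.\<close>
    define h where "h = (\<lambda>x\<in>bcarrier A. f (SOME i. i \<in> Field r \<and> x \<in> bcarrier (G i)) x)"
    have h: "h x = f i x" if i: "i \<in> Field r" and x: "x \<in> bcarrier (G i)" for i x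
    proof -
      let ?j = "SOME i. i \<in> Field r \<and> x \<in> bcarrier (G i)"
      have "?j \<in> Field r \<and> x \<in> bcarrier (G ?j)"
        using i x by (intro someI[of "\<lambda>i. i \<in> Field r \<and> x \<in> bcarrier (G i)" i]) simp
      then have "f ?j x = f i x" using f2 i x by blast
      then show ?thesis unfolding h_def using A(2) i x by auto
    qed
    have hext: "h \<in> extensional (bcarrier A)" by (simp add: h_def)
    have "boolean_hom A c h"
      unfolding boolean_hom_def ops
    proof (intro conjI ballI subsetI)
      obtain k where k: "k \<in> Field r" using ne by blast
      note cl = balg_closed(1,2)[OF SA_boolean[OF G[OF k]], unfolded SA_ops[OF G[OF k]]]
      show "h (bzero F) = bzero c" "h (bone F) = bone c"
        using h[OF k cl(1)] h[OF k cl(2)] s(3)[OF k]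
        unfolding boolean_hom_def SA_ops[OF G[OF k]] by auto
      show "y \<in> bcarrier c" if "y \<in> h ` bcarrier A" for y
        using that h s(3) A(2) unfolding boolean_hom_def by fastforce
      fix x assume x: "x \<in> bcarrier A"
      {
        fix y assume y: "y \<in> bcarrier A"
        obtain k where k: "k \<in> Field r" "x \<in> bcarrier (G k)" "y \<in> bcarrier (G k)"
          using union_carrier2[OF x y] .
        note cl = balg_closed(3-5)[OF SA_boolean[OF G[OF k(1)]], unfolded SA_ops[OF G[OF k(1)]]]
        show "h (bmeet F x y) = bmeet c (h x) (h y)" "h (bjoin F x y) = bjoin c (h x) (h y)"
          using s(3)[OF k(1)] h[OF k(1)] cl k unfolding boolean_hom_def SA_ops[OF G[OF k(1)]] by auto
      }
      obtain k where k: "k \<in> Field r" "x \<in> bcarrier (G k)" using union_carrier2[OF x x] .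
      note cl = balg_closed(3-5)[OF SA_boolean[OF G[OF k(1)]], unfolded SA_ops[OF G[OF k(1)]]]
      show "h (bneg F x) = bneg c (h x)"
        using s(3)[OF k(1)] h[OF k(1)] cl k unfolding boolean_hom_def SA_ops[OF G[OF k(1)]] by auto
    qed
    moreover have "h ` level A p \<subseteq> level c p" if p: "p \<in> Field P" for p
    proof (rule image_subsetI)
      fix x assume "x \<in> level A p"
      then obtain i where i: "i \<in> Field r" "x \<in> level (G i) p" using A(3)[OF p] by blast
      then have "h x = f i x" using h SA_level[OF G[OF i(1)] p] by blast
      then show "h x \<in> level c p" using s(4)[OF i(1) p] i(2) by auto
    qed
    ultimately have hh: "(A, h, c) \<in> hom ?C A c"
      using hext c SA_scaled[OF union_SA] SA_ops(4,5)[OF union_SA] zero_one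
      unfolding Bool_cat_nt_hom by auto
    have "Cmp ?C (A, h, c) (incl (G i) A) = s i" if i: "i \<in> Field r" for i
    proof -
      have "(\<lambda>x\<in>bcarrier (G i). h x) = f i"
        by (rule extensionalityI[of _ "bcarrier (G i)"]) (use s(2)[OF i] h[OF i] in auto)
      then show ?thesis using incl_cmp[OF union_le[OF i]] s(1)[OF i] by simp
    qed
    moreover have "k = (A, h, c)"
      if k: "k \<in> hom ?C A c" "\<forall>i\<in>Field r. Cmp ?C k (incl (G i) A) = s i" for k
    proof -
      obtain g where g: "k = (A, g, c)" "g \<in> extensional (bcarrier A)"
        using k(1) unfolding Bool_cat_nt_hom by blast
      have "g x = h x" if x: "x \<in> bcarrier A" for x
      proof -
        obtain i where i: "i \<in> Field r" "x \<in> bcarrier (G i)" using x A(2) by blast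
        then have "(\<lambda>x\<in>bcarrier (G i). g x) = f i"
          using k(2) s(1)[OF i(1)] incl_cmp[OF union_le[OF i(1)]] g(1) by auto
        then have "g x = f i x" using i(2) by (metis restrict_apply')
        then show ?thesis using h i by simp
      qed
      then have "g = h" using g(2) hext by (rule_tac extensionalityI)
      then show ?thesis using g by simp
    qed
    ultimately show ?thesis using hh by (intro ex1I[of _ "(A, h, c)"]) blast+
  qed
  ultimately show ?thesis
    unfolding is_colimit_def using diag_functor[OF po cat G mono] by (simp add: Ball_def)
qed

end

end

context covering
begin

section \<open>Finite partitions of the space of ideals\<close>

definition support :: "'x set \<Rightarrow> ('x set \<Rightarrow> 'e) \<Rightarrow> bool" where
  "support Y e \<longleftrightarrow> (\<forall>I\<in>pts. \<forall>J\<in>pts. I \<inter> Y = J \<inter> Y \<longrightarrow> e I = e J)"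

text \<open>Continuity of \<open>e\<close> into a discrete set: the space of ideals is compact, so
  local constancy amounts to dependence on finitely many generators.\<close>

definition finsupp :: "('x set \<Rightarrow> 'e) \<Rightarrow> bool" where
  "finsupp e \<longleftrightarrow> (\<exists>Y. finite Y \<and> Y \<subseteq> Field X \<and> support Y e)"

lemma finsupp_finite:
  assumes "finsupp e"
  shows "finite (e ` pts)"
proof -
  obtain Y where Y: "finite Y" "support Y e" using assms unfolding finsupp_def by blast
  define g where "g Z = e (SOME I. I \<in> pts \<and> I \<inter> Y = Z)" for Z
  have "e I = g (I \<inter> Y)" if I: "I \<in> pts" for I
  proof -
    let ?J = "SOME J. J \<in> pts \<and> J \<inter> Y = I \<inter> Y"
    have "?J \<in> pts \<and> ?J \<inter> Y = I \<inter> Y" by (rule someI[of _ I]) (use I in simp)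
    then show ?thesis using Y(2) I unfolding support_def g_def by metis
  qed
  then have "e ` pts \<subseteq> g ` Pow Y" by blast
  then show ?thesis using Y(1) finite_subset by blast
qed

text \<open>Boole's expansion with respect to one generator: on the ideals containing
  \<open>y\<close> the condition becomes \<open>Q (insert y Z)\<close>, on the others it stays
  \<open>Q Z\<close>, and both are clopen by induction.\<close>

lemma clopen_of_finite:
  assumes "finite Y" "Y \<subseteq> Field X"
  shows "\<exists>a\<in>bcarrier F. val X a = {I \<in> pts. Q (I \<inter> Y)}"
  using assms
proof (induction arbitrary: Q rule: finite_induct)
  case empty
  show ?case
  proof (cases "Q {}")
    case True
    then show ?thesis using F_val(2) F_closed(2) by (intro bexI[of _ "bone F"]) auto
  next
    case False
    then show ?thesis using F_val(1) F_closed(1) by (intro bexI[of _ "bzero F"]) auto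
  qed
next
  case (insert y Y)
  obtain a b where a: "a \<in> bcarrier F" "val X a = {I \<in> pts. Q (insert y (I \<inter> Y))}"
    and b: "b \<in> bcarrier F" "val X b = {I \<in> pts. Q (I \<inter> Y)}"
    using insert.IH[of "\<lambda>Z. Q (insert y Z)"] insert.IH[of Q] insert.prems by auto
  define g where "g = F_class X (Gen y)"
  have g: "g \<in> bcarrier F" "val X g = {I \<in> pts. y \<in> I}"
    using insert.prems F_carrierI[OF pjs, of "Gen y"] val_class[OF pjs, of "Gen y"]
    unfolding g_def by auto
  let ?c = "bjoin F (bmeet F g a) (bmeet F (bneg F g) b)"
  have "val X ?c = {I \<in> pts. Q (I \<inter> insert y Y)}"
    using a b g F_closed by (auto simp: F_val Int_insert_right split: if_splits)
  moreover have "?c \<in> bcarrier F" using a b g by (simp add: F_closed)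
  ultimately show ?case by blast
qed

lemma finsupp_clopen:
  assumes "finsupp e"
  shows "\<exists>a\<in>bcarrier F. val X a = {I \<in> pts. e I = u}"
proof -
  obtain Y where Y: "finite Y" "Y \<subseteq> Field X" "support Y e" using assms unfolding finsupp_def by blast
  have "{I \<in> pts. e I = u} = {I \<in> pts. \<exists>J\<in>pts. J \<inter> Y = I \<inter> Y \<and> e J = u}"
    using Y(3) unfolding support_def by blast
  then show ?thesis using clopen_of_finite[OF Y(1,2), of "\<lambda>Z. \<exists>J\<in>pts. J \<inter> Y = Z \<and> e J = u"] by simp
qed

text \<open>The algebra of unions of fibres of \<open>e\<close>, where the fibre over \<open>u\<close> has norm \<open>n u\<close>.\<close>

definition sat_set :: "('x set \<Rightarrow> 'e) \<Rightarrow> 'x bterm set set" where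
  "sat_set e = {a \<in> bcarrier F. \<forall>I\<in>pts. \<forall>J\<in>pts. e I = e J \<longrightarrow> (I \<in> val X a \<longleftrightarrow> J \<in> val X a)}"

definition part_alg :: "('x set \<Rightarrow> 'e) \<Rightarrow> ('e \<Rightarrow> 'p) \<Rightarrow> ('x bterm set, 'p) sbalg" where
  "part_alg e n = sub (sat_set e) (\<lambda>p. {a \<in> sat_set e. \<forall>I\<in>val X a. (p, n (e I)) \<in> P})"

definition fibre :: "('x set \<Rightarrow> 'e) \<Rightarrow> 'e \<Rightarrow> 'x bterm set" where
  "fibre e u = (SOME a. a \<in> bcarrier F \<and> val X a = {I \<in> pts. e I = u})"

lemma sat_setD:
  "a \<in> sat_set e \<Longrightarrow> I \<in> pts \<Longrightarrow> J \<in> pts \<Longrightarrow> e I = e J \<Longrightarrow> I \<in> val X a \<longleftrightarrow> J \<in> val X a"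
  unfolding sat_set_def by blast

lemma subalg_sat_set: "subalg (sat_set e)"
  unfolding subalg_def
proof (intro conjI ballI)
  show "sat_set e \<subseteq> bcarrier F" "bzero F \<in> sat_set e" "bone F \<in> sat_set e"
    unfolding sat_set_def using F_closed(1,2) by (auto simp add: F_val(1,2))
  fix a assume a: "a \<in> sat_set e"
  then have a': "a \<in> bcarrier F" unfolding sat_set_def by blast
  show "bneg F a \<in> sat_set e"
    using a F_closed(3)[OF a'] unfolding sat_set_def mem_Collect_eq F_val(3)[OF a'] by blast
  fix b assume b: "b \<in> sat_set e"
  then have b': "b \<in> bcarrier F" unfolding sat_set_def by blast
  show "bmeet F a b \<in> sat_set e"
    using a b F_closed(4)[OF a' b'] unfolding sat_set_def mem_Collect_eq F_val(4)[OF a' b'] by blast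
  show "bjoin F a b \<in> sat_set e"
    using a b F_closed(5)[OF a' b'] unfolding sat_set_def mem_Collect_eq F_val(5)[OF a' b'] by blast
qed

lemma sat_set_sub: "a \<in> sat_set e \<Longrightarrow> a \<in> bcarrier F"
  unfolding sat_set_def by blast

lemma val_pts: "I \<in> val X a \<Longrightarrow> I \<in> pts"
  unfolding val_def by blast

context
  fixes e :: "'x set \<Rightarrow> 'e"
  assumes e: "finsupp e"
begin

lemma fibre: "fibre e u \<in> bcarrier F" "val X (fibre e u) = {I \<in> pts. e I = u}"
proof -
  have "fibre e u \<in> bcarrier F \<and> val X (fibre e u) = {I \<in> pts. e I = u}"
    unfolding fibre_def using finsupp_clopen[OF e, of u] by (rule_tac someI_ex) blast
  then show "fibre e u \<in> bcarrier F" "val X (fibre e u) = {I \<in> pts. e I = u}" by auto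
qed

lemma fibre_sat: "fibre e u \<in> sat_set e"
  unfolding sat_set_def using fibre by auto

text \<open>There are finitely many fibres and \<open>a\<close> is the join of those it meets. The
  join is built by induction over finite sets of labels; it is recognised as \<open>a\<close>
  through \<open>F_inj\<close>, because \<open>val X a\<close> is a union of fibres.\<close>

lemma mem_ideal_of_fibres:
  assumes J: "boolean_ideal (sub (sat_set e) l) J" and a: "a \<in> sat_set e"
    and fib: "\<And>I. I \<in> val X a \<Longrightarrow> fibre e (e I) \<in> J"
  shows "a \<in> J"
proof -
  have J': "bzero F \<in> J" "\<And>x y. x \<in> J \<Longrightarrow> y \<in> J \<Longrightarrow> bjoin F x y \<in> J" "J \<subseteq> sat_set e"
    using J unfolding boolean_ideal_def by auto
  have "\<exists>b\<in>J. val X b = {I \<in> pts. e I \<in> R}" if "finite R" "R \<subseteq> e ` val X a" for R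
    using that
  proof (induction rule: finite_induct)
    case empty
    show ?case using J'(1) F_val(1) by auto
  next
    case (insert u R)
    then obtain b where b: "b \<in> J" "val X b = {I \<in> pts. e I \<in> R}" by auto
    have u: "fibre e u \<in> J" using insert.prems fib by auto
    have "val X (bjoin F (fibre e u) b) = {I \<in> pts. e I \<in> insert u R}"
      using b u fibre J'(3) sat_set_sub[of _ e] by (subst F_val) auto
    then show ?case using J'(2)[OF u b(1)] by blast
  qed
  moreover have "e ` val X a \<subseteq> e ` pts" using val_pts by blast
  then have "finite (e ` val X a)" using finsupp_finite[OF e] finite_subset by blast
  ultimately obtain b where b: "b \<in> J" "val X b = {I \<in> pts. e I \<in> e ` val X a}" by blast
  have "val X b = val X a"
  proof
    show "val X b \<subseteq> val X a"
    proof
      fix I assume "I \<in> val X b"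
      then obtain K where K: "I \<in> pts" "K \<in> val X a" "e I = e K" unfolding b(2) by blast
      then have "I \<in> val X a \<longleftrightarrow> K \<in> val X a" using sat_setD[OF a K(1) val_pts[OF K(2)]] by blast
      then show "I \<in> val X a" using K(2) by blast
    qed
    show "val X a \<subseteq> val X b" unfolding b(2) using val_pts by blast
  qed
  then have "b = a" using F_inj b J'(3) a sat_set_sub[of _ e] by blast
  then show ?thesis using b by simp
qed

context
  fixes n :: "'e \<Rightarrow> 'p"
  assumes n: "\<And>I. I \<in> pts \<Longrightarrow> n (e I) \<in> Field P"
begin

abbreviation (input) PA where "PA \<equiv> part_alg e n"

lemma part_simps:
  "bcarrier PA = sat_set e" "level PA p = {a \<in> sat_set e. \<forall>I\<in>val X a. (p, n (e I)) \<in> P}"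
  unfolding part_alg_def by simp_all

lemma part_ideal_iff: "boolean_ideal PA J \<longleftrightarrow> boolean_ideal (sub (sat_set e) l) J"
  unfolding part_alg_def boolean_ideal_def by simp

lemma part_level_ideal: "boolean_ideal PA (level PA p)"
  unfolding boolean_ideal_def part_simps
proof (intro conjI ballI impI)
  let ?L = "{a \<in> sat_set e. \<forall>I\<in>val X a. (p, n (e I)) \<in> P}"
  show "?L \<subseteq> sat_set e" by blast
  show "bzero PA \<in> ?L" using subalg_sat_set[of e] F_val(1) unfolding part_alg_def subalg_def by simp
  show "bjoin PA x y \<in> ?L" if "x \<in> ?L" "y \<in> ?L" for x y
    using that subalg_sat_set[of e] sat_set_sub[of _ e] unfolding part_alg_def subalg_def
    by (auto simp: F_val)
  show "y \<in> ?L" if "x \<in> ?L" "y \<in> sat_set e" "ble PA y x" for x y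
    using that ble_F[OF pjs, of y x] sat_set_sub[of _ e] unfolding part_alg_def by auto
qed

lemma fibre_level: "I \<in> pts \<Longrightarrow> fibre e (e I) \<in> level PA p \<longleftrightarrow> (p, n (e I)) \<in> P"
  unfolding part_simps using fibre_sat fibre by auto

text \<open>The fibre through \<open>I\<close> lies in the level of its own norm
  \<open>n (e I)\<close>. If an element of the levels \<open>p\<close> and \<open>q\<close> contains
  \<open>I\<close>, that norm is an upper bound of \<open>p\<close> and \<open>q\<close>. Both join
  conditions follow, as an element is the join of its fibres.\<close>

lemma part_scaled: "scaled_boolean_alg P PA"
  unfolding scaled_boolean_alg_def
proof (intro conjI ballI)
  show B: "boolean_alg PA" unfolding part_alg_def using boolean_alg_sub[OF subalg_sat_set[of e]] .
  show "boolean_ideal PA (level PA p)" for p by (rule part_level_ideal)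
  have lc: "level PA p \<subseteq> bcarrier PA" for p unfolding part_simps by blast
  show "bcarrier PA = ideal_gen PA (\<Union>p\<in>Field P. level PA p)"
  proof
    have "(\<Union>p\<in>Field P. level PA p) \<subseteq> bcarrier PA" using lc by blast
    from ideal_gen_ideal[OF B this]
    show "ideal_gen PA (\<Union>p\<in>Field P. level PA p) \<subseteq> bcarrier PA" unfolding boolean_ideal_def by blast
    show "bcarrier PA \<subseteq> ideal_gen PA (\<Union>p\<in>Field P. level PA p)"
      unfolding ideal_gen_def
    proof (intro subsetI InterI, clarify)
      fix a J assume a: "a \<in> bcarrier PA" and J: "boolean_ideal PA J" "(\<Union>p\<in>Field P. level PA p) \<subseteq> J"
      show "a \<in> J"
      proof (rule mem_ideal_of_fibres)
        show "boolean_ideal (sub (sat_set e) (level PA)) J" using J(1) part_ideal_iff by blast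
        show "a \<in> sat_set e" using a part_simps by blast
        fix I assume "I \<in> val X a"
        then have I: "I \<in> pts" by (rule val_pts)
        then have "fibre e (e I) \<in> level PA (n (e I))"
          using fibre_level P_order(1)[OF P_po n] by blast
        then show "fibre e (e I) \<in> J" using J(2) n[OF I] by blast
      qed
    qed
  qed
  fix p q assume pq: "p \<in> Field P" "q \<in> Field P"
  let ?U = "upper_bounds P {p, q}"
  show "level PA p \<inter> level PA q = ideal_gen PA (\<Union>r\<in>?U. level PA r)"
  proof
    show "level PA p \<inter> level PA q \<subseteq> ideal_gen PA (\<Union>r\<in>?U. level PA r)"
      unfolding ideal_gen_def
    proof (intro subsetI InterI, clarify)
      fix a J assume a: "a \<in> level PA p" "a \<in> level PA q"
        and J: "boolean_ideal PA J" "(\<Union>r\<in>?U. level PA r) \<subseteq> J"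
      show "a \<in> J"
      proof (rule mem_ideal_of_fibres)
        show "boolean_ideal (sub (sat_set e) (level PA)) J" using J(1) part_ideal_iff by blast
        show "a \<in> sat_set e" using a part_simps by blast
        fix I assume Ia: "I \<in> val X a"
        then have I: "I \<in> pts" by (rule val_pts)
        then have "fibre e (e I) \<in> level PA (n (e I))"
          using fibre_level P_order(1)[OF P_po n] by blast
        moreover have "n (e I) \<in> ?U"
          using a Ia n[OF I] unfolding part_simps upper_bounds_def by auto
        ultimately show "fibre e (e I) \<in> J" using J(2) by blast
      qed
    qed
    have "level PA r \<subseteq> level PA p \<inter> level PA q" if "r \<in> ?U" for r
      using that P_order(2)[OF P_po] unfolding part_simps upper_bounds_def by blast
    moreover have "boolean_ideal PA (level PA p \<inter> level PA q)"
      using part_level_ideal[of p] part_level_ideal[of q]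
      unfolding boolean_ideal_def by (intro conjI) blast+
    ultimately show "ideal_gen PA (\<Union>r\<in>?U. level PA r) \<subseteq> level PA p \<inter> level PA q"
      by (intro ideal_gen_least) blast+
  qed
qed

lemma part_SA: "PA \<in> SA"
  unfolding SA_def using part_scaled subalg_sat_set part_alg_def by blast

lemma part_atoms: "atoms PA = fibre e ` e ` pts"
proof -
  have ble: "ble PA a b \<longleftrightarrow> val X a \<subseteq> val X b" if "a \<in> sat_set e" "b \<in> sat_set e" for a b
    using ble_F[OF pjs sat_set_sub[OF that(1)] sat_set_sub[OF that(2)]] unfolding part_alg_def by simp
  have zero: "a = bzero F \<longleftrightarrow> val X a = {}" if "a \<in> sat_set e" for a
    using F_val(1) F_inj[OF sat_set_sub[OF that] F_closed(1)] by auto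
  have z: "bzero PA = bzero F" unfolding part_alg_def by simp
  have closed: "fibre e (e I) = a \<or> val X a \<inter> {J \<in> pts. e J = e I} = {}"
    if "a \<in> sat_set e" "I \<in> pts" "val X a \<subseteq> {J \<in> pts. e J = e I}" for a I
  proof (rule disjCI)
    assume "val X a \<inter> {J \<in> pts. e J = e I} \<noteq> {}"
    then obtain K where K: "K \<in> val X a" "K \<in> pts" "e K = e I" by blast
    have "J \<in> val X a" if J: "J \<in> pts" "e J = e I" for J
    proof -
      have "J \<in> val X a \<longleftrightarrow> K \<in> val X a"
        using sat_setD[OF \<open>a \<in> sat_set e\<close> J(1) K(2)] J(2) K(3) by simp
      then show ?thesis using K by blast
    qed
    then have "val X a = val X (fibre e (e I))" using that(3) fibre by blast
    then show "fibre e (e I) = a" using F_inj[OF fibre(1) sat_set_sub[OF that(1)]] by simp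
  qed
  show ?thesis
  proof (intro subset_antisym subsetI)
    fix a assume a: "a \<in> atoms PA"
    then have as: "a \<in> sat_set e" "a \<noteq> bzero F" unfolding atoms_def part_simps z by auto
    then obtain I where I: "I \<in> val X a" using zero by blast
    have Ip: "I \<in> pts" using val_pts[OF I] .
    have "val X (fibre e (e I)) \<subseteq> val X a"
      unfolding fibre using sat_setD[OF as(1) _ Ip] I by blast
    then have "ble PA (fibre e (e I)) a" using ble fibre_sat as by blast
    moreover have "fibre e (e I) \<noteq> bzero F" using zero[OF fibre_sat] fibre Ip by blast
    ultimately have "fibre e (e I) = a"
      using a fibre_sat unfolding atoms_def part_simps z by blast
    then show "a \<in> fibre e ` e ` pts" using Ip by blast
  next
    fix a assume "a \<in> fibre e ` e ` pts"
    then obtain I where I: "I \<in> pts" "a = fibre e (e I)" by blast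
    have "fibre e (e I) \<noteq> bzero F" using zero[OF fibre_sat] fibre I by blast
    moreover have "x = bzero F \<or> x = fibre e (e I)" if x: "x \<in> sat_set e" "ble PA x (fibre e (e I))" for x
    proof -
      have "val X x \<subseteq> {J \<in> pts. e J = e I}" using x ble[OF x(1) fibre_sat] fibre by simp
      then show ?thesis using closed[OF x(1) I(1)] zero[OF x(1)] by blast
    qed
    ultimately show "a \<in> atoms PA" unfolding atoms_def part_simps z using fibre_sat I(2) by blast
  qed
qed

lemma part_greatest:
  assumes "I \<in> pts"
  shows "greatest_in P {p \<in> Field P. fibre e (e I) \<in> level PA p} (n (e I))"
  using fibre_level[OF assms] n[OF assms] P_order(1)[OF P_po n[OF assms]]
  unfolding greatest_in_def by auto

lemma part_norm:
  assumes "I \<in> pts"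
  shows "atom_norm P PA (fibre e (e I)) = n (e I)"
  unfolding atom_norm_def
proof (rule the_equality)
  show "greatest_in P {p \<in> Field P. fibre e (e I) \<in> level PA p} (n (e I))"
    by (rule part_greatest[OF assms])
  fix m assume "greatest_in P {p \<in> Field P. fibre e (e I) \<in> level PA p} m"
  then show "m = n (e I)"
    using part_greatest[OF assms] P_order(3)[OF P_po] unfolding greatest_in_def by blast
qed

text \<open>A union of fibres is determined by the finite set of labels that it takes.\<close>

lemma part_finite: "finite (bcarrier PA)"
proof -
  have "inj_on (\<lambda>a. e ` val X a) (sat_set e)"
  proof (rule inj_onI)
    have sub: "val X a \<subseteq> val X b"
      if a: "a \<in> sat_set e" and b: "b \<in> sat_set e" and eq: "e ` val X a = e ` val X b" for a b
    proof
      fix I assume I: "I \<in> val X a"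
      then obtain J where J: "J \<in> val X b" "e I = e J" using eq by blast
      have "I \<in> val X b \<longleftrightarrow> J \<in> val X b"
        using sat_setD[OF b val_pts[OF I] val_pts[OF J(1)] J(2)] .
      then show "I \<in> val X b" using J by blast
    qed
    fix a b assume ab: "a \<in> sat_set e" "b \<in> sat_set e" "e ` val X a = e ` val X b"
    then have "val X a = val X b" using sub[OF ab] sub[OF ab(2,1) ab(3)[symmetric]] by blast
    then show "a = b" using F_inj sat_set_sub[of _ e] ab by blast
  qed
  moreover have "(\<lambda>a. e ` val X a) ` sat_set e \<subseteq> Pow (e ` pts)" using val_pts by blast
  ultimately show ?thesis
    unfolding part_simps using finsupp_finite[OF e] by (meson finite_Pow_iff finite_subset inj_on_finite)
qed

lemma part_compact: "compact_sbalg P PA"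
  unfolding compact_sbalg_def using part_scaled part_finite part_atoms part_greatest by fastforce

end

end

section \<open>A compatible system of labelled partitions\<close>

text \<open>Membership of \<open>e I\<close> in \<open>I\<close> puts the fibre through
  \<open>I\<close> below the generator of \<open>e I\<close>, so the norm \<open>d (e I)\<close> is
  compatible with the levels of \<open>F(X)\<close>.\<close>

definition label :: "('x set \<Rightarrow> 'x) \<Rightarrow> bool" where
  "label e \<longleftrightarrow> (\<forall>I\<in>pts. e I \<in> I) \<and> finsupp e"

text \<open>When \<open>e I\<close> is also in \<open>I\<close>, the trace of \<open>I\<close> on
  \<open>Y\<close> consists of the members of \<open>Y\<close> below \<open>e I\<close>. The label
  then determines the trace, so each fibre of \<open>e\<close> lies in one cell of the partition
  given by \<open>Y\<close>.\<close>

definition refines :: "'x set \<Rightarrow> ('x set \<Rightarrow> 'x) \<Rightarrow> bool" where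
  "refines Y e \<longleftrightarrow> (\<forall>I\<in>pts. \<forall>y\<in>Y. y \<in> I \<longrightarrow> (y, e I) \<in> X)"

lemma label_field: "label e \<Longrightarrow> I \<in> pts \<Longrightarrow> e I \<in> Field X"
  unfolding label_def poset_ideal_def by blast

text \<open>Start with a minimal element of \<open>X\<close> inside each ideal. To include
  \<open>y\<close>, replace the label of each ideal containing \<open>y\<close> by a minimal upper
  bound of the old label and \<open>y\<close> within the ideal. Finitely many old labels have
  finitely many such bounds, so the support stays finite.\<close>

lemma label_exists:
  assumes "finite Y" "Y \<subseteq> Field X"
  shows "\<exists>e. label e \<and> refines Y e"
  using assms
proof (induction rule: finite_induct)
  case empty
  let ?M = "minimal_elems X (Field X)"
  have M: "finite ?M" "?M \<subseteq> Field X"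
    using finite_nabla[OF pjs, of "{}"] nabla_empty[OF pjs] unfolding minimal_elems_def by auto
  define e where "e I = (SOME u. u \<in> I \<inter> ?M)" for I
  have "e I \<in> I \<inter> ?M" if "I \<in> pts" for I
    unfolding e_def by (rule someI_ex) (use ideal_minimal[OF pjs, of I] that in auto)
  moreover have "support ?M e" unfolding support_def e_def by simp
  ultimately have "label e" unfolding label_def finsupp_def using M by blast
  then show ?case unfolding refines_def by blast
next
  case (insert y Y)
  then obtain e where e: "label e" "refines Y e" by auto
  obtain Z where Z: "finite Z" "Z \<subseteq> Field X" "support Z e"
    using e(1) unfolding label_def finsupp_def by blast
  have y: "y \<in> Field X" using insert.prems by blast
  have eF: "e I \<in> Field X" if "I \<in> pts" for I using label_field[OF e(1) that] .
  \<comment> \<open>The selection is made from the set \<open>nabla X {e I, y} \<inter> I\<close>,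
    so it depends on \<open>I\<close> only through the old label and a finite trace. This is what
    gives \<open>e'\<close> the finite support \<open>Z'\<close>.\<close>
  define e' where "e' I = (if y \<in> I then SOME w. w \<in> nabla X {e I, y} \<inter> I else e I)" for I
  have e': "e' I \<in> nabla X {e I, y} \<inter> I" if I: "I \<in> pts" "y \<in> I" for I
  proof -
    have "e I \<in> I" using e(1) I(1) unfolding label_def by blast
    then have "\<exists>w. w \<in> nabla X {e I, y} \<inter> I" using ideal_nabla[OF pjs, of I "e I" y] I by blast
    from someI_ex[OF this] show ?thesis unfolding e'_def using I(2) by simp
  qed
  have eI': "(e I, e' I) \<in> X" if I: "I \<in> pts" for I
  proof (cases "y \<in> I")
    case True
    then show ?thesis using nabla_upper[OF pjs, of "e' I" "{e I, y}" "e I"] e'[OF I] by blast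
  next
    case False
    then show ?thesis using partial_orderD(1)[OF X_po eF[OF I]] unfolding e'_def by simp
  qed
  define Z' where "Z' = insert y Z \<union> (\<Union>u\<in>e ` pts. nabla X {u, y})"
  have "finite (nabla X {u, y})" if "u \<in> e ` pts" for u
    using finite_nabla[OF pjs, of "{u, y}"] eF y that by blast
  moreover have "finite (e ` pts)" using e(1) finsupp_finite[of e] unfolding label_def by blast
  ultimately have "finite Z'" unfolding Z'_def using Z by blast
  moreover have "Z' \<subseteq> Field X"
    using Z y unfolding Z'_def nabla_def minimal_elems_def upper_bounds_def by blast
  moreover have "support Z' e'"
    unfolding support_def
  proof (intro ballI impI)
    fix I J assume IJ: "I \<in> pts" "J \<in> pts" "I \<inter> Z' = J \<inter> Z'"
    then have "I \<inter> Z = J \<inter> Z" unfolding Z'_def by blast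
    then have "e I = e J" using Z(3) IJ unfolding support_def by blast
    moreover have "y \<in> I \<longleftrightarrow> y \<in> J" using IJ(3) unfolding Z'_def by blast
    moreover have "nabla X {e I, y} \<inter> I = nabla X {e I, y} \<inter> J"
      using IJ(1,3) unfolding Z'_def by blast
    ultimately show "e' I = e' J" unfolding e'_def by simp
  qed
  moreover have "e' I \<in> I" if I: "I \<in> pts" for I
    using e'[OF I] e(1) I unfolding e'_def label_def by (cases "y \<in> I") auto
  ultimately have "label e'" unfolding label_def finsupp_def by blast
  moreover have "refines (insert y Y) e'"
    unfolding refines_def
  proof (intro ballI impI)
    fix I z assume I: "I \<in> pts" "z \<in> insert y Y" "z \<in> I"
    show "(z, e' I) \<in> X"
    proof (cases "z = y")
      case True
      then show ?thesis using nabla_upper[OF pjs, of "e' I" "{e I, y}" y] e'[OF I(1)] I(3) by blast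
    next
      case False
      then have "(z, e I) \<in> X" using e(2) I unfolding refines_def by blast
      then show ?thesis using eI'[OF I(1)] partial_orderD(2)[OF X_po] by blast
    qed
  qed
  ultimately show ?case by blast
qed

text \<open>The first condition makes norms grow and the second makes the fibres of
  \<open>e'\<close> refine those of \<open>e\<close>; together they give the inclusion of the
  corresponding scaled algebras in \<open>H_mono\<close>.\<close>

definition finer :: "('x set \<Rightarrow> 'x) \<Rightarrow> ('x set \<Rightarrow> 'x) \<Rightarrow> bool" where
  "finer e e' \<longleftrightarrow> (\<forall>I\<in>pts. (e I, e' I) \<in> X) \<and> (\<forall>I\<in>pts. \<forall>J\<in>pts. e' I = e' J \<longrightarrow> e I = e J)"

lemma refines_support:
  assumes "refines Y e'" "label e'" "I \<in> pts" "J \<in> pts" "e' I = e' J"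
  shows "I \<inter> Y \<subseteq> J"
  using assms ideal_lower[OF pjs, of J "e' J"] unfolding refines_def label_def by fastforce

text \<open>Recursion along the proper inclusion of finite sets. At \<open>Y\<close> there are only
  finitely many earlier labellings, each with finite support and finitely many values, so a single
  finite set encodes everything that the new labelling has to respect.\<close>

lemma ladder_exists:
  "\<exists>f. \<forall>Y. finite Y \<and> Y \<subseteq> Field X \<longrightarrow>
     label (f Y) \<and> refines Y (f Y) \<and> (\<forall>Y'. Y' \<subset> Y \<longrightarrow> finer (f Y') (f Y))"
proof -
  define Q where "Q f Y e \<longleftrightarrow> (finite Y \<and> Y \<subseteq> Field X \<longrightarrow>
     label e \<and> refines Y e \<and> (\<forall>Y'. Y' \<subset> Y \<longrightarrow> finer (f Y') e))" for f Y e
  have "\<exists>f. \<forall>Y. Q f Y (f Y)"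
  proof (rule dependent_wf_choice[OF wf_finite_psubset])
    fix f g :: "'x set \<Rightarrow> 'x set \<Rightarrow> 'x" and Y e
    assume eq: "\<And>Z. (Z, Y) \<in> finite_psubset \<Longrightarrow> f Z = g Z"
    have "f Y' = g Y'" if "finite Y" "Y' \<subset> Y" for Y'
      using eq[of Y'] that unfolding finite_psubset_def by simp
    then show "Q f Y e = Q g Y e" unfolding Q_def by auto
  next
    fix Y and f :: "'x set \<Rightarrow> 'x set \<Rightarrow> 'x"
    assume IH: "\<And>Y'. (Y', Y) \<in> finite_psubset \<Longrightarrow> Q f Y' (f Y')"
    show "\<exists>e. Q f Y e"
    proof (cases "finite Y \<and> Y \<subseteq> Field X")
      case True
      have lab: "label (f Y')" if "Y' \<subset> Y" for Y'
        using IH[of Y'] that True finite_subset[of Y' Y] unfolding Q_def finite_psubset_def by auto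
      have "\<forall>Y'\<in>{Y'. Y' \<subset> Y}. \<exists>Z. finite Z \<and> Z \<subseteq> Field X \<and> support Z (f Y')"
        using lab[unfolded label_def finsupp_def] by simp
      then obtain Z where Z: "\<And>Y'. Y' \<subset> Y \<Longrightarrow> finite (Z Y') \<and> Z Y' \<subseteq> Field X \<and> support (Z Y') (f Y')"
        unfolding Ball_def mem_Collect_eq by metis
      \<comment> \<open>Each ingredient of \<open>W\<close> serves one requirement: \<open>Y\<close>
        for \<open>refines Y e\<close>, the supports \<open>Z Y'\<close> for fibres inside the
        earlier fibres, and the earlier labels for \<open>e I\<close> to lie above all of
        them.\<close>
      define W where "W = Y \<union> (\<Union>Y'\<in>{Y'. Y' \<subset> Y}. Z Y' \<union> f Y' ` pts)"
      have fin: "finite {Y'. Y' \<subset> Y}"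
        using True by (auto intro: finite_subset[of _ "Pow Y"])
      have "finite (Z Y' \<union> f Y' ` pts)" if "Y' \<subset> Y" for Y'
        using Z[OF that] finsupp_finite[of "f Y'"] lab[OF that] unfolding label_def by simp
      then have "finite W" unfolding W_def
        using True fin by (intro finite_UnI finite_UN_I) simp_all
      moreover have "f Y' ` pts \<subseteq> Field X" if "Y' \<subset> Y" for Y' using label_field[OF lab[OF that]] by blast
      then have "W \<subseteq> Field X" unfolding W_def using True Z by blast
      ultimately obtain e where e: "label e" "refines W e" using label_exists by blast
      have "refines Y e" using e(2) unfolding refines_def W_def by blast
      moreover have "finer (f Y') e" if Y': "Y' \<subset> Y" for Y'
        unfolding finer_def
      proof (intro conjI ballI impI)
        fix I assume I: "I \<in> pts"
        have "f Y' I \<in> I" using lab[OF Y'] I unfolding label_def by blast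
        moreover have "f Y' I \<in> W" using Y' I unfolding W_def by blast
        ultimately show "(f Y' I, e I) \<in> X" using e(2) I unfolding refines_def by blast
        fix J assume J: "J \<in> pts" and eq: "e I = e J"
        have "I \<inter> W = J \<inter> W"
          using refines_support[OF e(2,1) I J eq] refines_support[OF e(2,1) J I eq[symmetric]] by blast
        then have "I \<inter> Z Y' = J \<inter> Z Y'" using Y' unfolding W_def by blast
        then show "f Y' I = f Y' J" using Z[OF Y'] I J unfolding support_def by blast
      qed
      ultimately have "Q f Y e" unfolding Q_def using e(1) by blast
      then show ?thesis by (rule exI[of _ e])
    next
      case False
      then show ?thesis unfolding Q_def by auto
    qed
  qed
  then show ?thesis unfolding Q_def .
qed

definition ladder :: "'x set \<Rightarrow> 'x set \<Rightarrow> 'x" where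
  "ladder = (SOME f. \<forall>Y. finite Y \<and> Y \<subseteq> Field X \<longrightarrow>
     label (f Y) \<and> refines Y (f Y) \<and> (\<forall>Y'. Y' \<subset> Y \<longrightarrow> finer (f Y') (f Y)))"

lemma ladder:
  assumes "Y \<in> Fpow (Field X)"
  shows "label (ladder Y)" "refines Y (ladder Y)" "Y' \<subseteq> Y \<Longrightarrow> finer (ladder Y') (ladder Y)"
proof -
  have *: "label (ladder Y) \<and> refines Y (ladder Y) \<and> (\<forall>Y'. Y' \<subset> Y \<longrightarrow> finer (ladder Y') (ladder Y))"
    using someI_ex[OF ladder_exists] assms unfolding ladder_def[symmetric] Fpow_def by blast
  then show "label (ladder Y)" "refines Y (ladder Y)" by auto
  have "finer (ladder Y) (ladder Y)"
    unfolding finer_def using * label_field partial_orderD(1)[OF X_po] by blast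
  then show "Y' \<subseteq> Y \<Longrightarrow> finer (ladder Y') (ladder Y)" using * by blast
qed

definition lsupp :: "'x set \<Rightarrow> 'x set" where
  "lsupp Y = (SOME Z. finite Z \<and> Z \<subseteq> Field X \<and> support Z (ladder Y))"

lemma lsupp:
  assumes "Y \<in> Fpow (Field X)"
  shows "finite (lsupp Y)" "lsupp Y \<subseteq> Field X" "support (lsupp Y) (ladder Y)"
proof -
  have "\<exists>Z. finite Z \<and> Z \<subseteq> Field X \<and> support Z (ladder Y)"
    using ladder(1)[OF assms] unfolding label_def finsupp_def by blast
  from someI_ex[OF this] show "finite (lsupp Y)" "lsupp Y \<subseteq> Field X" "support (lsupp Y) (ladder Y)"
    unfolding lsupp_def by auto
qed

section \<open>Exhaustion of \<open>F(X)\<close> by the compact algebras \<open>H Y\<close>\<close>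

definition H :: "'x set \<Rightarrow> ('x bterm set, 'p) sbalg" where
  "H Y = part_alg (ladder Y) d"

text \<open>\<open>G Z\<close> takes the place of \<open>F\<close> of the \<open>\<nabla>\<close>-closure of \<open>Z\<close>: by construction it
  preserves directed unions in \<open>Z\<close>, and it only involves \<open>GS Z\<close>, defined below, which is hardly larger
  than \<open>Z\<close>.\<close>

definition G :: "'x set \<Rightarrow> ('x bterm set, 'p) sbalg" where
  "G Z = sub (\<Union>Y\<in>Fpow Z. bcarrier (H Y)) (\<lambda>p. \<Union>Y\<in>Fpow Z. level (H Y) p)"

lemma H_prems:
  assumes "Y \<in> Fpow (Field X)"
  shows "finsupp (ladder Y)" "I \<in> pts \<Longrightarrow> d (ladder Y I) \<in> Field P"
  using ladder(1)[OF assms] label_field d_field unfolding label_def by auto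

lemma H_SA: "Y \<in> Fpow (Field X) \<Longrightarrow> H Y \<in> SA"
  unfolding H_def by (rule part_SA[of "ladder Y" d, OF H_prems])

lemma H_mono:
  assumes "Y \<in> Fpow (Field X)" "Y' \<subseteq> Y"
  shows "le (H Y') (H Y)"
proof -
  have f: "finer (ladder Y') (ladder Y)" using ladder(3)[OF assms] .
  have "sat_set (ladder Y') \<subseteq> sat_set (ladder Y)"
    using f unfolding sat_set_def finer_def by blast
  moreover have "(p, d (ladder Y I)) \<in> P" if "I \<in> pts" "(p, d (ladder Y' I)) \<in> P" for p I
    using f that d_mono P_order(2)[OF P_po] unfolding finer_def by blast
  ultimately show ?thesis
    unfolding le_def H_def part_alg_def using val_pts by (auto simp del: mem_Collect_eq)
qed

lemma Fpow_Un: "Y \<in> Fpow Z \<Longrightarrow> Y' \<in> Fpow Z \<Longrightarrow> Y \<union> Y' \<in> Fpow Z"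
  unfolding Fpow_def by blast

lemma directed_Fpow: "directed (incl_rel {Y \<in> Fpow Z. W \<subseteq> Y})" if "W \<in> Fpow Z"
  using that Fpow_Un by (intro directed_incl_relI) blast+

lemma gen_class: "u \<in> Field X \<Longrightarrow> F_class X (Gen u) \<in> bcarrier F"
  "u \<in> Field X \<Longrightarrow> val X (F_class X (Gen u)) = {I \<in> pts. u \<in> I}"
  using F_carrierI[OF pjs, of "Gen u"] val_class[OF pjs, of "Gen u"] by auto

text \<open>The truth of a term at an ideal depends only on the trace on its generators, which the
  label of \<open>ladder (gens t)\<close> determines. Hence the class of \<open>t\<close> is a union
  of fibres of that labelling.\<close>

lemma carrier_union: "bcarrier F = (\<Union>Y\<in>Fpow (Field X). bcarrier (H Y))"
proof
  show "(\<Union>Y\<in>Fpow (Field X). bcarrier (H Y)) \<subseteq> bcarrier F" using SA_carrier H_SA by blast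
  show "bcarrier F \<subseteq> (\<Union>Y\<in>Fpow (Field X). bcarrier (H Y))"
  proof
    fix a assume a: "a \<in> bcarrier F"
    then obtain t where t: "gens t \<subseteq> Field X" "a = F_class X t" using F_carrierE[OF pjs] by blast
    have "finite (gens t)" by (induction t) auto
    then have Y: "gens t \<in> Fpow (Field X)" using t unfolding Fpow_def by blast
    have "I \<in> val X a \<longleftrightarrow> J \<in> val X a"
      if IJ: "I \<in> pts" "J \<in> pts" and eq: "ladder (gens t) I = ladder (gens t) J" for I J
    proof -
      have "I \<inter> gens t = J \<inter> gens t"
        using refines_support[OF ladder(2,1)[OF Y] IJ eq]
          refines_support[OF ladder(2,1)[OF Y] IJ(2,1) eq[symmetric]] by blast
      then show ?thesis unfolding t(2) val_class[OF pjs t(1)] using IJ sat_cong[of I t J] by auto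
    qed
    then have "a \<in> bcarrier (H (gens t))" unfolding H_def part_alg_def sub_simps(1) sat_set_def
      using a by blast
    then show "a \<in> (\<Union>Y\<in>Fpow (Field X). bcarrier (H Y))" using Y by blast
  qed
qed

text \<open>Brings the extended record into the form \<open>sub\<close>, to which the results on
  directed unions apply.\<close>

lemma F_scaled_sub:
  "F_scaled P X d = sub (bcarrier F)
     (\<lambda>p. ideal_gen F {F_class X (Gen u) |u. u \<in> Field X \<and> (p, d u) \<in> P})"
  unfolding F_scaled_def sub_def balg.extend_def by (simp add: F_alg_def)

text \<open>A generator \<open>u\<close> with \<open>p\<close> below \<open>d u\<close> lies in
  \<open>H {u}\<close>, where ideals containing \<open>u\<close> have labels above \<open>u\<close>
  and hence norms above \<open>p\<close>. Conversely, a fibre over \<open>u\<close> with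
  \<open>p\<close> below \<open>d u\<close> lies below the generator of \<open>u\<close>, and
  elements of the level \<open>p\<close> of \<open>H Y\<close> are joins of such fibres.\<close>

lemma level_union:
  assumes p: "p \<in> Field P"
  shows "level (F_scaled P X d) p = (\<Union>Y\<in>Fpow (Field X). level (H Y) p)"
proof -
  let ?U = "{F_class X (Gen u) |u. u \<in> Field X \<and> (p, d u) \<in> P}"
  let ?S = "sub (bcarrier F) (\<lambda>p. \<Union>Y\<in>Fpow (Field X). level (H Y) p)"
  have U: "?U \<subseteq> bcarrier F" using gen_class by blast
  note B = boolean_alg_F[OF pjs]
  have idl: "boolean_ideal F (\<Union>Y\<in>Fpow (Field X). level (H Y) p)"
  proof -
    \<comment> \<open>The auxiliary algebra \<open>?S\<close> has the unions as its levels by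
      definition. The result on unions cannot be applied to \<open>F_scaled\<close> directly, since
      the shape of its levels is what is being proved.\<close>
    have "boolean_ideal ?S (level ?S p)"
    proof (rule union_level_ideal[of "incl_rel {Y \<in> Fpow (Field X). {} \<subseteq> Y}" H])
      show "directed (incl_rel {Y \<in> Fpow (Field X). {} \<subseteq> Y})"
        by (rule directed_Fpow) (rule empty_in_Fpow)
    qed (use H_SA H_mono p carrier_union in auto)
    then show ?thesis unfolding boolean_ideal_def by simp
  qed
  have "ideal_gen F ?U = (\<Union>Y\<in>Fpow (Field X). level (H Y) p)"
  proof
    have "?U \<subseteq> (\<Union>Y\<in>Fpow (Field X). level (H Y) p)"
    proof
      fix a assume "a \<in> ?U"
      then obtain u where u: "a = F_class X (Gen u)" "u \<in> Field X" "(p, d u) \<in> P" by blast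
      have Y: "{u} \<in> Fpow (Field X)" using u unfolding Fpow_def by simp
      have up: "(u, ladder {u} I) \<in> X" if "I \<in> pts" "u \<in> I" for I
        using ladder(2)[OF Y] that unfolding refines_def by blast
      have "(p, d (ladder {u} I)) \<in> P" if "I \<in> pts" "u \<in> I" for I
        using d_mono[OF up[OF that]] u(3) P_order(2)[OF P_po] by blast
      moreover have "a \<in> sat_set (ladder {u})"
      proof -
        have "u \<in> I \<longleftrightarrow> u \<in> J" if IJ: "I \<in> pts" "J \<in> pts" "ladder {u} I = ladder {u} J" for I J
          using refines_support[OF ladder(2,1)[OF Y] IJ]
            refines_support[OF ladder(2,1)[OF Y] IJ(2,1) IJ(3)[symmetric]] by blast
        then show ?thesis unfolding u(1) sat_set_def mem_Collect_eq
          unfolding gen_class(2)[OF u(2)] using gen_class(1)[OF u(2)] by blast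
      qed
      ultimately have "a \<in> level (H {u}) p"
        unfolding H_def part_alg_def using gen_class(2)[OF u(2)] u(1) by simp
      then show "a \<in> (\<Union>Y\<in>Fpow (Field X). level (H Y) p)" using Y by blast
    qed
    then show "ideal_gen F ?U \<subseteq> (\<Union>Y\<in>Fpow (Field X). level (H Y) p)"
      by (rule ideal_gen_least[OF idl])
    show "(\<Union>Y\<in>Fpow (Field X). level (H Y) p) \<subseteq> ideal_gen F ?U"
    proof (rule UN_least)
      fix Y assume Y: "Y \<in> Fpow (Field X)"
      note e = H_prems(1)[OF Y]
      let ?J = "ideal_gen F ?U \<inter> sat_set (ladder Y)"
      have iF: "boolean_ideal F (ideal_gen F ?U)" by (rule ideal_gen_ideal(1)[OF B U])
      show "level (H Y) p \<subseteq> ideal_gen F ?U"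
      proof
        fix a assume a: "a \<in> level (H Y) p"
        then have a': "a \<in> sat_set (ladder Y)" "\<And>I. I \<in> val X a \<Longrightarrow> (p, d (ladder Y I)) \<in> P"
          unfolding H_def part_alg_def by auto
        have "a \<in> ?J"
        proof (rule mem_ideal_of_fibres[OF e])
          show "boolean_ideal (sub (sat_set (ladder Y)) (\<lambda>p. {})) ?J"
            using iF subalg_sat_set[of "ladder Y"] unfolding boolean_ideal_def sub_simps subalg_def
            by (intro conjI ballI impI) auto
          show "a \<in> sat_set (ladder Y)" by (rule a')
          fix I assume I: "I \<in> val X a"
          let ?u = "ladder Y I"
          have u: "?u \<in> Field X" using label_field[OF ladder(1)[OF Y] val_pts[OF I]] .
          have "J \<in> val X (F_class X (Gen ?u))" if "J \<in> val X (fibre (ladder Y) ?u)" for J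
            using that ladder(1)[OF Y] unfolding fibre[OF e] gen_class(2)[OF u] label_def by force
          then have "ble F (fibre (ladder Y) ?u) (F_class X (Gen ?u))"
            using ble_F[OF pjs fibre(1)[OF e] gen_class(1)[OF u]] by blast
          moreover have "F_class X (Gen ?u) \<in> ideal_gen F ?U"
            using ideal_gen_ideal(2)[OF B U] u a'(2)[OF I] by blast
          ultimately have "fibre (ladder Y) ?u \<in> ideal_gen F ?U"
            using iF fibre(1)[OF e] unfolding boolean_ideal_def by blast
          then show "fibre (ladder Y) ?u \<in> ?J" using fibre_sat[OF e] by blast
        qed
        then show "a \<in> ideal_gen F ?U" by blast
      qed
    qed
  qed
  then show ?thesis unfolding F_scaled_sub by simp
qed

end

text \<open>The form in which preservation is used below: it is enough to give an injection of the
  index set into the type that measures smallness.\<close>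

lemma preserves_small_reindex:
  fixes g :: "'i \<Rightarrow> 'v"
  assumes "preserves_small_directed_colimits TYPE('v) C E F" "directed r" "inj_on g (Field r)"
    and "is_colimit (poset_cat r) C D c s"
  shows "is_colimit (poset_cat r) E (functor_comp F D) (FO F c) (FA F \<circ> s)"
proof (rule preserves_colimits_over_reindex)
  show "preserves_colimits_over {r :: 'v rel. directed r} C E F"
    using assms(1) unfolding preserves_small_directed_colimits_def .
  show "map_prod g g ` r \<in> {r. directed r}" using directed_image_rel[OF assms(2,3)] by simp
  show "Partial_order r" using assms(2) unfolding directed_def poset_def by blast
qed fact+

context covering
begin

subsection \<open>Evaluation at an ideal\<close>

abbreviation FS where "FS \<equiv> F_scaled P X d"

text \<open>A finite subset of a directed union lies in one of the sets. As \<open>G Z\<close> is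
  assembled from the finite subsets of \<open>Z\<close>, it commutes with such unions.\<close>

lemma G_union:
  fixes z :: "'i \<Rightarrow> 'x set"
  assumes r: "directed r" and z: "\<And>i j. (i, j) \<in> r \<Longrightarrow> z i \<subseteq> z j" "\<And>i. i \<in> Field r \<Longrightarrow> z i \<subseteq> W"
    and W: "W \<subseteq> (\<Union>i\<in>Field r. z i)"
  shows "Fpow W = (\<Union>i\<in>Field r. Fpow (z i))"
proof
  show "(\<Union>i\<in>Field r. Fpow (z i)) \<subseteq> Fpow W" using z(2) Fpow_mono by blast
  show "Fpow W \<subseteq> (\<Union>i\<in>Field r. Fpow (z i))"
  proof
    fix Y assume "Y \<in> Fpow W"
    then have "finite Y" "Y \<subseteq> W" unfolding Fpow_def by auto
    then have "\<exists>i\<in>Field r. Y \<subseteq> z i"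
    proof (induction rule: finite_induct)
      case empty
      then show ?case using r unfolding directed_def poset_def by (auto simp: Field_def)
    next
      case (insert y Y)
      then obtain i j where ij: "i \<in> Field r" "Y \<subseteq> z i" "j \<in> Field r" "y \<in> z j" using W by auto
      then obtain k where k: "(i, k) \<in> r" "(j, k) \<in> r" using r unfolding directed_def by blast
      then have "insert y Y \<subseteq> z k" using ij z(1)[OF k(1)] z(1)[OF k(2)] by auto
      then show ?case using FieldI2[OF k(1)] by blast
    qed
    then show "Y \<in> (\<Union>i\<in>Field r. Fpow (z i))" using \<open>finite Y\<close> unfolding Fpow_def by blast
  qed
qed

lemma G_SA:
  assumes "Z \<subseteq> Field X"
  shows "G Z \<in> SA"
proof (rule union_SA[of "incl_rel {Y \<in> Fpow Z. {} \<subseteq> Y}" H])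
  have *: "Y \<in> Fpow (Field X)" if "Y \<in> Fpow Z" for Y using Fpow_mono[OF assms] that by blast
  show "directed (incl_rel {Y \<in> Fpow Z. {} \<subseteq> Y})" by (rule directed_Fpow) (rule empty_in_Fpow)
  show "G Z = sub (bcarrier (G Z)) (level (G Z))" unfolding G_def by simp
qed (use H_SA H_mono Fpow_mono[OF assms] in \<open>auto simp: G_def\<close>)

lemma G_mono: "Z \<subseteq> Z' \<Longrightarrow> le (G Z) (G Z')"
  using Fpow_mono[of Z Z'] unfolding le_def G_def by auto

lemma H_G: "Y \<in> Fpow Z \<Longrightarrow> le (H Y) (G Z)"
  unfolding le_def G_def by auto

lemma FS_G:
  shows "FS = sub (bcarrier FS) (level FS)" "bcarrier FS = bcarrier (G (Field X))"
    and "p \<in> Field P \<Longrightarrow> level FS p = level (G (Field X)) p"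
  using carrier_union level_union[of p] unfolding F_scaled_sub G_def by auto

text \<open>The apex \<open>A\<close> has to agree with \<open>G W\<close> only on
  \<open>Field P\<close>. So the lemma covers both \<open>G W\<close> itself and
  \<open>F_scaled\<close>, whose levels outside \<open>P\<close> are given by another
  formula.\<close>

lemma G_colimit:
  fixes z :: "'i \<Rightarrow> 'x set"
  assumes r: "directed r" and z: "\<And>i j. (i, j) \<in> r \<Longrightarrow> z i \<subseteq> z j" "\<And>i. i \<in> Field r \<Longrightarrow> z i \<subseteq> W"
    and W: "W \<subseteq> (\<Union>i\<in>Field r. z i)" "W \<subseteq> Field X"
    and A: "A = sub (bcarrier A) (level A)" "bcarrier A = bcarrier (G W)"
      "\<And>p. p \<in> Field P \<Longrightarrow> level A p = level (G W) p"
    and cat: "category BC"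
  shows "is_colimit (poset_cat r) BC (diag (\<lambda>i. G (z i))) A (\<lambda>i. incl (G (z i)) A)" "A \<in> SA"
proof -
  note U = G_union[OF r z W(1)]
  have c: "bcarrier A = (\<Union>i\<in>Field r. bcarrier (G (z i)))"
    unfolding A(2) G_def using U by auto
  have l: "level A p = (\<Union>i\<in>Field r. level (G (z i)) p)" if "p \<in> Field P" for p
    unfolding A(3)[OF that] unfolding G_def using U by auto
  have s: "G (z i) \<in> SA" if "i \<in> Field r" for i using G_SA z(2)[OF that] W(2) by blast
  show "is_colimit (poset_cat r) BC (diag (\<lambda>i. G (z i))) A (\<lambda>i. incl (G (z i)) A)"
    by (rule union_colimit[OF r s G_mono[OF z(1)] A(1) c l cat])
  show "A \<in> SA" by (rule union_SA[OF r s G_mono[OF z(1)] A(1) c l])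
qed

lemma H_FS: "Y \<in> Fpow (Field X) \<Longrightarrow> le (H Y) FS"
  and G_FS: "Z \<subseteq> Field X \<Longrightarrow> le (G Z) FS"
  using H_G[of Y "Field X"] G_mono[of Z "Field X"] FS_G unfolding le_def by auto

text \<open>The finite sets containing \<open>W\<close> are cofinal among all finite subsets of
  \<open>X\<close>. Later \<open>W = {w}\<close>, with \<open>w\<close> a member of a sharp ideal
  realising its norm.\<close>

lemma H_colimit:
  assumes W: "W \<in> Fpow (Field X)" and cat: "category BC"
  defines "r \<equiv> incl_rel {Y \<in> Fpow (Field X). W \<subseteq> Y}"
  shows "is_colimit (poset_cat r) BC (diag H) FS (\<lambda>Y. incl (H Y) FS)" "FS \<in> SA"
proof -
  have dir: "directed r" unfolding r_def using directed_Fpow[OF W] .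
  have F: "Field r = {Y \<in> Fpow (Field X). W \<subseteq> Y}" unfolding r_def by simp
  have s: "H Y \<in> SA" if "Y \<in> Field r" for Y using that H_SA unfolding F by blast
  have m: "le (H Y) (H Y')" if "(Y, Y') \<in> r" for Y Y' using that H_mono unfolding r_def by simp
  have enl: "\<exists>Y'\<in>Field r. le (H Y) (H Y')" if "Y \<in> Fpow (Field X)" for Y
    using Fpow_Un[OF that W] H_mono[of "Y \<union> W" Y] unfolding F by (intro bexI[of _ "Y \<union> W"]) auto
  have c: "bcarrier FS = (\<Union>Y\<in>Field r. bcarrier (H Y))"
  proof -
    have "bcarrier FS = (\<Union>Y\<in>Fpow (Field X). bcarrier (H Y))" unfolding FS_G(2) G_def by simp
    also have "\<dots> = (\<Union>Y\<in>Field r. bcarrier (H Y))"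
    proof
      show "(\<Union>Y\<in>Fpow (Field X). bcarrier (H Y)) \<subseteq> (\<Union>Y\<in>Field r. bcarrier (H Y))"
      proof (rule UN_least)
        fix Y assume "Y \<in> Fpow (Field X)"
        then obtain Y' where "Y' \<in> Field r" "le (H Y) (H Y')" using enl by blast
        then show "bcarrier (H Y) \<subseteq> (\<Union>Y\<in>Field r. bcarrier (H Y))" unfolding le_def by blast
      qed
      show "(\<Union>Y\<in>Field r. bcarrier (H Y)) \<subseteq> (\<Union>Y\<in>Fpow (Field X). bcarrier (H Y))"
        unfolding F by blast
    qed
    finally show ?thesis .
  qed
  have l: "level FS p = (\<Union>Y\<in>Field r. level (H Y) p)" if p: "p \<in> Field P" for p
  proof -
    have "level FS p = (\<Union>Y\<in>Fpow (Field X). level (H Y) p)" unfolding FS_G(3)[OF p] G_def by simp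
    also have "\<dots> = (\<Union>Y\<in>Field r. level (H Y) p)"
    proof
      show "(\<Union>Y\<in>Fpow (Field X). level (H Y) p) \<subseteq> (\<Union>Y\<in>Field r. level (H Y) p)"
      proof (rule UN_least)
        fix Y assume "Y \<in> Fpow (Field X)"
        then obtain Y' where "Y' \<in> Field r" "le (H Y) (H Y')" using enl by blast
        then show "level (H Y) p \<subseteq> (\<Union>Y\<in>Field r. level (H Y) p)" using p unfolding le_def by blast
      qed
      show "(\<Union>Y\<in>Field r. level (H Y) p) \<subseteq> (\<Union>Y\<in>Fpow (Field X). level (H Y) p)"
        unfolding F by blast
    qed
    finally show ?thesis .
  qed
  show "is_colimit (poset_cat r) BC (diag H) FS (\<lambda>Y. incl (H Y) FS)"
    by (rule union_colimit[OF dir s m FS_G(1) c l cat])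
  show "FS \<in> SA" by (rule union_SA[OF dir s m FS_G(1) c l])
qed

text \<open>The one-block partition, that is, the two-element algebra whose only atom has norm
  \<open>q\<close>. Tensoring it with the diagram gives a product with the single factor
  \<open>FO D q\<close>.\<close>

definition TWO :: "'p \<Rightarrow> ('x bterm set, 'p) sbalg" where
  "TWO q = part_alg (\<lambda>_. ()) (\<lambda>_. q)"

lemma finsupp_const: "finsupp (\<lambda>_. ())"
  unfolding finsupp_def support_def by blast

lemma fibre_const: "fibre (\<lambda>_. ()) u = bone F"
  by (rule F_inj[OF fibre(1)[OF finsupp_const] F_closed(2)]) (simp add: fibre(2)[OF finsupp_const] F_val(2))

lemma TWO_SA: "q \<in> Field P \<Longrightarrow> TWO q \<in> SA"
  unfolding TWO_def by (rule part_SA[OF finsupp_const])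

lemma TWO_compact: "q \<in> Field P \<Longrightarrow> compact_sbalg P (TWO q)"
  unfolding TWO_def by (rule part_compact[OF finsupp_const])

lemma TWO_atoms: "q \<in> Field P \<Longrightarrow> atoms (TWO q) = {bone F}"
  unfolding TWO_def using pts_nonempty by (subst part_atoms[OF finsupp_const]) (auto simp: fibre_const)

lemma TWO_norm:
  assumes "q \<in> Field P"
  shows "atom_norm P (TWO q) (bone F) = q"
proof -
  obtain I where "I \<in> pts" using pts_nonempty by blast
  then show ?thesis
    using part_norm[OF finsupp_const, of "\<lambda>_. q" I] assms unfolding TWO_def fibre_const by simp
qed

lemma TWO_simps:
  "bcarrier (TWO q) = {bzero F, bone F}"
  "level (TWO q) p = (if (p, q) \<in> P then {bzero F, bone F} else {bzero F})"
proof -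
  have "a = bzero F \<or> a = bone F" if a: "a \<in> sat_set (\<lambda>_. ())" for a
  proof (cases "val X a = {}")
    case True
    then show ?thesis using F_inj[OF sat_set_sub[OF a] F_closed(1)] F_val(1) by simp
  next
    case False
    then obtain I where I: "I \<in> val X a" by blast
    then have "J \<in> val X a" if "J \<in> pts" for J
      using sat_setD[OF a that val_pts[OF I]] by simp
    then have "val X a = pts" using val_pts by blast
    then show ?thesis using F_inj[OF sat_set_sub[OF a] F_closed(2)] F_val(2) by simp
  qed
  moreover have "bzero F \<in> sat_set (\<lambda>_. ())" "bone F \<in> sat_set (\<lambda>_. ())"
    using subalg_sat_set unfolding subalg_def by auto
  ultimately have c: "sat_set (\<lambda>_. ()) = {bzero F, bone F}" by blast
  then show "bcarrier (TWO q) = {bzero F, bone F}" unfolding TWO_def part_alg_def by simp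
  have "{a \<in> {bzero F, bone F}. \<forall>I\<in>val X a. (p, q) \<in> P} =
      (if (p, q) \<in> P then {bzero F, bone F} else {bzero F})"
    using pts_nonempty F_val(1,2) by auto
  then show "level (TWO q) p = (if (p, q) \<in> P then {bzero F, bone F} else {bzero F})"
    unfolding TWO_def part_alg_def sub_simps c .
qed

lemma TWO_mono:
  assumes "(a, b) \<in> P"
  shows "le (TWO a) (TWO b)"
  using P_order(2)[OF P_po _ assms] unfolding le_def TWO_simps by auto

text \<open>The point \<open>x\<close> of the Stone space, read as a morphism to the two-element
  algebra of norm \<open>q\<close>.\<close>

definition ev where
  "ev A x q = (A, \<lambda>a\<in>bcarrier A. if x \<in> val X a then bone F else bzero F, TWO q)"

lemma ev_hom:
  assumes A: "A \<in> SA" and x: "x \<in> pts" and q: "q \<in> Field P"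
    and lev: "\<And>p a. p \<in> Field P \<Longrightarrow> a \<in> level A p \<Longrightarrow> x \<in> val X a \<Longrightarrow> (p, q) \<in> P"
  shows "ev A x q \<in> hom BC A (TWO q)"
proof -
  let ?f = "\<lambda>a\<in>bcarrier A. if x \<in> val X a then bone F else bzero F"
  note F = SA_carrier[OF A, THEN subsetD]
  note cl = balg_closed[OF SA_boolean[OF A], unfolded SA_ops[OF A]]
  have ops: "bmeet F (bone F) (bone F) = bone F" "bmeet F (bone F) (bzero F) = bzero F"
    "bmeet F (bzero F) (bone F) = bzero F" "bmeet F (bzero F) (bzero F) = bzero F"
    "bjoin F (bone F) (bone F) = bone F" "bjoin F (bone F) (bzero F) = bone F"
    "bjoin F (bzero F) (bone F) = bone F" "bjoin F (bzero F) (bzero F) = bzero F"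
    "bneg F (bone F) = bzero F" "bneg F (bzero F) = bone F"
    by (rule F_inj; use F_closed in \<open>auto simp: F_val\<close>)+
  have "boolean_hom A (TWO q) ?f"
    unfolding boolean_hom_def SA_ops[OF A] SA_ops[OF TWO_SA[OF q]]
  proof (intro conjI ballI)
    show "?f ` bcarrier A \<subseteq> bcarrier (TWO q)" unfolding TWO_simps by auto
    show "?f (bzero F) = bzero F" "?f (bone F) = bone F"
      using cl(1,2) F_val(1,2) x by auto
    fix a assume a: "a \<in> bcarrier A"
    show "?f (bneg F a) = bneg F (?f a)"
      using a cl(3)[OF a] F_val(3)[OF F[OF a]] x by (simp add: ops)
    fix b assume b: "b \<in> bcarrier A"
    show "?f (bmeet F a b) = bmeet F (?f a) (?f b)"
      using a b cl(4)[OF a b] F_val(4)[OF F[OF a] F[OF b]] by (simp add: ops)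
    show "?f (bjoin F a b) = bjoin F (?f a) (?f b)"
      using a b cl(5)[OF a b] F_val(5)[OF F[OF a] F[OF b]] by (simp add: ops)
  qed
  moreover have "?f ` level A p \<subseteq> level (TWO q) p" if p: "p \<in> Field P" for p
    unfolding TWO_simps using lev[OF p] SA_level[OF A p] by auto
  ultimately show ?thesis
    using SA_scaled[OF A] SA_scaled[OF TWO_SA[OF q]] SA_ops[OF A] SA_ops[OF TWO_SA[OF q]] zero_one
    unfolding Bool_cat_nt_hom ev_def by auto
qed

lemma ev_incl: "le A B \<Longrightarrow> Cmp BC (ev B x q) (incl A B) = ev A x q"
  unfolding ev_def using incl_cmp by (auto simp: restrict_def fun_eq_iff le_def)

lemma incl_ev: "Cmp BC (incl (TWO a) (TWO b)) (ev A x a) = ev A x b"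
  unfolding ev_def incl_def Bool_cat_nt_simps compose_def TWO_simps by (auto simp: restrict_def fun_eq_iff)

definition norm_of :: "'x set \<Rightarrow> 'p \<Rightarrow> bool" where
  "norm_of x q \<longleftrightarrow> x \<in> pts \<and> greatest_in P (d ` x) q"

lemma norm_ofD:
  assumes "norm_of x q"
  shows "x \<in> pts" "q \<in> Field P" "u \<in> x \<Longrightarrow> (d u, q) \<in> P" "\<exists>w\<in>x. d w = q"
proof -
  show x: "x \<in> pts" using assms unfolding norm_of_def by blast
  show "\<exists>w\<in>x. d w = q" "u \<in> x \<Longrightarrow> (d u, q) \<in> P"
    using assms unfolding norm_of_def greatest_in_def by auto
  then show "q \<in> Field P" using x d_field unfolding poset_ideal_def by auto
qed

text \<open>An element of level \<open>p\<close> that is true at \<open>x\<close> contains a fibre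
  through \<open>x\<close> whose label has norm at least \<open>p\<close>. The label is a member of
  \<open>x\<close>, so its norm is at most that of \<open>x\<close>.\<close>

lemma ev_FS:
  assumes "norm_of x q" "category BC"
  shows "ev FS x q \<in> hom BC FS (TWO q)"
proof (rule ev_hom)
  show "FS \<in> SA" using H_colimit(2)[OF empty_in_Fpow assms(2)] .
  show "x \<in> pts" "q \<in> Field P" using norm_ofD[OF assms(1)] by auto
  fix p a assume p: "p \<in> Field P" and a: "a \<in> level FS p" "x \<in> val X a"
  then obtain Y where Y: "Y \<in> Fpow (Field X)" "a \<in> level (H Y) p" using level_union by blast
  then have "(p, d (ladder Y x)) \<in> P" using a(2) unfolding H_def part_alg_def by auto
  moreover have "ladder Y x \<in> x" using ladder(1)[OF Y(1)] norm_ofD(1)[OF assms(1)] unfolding label_def by blast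
  ultimately show "(p, q) \<in> P" using norm_ofD(3)[OF assms(1)] P_order(2)[OF P_po] by blast
qed

text \<open>The generators on which all labellings entering \<open>G Z\<close> depend. Ideals with
  the same trace on \<open>GS Z\<close> have the same evaluation on \<open>G Z\<close>, by
  \<open>ev_G_eq\<close>.\<close>

definition GS :: "'x set \<Rightarrow> 'x set" where "GS Z = (\<Union>Y\<in>Fpow Z. lsupp Y)"

lemma ev_G_eq:
  assumes "Z \<subseteq> Field X" "x \<in> pts" "y \<in> pts" "x \<inter> GS Z = y \<inter> GS Z"
  shows "ev (G Z) x q = ev (G Z) y q"
proof -
  have "x \<in> val X a \<longleftrightarrow> y \<in> val X a" if a: "a \<in> bcarrier (G Z)" for a
  proof -
    obtain Y where Y: "Y \<in> Fpow Z" "a \<in> bcarrier (H Y)" using a unfolding G_def by auto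
    have Y': "Y \<in> Fpow (Field X)" using Fpow_mono[OF assms(1)] Y(1) by blast
    have "x \<inter> lsupp Y = y \<inter> lsupp Y" using assms(4) Y(1) unfolding GS_def by blast
    then have "ladder Y x = ladder Y y" using lsupp(3)[OF Y'] assms(2,3) unfolding support_def by blast
    moreover have "a \<in> sat_set (ladder Y)" using Y(2) unfolding H_def part_alg_def by simp
    ultimately show ?thesis using sat_setD[OF _ assms(2,3)] by blast
  qed
  then have "(if x \<in> val X a then bone F else bzero F) = (if y \<in> val X a then bone F else bzero F)"
    if "a \<in> bcarrier (G Z)" for a using that by simp
  then show ?thesis unfolding ev_def by (simp cong: restrict_cong)
qed

end

section \<open>Projections of a condensate\<close>

locale condensate = covering P X d
  for P :: "'p rel" and X :: "'x rel" and d :: "'x \<Rightarrow> 'p" +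
  fixes C :: "('o, 'a) cat" and D :: "('p, 'o, 'a) diagram"
    and T :: "(('x bterm set, 'p) sbalg,
       ('x bterm set, 'p) sbalg \<times> ('x bterm set \<Rightarrow> 'x bterm set) \<times> ('x bterm set, 'p) sbalg,
       'o, 'a) cfunctor"
    and pr :: "('x bterm set, 'p) sbalg \<Rightarrow> 'x bterm set \<Rightarrow> 'a"
  assumes D: "is_functor (poset_cat P) C D" and T: "is_functor BC C T"
    and T_pres: "preserves_small_directed_colimits TYPE('x bterm set) BC C T"
    and pr: "\<And>A. A \<in> Obj BC \<Longrightarrow> compact_sbalg P A \<Longrightarrow>
      is_product C (atoms A) (\<lambda>u. FO D (atom_norm P A u)) (FO T A) (pr A)"
    and pr_nat: "\<And>A f B v. (A, f, B) \<in> Arr BC \<Longrightarrow> compact_sbalg P A \<Longrightarrow> compact_sbalg P B \<Longrightarrow>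
      v \<in> atoms B \<Longrightarrow> Cmp C (pr B v) (FA T (A, f, B)) =
      (let u = (THE u. u \<in> atoms A \<and> ble B v (f u)) in
        Cmp C (FA D (atom_norm P A u, atom_norm P B v)) (pr A u))"
begin

lemma cats: "category BC" "category C"
  using functor_cats[OF T] .

lemma FS_SA: "FS \<in> SA"
  using H_colimit(2)[OF empty_in_Fpow cats(1)] .

text \<open>Replaces the definite description in the tensor functor by an explicit atom
  \<open>u\<close>, given a proof that it is the only candidate.\<close>

lemma pr_nat':
  assumes f: "(A, f, B) \<in> hom BC A B" and cA: "compact_sbalg P A" and cB: "compact_sbalg P B"
    and v: "v \<in> atoms B" and u: "u \<in> atoms A" "ble B v (f u)"
    and unique: "\<And>u'. u' \<in> atoms A \<Longrightarrow> ble B v (f u') \<Longrightarrow> u' = u"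
  shows "Cmp C (pr B v) (FA T (A, f, B)) = Cmp C (FA D (atom_norm P A u, atom_norm P B v)) (pr A u)"
proof -
  have eq: "(THE u. u \<in> atoms A \<and> ble B v (f u)) = u"
    by (rule the_equality, rule conjI[OF u], erule conjE, rule unique)
  have "(A, f, B) \<in> Arr BC" using f unfolding hom_def by simp
  from pr_nat[OF this cA cB v] show ?thesis unfolding eq Let_def .
qed

lemma D_hom: "(a, b) \<in> P \<Longrightarrow> FA D (a, b) \<in> hom C (FO D a) (FO D b)"
  and D_ident: "a \<in> Field P \<Longrightarrow> FA D (a, a) = Ident C (FO D a)"
  and D_obj: "a \<in> Field P \<Longrightarrow> FO D a \<in> Obj C"
  using D unfolding is_functor_poset[OF P_po] by blast+

lemma pr_TWO_hom: "q \<in> Field P \<Longrightarrow> pr (TWO q) (bone F) \<in> hom C (FO T (TWO q)) (FO D q)"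
  using pr[OF SA_obj[OF TWO_SA] TWO_compact, of q] TWO_atoms TWO_norm
  unfolding is_product_def by auto

text \<open>The projections of the one-factor products are natural in the norm, since an inclusion
  of two-element algebras matches the only atoms.\<close>

lemma pr_TWO:
  assumes ab: "(a, b) \<in> P"
  shows "Cmp C (pr (TWO b) (bone F)) (FA T (incl (TWO a) (TWO b))) =
         Cmp C (FA D (a, b)) (pr (TWO a) (bone F))"
proof -
  have F: "a \<in> Field P" "b \<in> Field P" using FieldI1[OF ab] FieldI2[OF ab] by auto
  have one: "ble (TWO b) (bone F) (bone F)"
    using ble_F[OF pjs F_closed(2) F_closed(2)] unfolding SA_ops(6)[OF TWO_SA[OF F(2)]] by simp
  have "Cmp C (pr (TWO b) (bone F)) (FA T (TWO a, \<lambda>x\<in>bcarrier (TWO a). x, TWO b)) =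
      Cmp C (FA D (atom_norm P (TWO a) (bone F), atom_norm P (TWO b) (bone F))) (pr (TWO a) (bone F))"
  proof (rule pr_nat'[OF _ TWO_compact[OF F(1)] TWO_compact[OF F(2)]])
    show "(TWO a, \<lambda>x\<in>bcarrier (TWO a). x, TWO b) \<in> hom BC (TWO a) (TWO b)"
      using incl_hom[OF TWO_SA[OF F(1)] TWO_SA[OF F(2)] TWO_mono[OF ab]] unfolding incl_def .
    show "ble (TWO b) (bone F) ((\<lambda>x\<in>bcarrier (TWO a). x) (bone F))"
      using one by (simp add: TWO_simps(1))
  qed (simp_all add: TWO_atoms F)
  then show ?thesis unfolding TWO_norm[OF F(1)] TWO_norm[OF F(2)] incl_def .
qed

definition proj where
  "proj x q = Cmp C (pr (TWO q) (bone F)) (FA T (ev FS x q))"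

lemma proj_hom:
  assumes "norm_of x q"
  shows "proj x q \<in> hom C (FO T FS) (FO D q)"
  unfolding proj_def
  using hom_cmp[OF cats(2) functor_hom[OF T ev_FS[OF assms cats(1)]] pr_TWO_hom] norm_ofD(2)[OF assms]
  by blast

lemma proj_incl:
  assumes n: "norm_of x q" and A: "A \<in> SA" "le A FS"
  shows "Cmp C (proj x q) (FA T (incl A FS)) = Cmp C (pr (TWO q) (bone F)) (FA T (ev A x q))"
proof -
  have i: "incl A FS \<in> hom BC A FS" by (rule incl_hom[OF A(1) FS_SA A(2)])
  have e: "ev FS x q \<in> hom BC FS (TWO q)" by (rule ev_FS[OF n cats(1)])
  have "Cmp C (proj x q) (FA T (incl A FS)) =
      Cmp C (pr (TWO q) (bone F)) (Cmp C (FA T (ev FS x q)) (FA T (incl A FS)))"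
    unfolding proj_def
    using cmp_assoc[OF cats(2) functor_hom[OF T i] functor_hom[OF T e] pr_TWO_hom] norm_ofD(2)[OF n]
    by simp
  then show ?thesis unfolding functor_cmp[OF T i e, symmetric] ev_incl[OF A(2)] .
qed

lemma ev_sub_hom:
  assumes n: "norm_of x q" and A: "A \<in> SA" "le A FS"
  shows "ev A x q \<in> hom BC A (TWO q)"
  using hom_cmp[OF cats(1) incl_hom[OF A(1) FS_SA A(2)] ev_FS[OF n cats(1)]]
  unfolding ev_incl[OF A(2)] .

text \<open>Raising the norm after evaluating at \<open>x\<close> in \<open>TWO a\<close> amounts to
  evaluating at \<open>x\<close> in \<open>TWO b\<close>. On \<open>G Z\<close> this equals
  evaluation at \<open>y\<close>, as the two traces on \<open>GS Z\<close> agree.\<close>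

lemma proj_natural:
  assumes x: "norm_of x a" and y: "norm_of y b" and ab: "(a, b) \<in> P" and Z: "Z \<subseteq> Field X"
    and eq: "x \<inter> GS Z = y \<inter> GS Z"
  shows "Cmp C (FA D (a, b)) (Cmp C (proj x a) (FA T (incl (G Z) FS))) =
         Cmp C (proj y b) (FA T (incl (G Z) FS))"
proof -
  note GZ = G_SA[OF Z] G_FS[OF Z]
  note F = norm_ofD(2)[OF x] norm_ofD(2)[OF y]
  note i = incl_hom[OF TWO_SA[OF F(1)] TWO_SA[OF F(2)] TWO_mono[OF ab]]
  note e = ev_sub_hom[OF x GZ]
  have "Cmp C (FA D (a, b)) (Cmp C (proj x a) (FA T (incl (G Z) FS))) =
      Cmp C (FA D (a, b)) (Cmp C (pr (TWO a) (bone F)) (FA T (ev (G Z) x a)))"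
    unfolding proj_incl[OF x GZ] ..
  also have "\<dots> = Cmp C (Cmp C (FA D (a, b)) (pr (TWO a) (bone F))) (FA T (ev (G Z) x a))"
    by (rule cmp_assoc[OF cats(2) functor_hom[OF T e] pr_TWO_hom[OF F(1)] D_hom[OF ab]])
  also have "\<dots> = Cmp C (Cmp C (pr (TWO b) (bone F)) (FA T (incl (TWO a) (TWO b)))) (FA T (ev (G Z) x a))"
    unfolding pr_TWO[OF ab] ..
  also have "\<dots> = Cmp C (pr (TWO b) (bone F)) (Cmp C (FA T (incl (TWO a) (TWO b))) (FA T (ev (G Z) x a)))"
    by (rule cmp_assoc[OF cats(2) functor_hom[OF T e] functor_hom[OF T i] pr_TWO_hom[OF F(2)], symmetric])
  also have "\<dots> = Cmp C (pr (TWO b) (bone F)) (FA T (ev (G Z) x b))"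
    unfolding functor_cmp[OF T e i, symmetric] incl_ev ..
  also have "\<dots> = Cmp C (proj y b) (FA T (incl (G Z) FS))"
    unfolding proj_incl[OF y GZ] ev_G_eq[OF Z norm_ofD(1)[OF x] norm_ofD(1)[OF y] eq] ..
  finally show ?thesis .
qed

text \<open>As \<open>w\<close> belongs to \<open>Y\<close>, the label of \<open>x\<close> lies
  above \<open>w\<close> and within \<open>x\<close>, so antisymmetry pins its norm to
  \<open>q\<close>. The transition arrow of the diagram is then an identity, and
  \<open>proj x q\<close> restricts on \<open>H Y\<close> to a canonical projection of the product
  over atoms.\<close>

lemma proj_H:
  assumes n: "norm_of x q" and w: "w \<in> x" "d w = q" and Y: "Y \<in> Fpow (Field X)" "w \<in> Y"
  shows "Cmp C (proj x q) (FA T (incl (H Y) FS)) = pr (H Y) (fibre (ladder Y) (ladder Y x))"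
    and "fibre (ladder Y) (ladder Y x) \<in> atoms (H Y)"
    and "atom_norm P (H Y) (fibre (ladder Y) (ladder Y x)) = q"
    and "pr (H Y) (fibre (ladder Y) (ladder Y x)) \<in> hom C (FO T (H Y)) (FO D q)"
proof -
  let ?u = "fibre (ladder Y) (ladder Y x)"
  note x = norm_ofD(1)[OF n] and q = norm_ofD(2)[OF n]
  note HY = H_SA[OF Y(1)] H_FS[OF Y(1)]
  note e = H_prems(1)[OF Y(1)] H_prems(2)[OF Y(1)]
  have "ladder Y x \<in> x" using ladder(1)[OF Y(1)] x unfolding label_def by blast
  moreover have "(w, ladder Y x) \<in> X" using ladder(2)[OF Y(1)] x w Y(2) unfolding refines_def by blast
  ultimately have dq: "d (ladder Y x) = q"
    using w norm_ofD(3)[OF n] d_mono P_order(3)[OF P_po] by blast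
  have atoms: "atoms (H Y) = fibre (ladder Y) ` ladder Y ` pts"
    unfolding H_def by (rule part_atoms[of _ d, OF e])
  then show u: "?u \<in> atoms (H Y)" using x by blast
  show nu: "atom_norm P (H Y) ?u = q"
    unfolding H_def dq[symmetric] by (rule part_norm[of _ d, OF e x])
  have cH: "compact_sbalg P (H Y)" unfolding H_def by (rule part_compact[of _ d, OF e])
  show h: "pr (H Y) ?u \<in> hom C (FO T (H Y)) (FO D q)"
    using pr[OF SA_obj[OF HY(1)] cH] u nu unfolding is_product_def by auto
  have at: "a \<in> bcarrier (H Y)" if "a \<in> atoms (H Y)" for a using that unfolding atoms_def by blast
  have ble: "ble (TWO q) (bone F) c \<longleftrightarrow> c = bone F" if "c \<in> {bzero F, bone F}" for c
    using that ble_F[OF pjs F_closed(2,2)] ble_F[OF pjs F_closed(2,1)] F_val(1,2) pts_nonempty zero_one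
    unfolding SA_ops(6)[OF TWO_SA[OF q]] by auto
  have "Cmp C (pr (TWO q) (bone F)) (FA T (ev (H Y) x q)) =
      Cmp C (FA D (atom_norm P (H Y) ?u, atom_norm P (TWO q) (bone F))) (pr (H Y) ?u)"
    unfolding ev_def
  proof (rule pr_nat'[OF _ cH TWO_compact[OF q] _ u])
    show "(H Y, \<lambda>a\<in>bcarrier (H Y). if x \<in> val X a then bone F else bzero F, TWO q) \<in> hom BC (H Y) (TWO q)"
      using ev_sub_hom[OF n HY] unfolding ev_def .
    show "bone F \<in> atoms (TWO q)" using TWO_atoms[OF q] by simp
    show "ble (TWO q) (bone F) ((\<lambda>a\<in>bcarrier (H Y). if x \<in> val X a then bone F else bzero F) ?u)"
      using at[OF u] fibre(2)[OF e(1)] x ble by simp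
    fix u' assume u': "u' \<in> atoms (H Y)"
      "ble (TWO q) (bone F) ((\<lambda>a\<in>bcarrier (H Y). if x \<in> val X a then bone F else bzero F) u')"
    then have "x \<in> val X u'" using at[OF u'(1)] ble zero_one by (auto split: if_splits)
    moreover obtain I where I: "u' = fibre (ladder Y) (ladder Y I)" using u'(1) unfolding atoms by blast
    ultimately have "ladder Y x = ladder Y I" using fibre(2)[OF e(1)] by simp
    then show "u' = ?u" unfolding I by simp
  qed
  also have "\<dots> = pr (H Y) ?u"
    unfolding nu TWO_norm[OF q] D_ident[OF q] by (rule cmp_ident(2)[OF cats(2) h])
  finally show "Cmp C (proj x q) (FA T (incl (H Y) FS)) = pr (H Y) ?u"
    unfolding proj_incl[OF n HY] .
qed

text \<open>\<open>extended_projection\<close> asks for products indexed by sets of natural numbers,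
  while the tensor functor yields products indexed by atoms.\<close>

lemma is_product_reindex:
  assumes p: "is_product C K F' c pr'" and f: "bij_betw f K' K"
  shows "is_product C K' (F' \<circ> f) c (pr' \<circ> f)"
proof -
  have K: "K = f ` K'" and inj: "inj_on f K'" using f unfolding bij_betw_def by auto
  have "\<exists>!h. h \<in> hom C c' c \<and> (\<forall>k\<in>K'. Cmp C (pr' (f k)) h = q k)"
    if "c' \<in> Obj C" "\<forall>k\<in>K'. q k \<in> hom C c' (F' (f k))" for c' q
  proof -
    define q' where "q' = q \<circ> inv_into K' f"
    have q': "q' (f k) = q k" if "k \<in> K'" for k using inj that unfolding q'_def by simp
    have "\<forall>k\<in>K. q' k \<in> hom C c' (F' k)" unfolding K using that(2) q' by simp
    then have "\<exists>!h. h \<in> hom C c' c \<and> (\<forall>k\<in>K. Cmp C (pr' k) h = q' k)"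
      using p that(1) unfolding is_product_def by blast
    then show ?thesis unfolding K using q' by simp
  qed
  then show ?thesis using p K unfolding is_product_def by auto
qed

text \<open>Take the finite sets \<open>Y\<close> containing some \<open>w\<close> in
  \<open>x\<close> with \<open>d w = q\<close>. Over this system the source is the colimit of the
  products at \<open>H Y\<close>, the target is a constant diagram, and \<open>proj_H\<close>
  identifies the components with canonical projections.\<close>

lemma proj_extended:
  assumes n: "norm_of x q"
  shows "extended_projection TYPE('x bterm set) C (proj x q)"
proof -
  note x = norm_ofD(1)[OF n] and q = norm_ofD(2)[OF n]
  obtain w where w: "w \<in> x" "d w = q" using norm_ofD(4)[OF n] by blast
  have wF: "w \<in> Field X" using w x unfolding poset_ideal_def by blast
  define r where "r = incl_rel {Y \<in> Fpow (Field X). {w} \<subseteq> Y}"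
  have W: "{w} \<in> Fpow (Field X)" using wF unfolding Fpow_def by simp
  have dir: "directed r" unfolding r_def using directed_Fpow[OF W] .
  have po: "Partial_order r" using dir unfolding directed_def poset_def by blast
  have F: "Y \<in> Fpow (Field X)" "w \<in> Y" if "Y \<in> Field r" for Y using that unfolding r_def by auto
  \<comment> \<open>A finite set of elements of \<open>X\<close> is coded by the set of the
    corresponding generator terms, an element of the type that measures smallness.\<close>
  let ?g = "\<lambda>Y. Gen ` Y"
  have inj: "inj_on ?g (Field r)" by (rule inj_onI) (auto simp: inj_image_eq_iff inj_def)
  let ?D = "functor_comp T (diag H)"
  let ?E = "\<lparr>FO = \<lambda>i. FO D q, FA = \<lambda>f. Ident C (FO D q)\<rparr>"
  let ?pi = "\<lambda>Y. pr (H Y) (fibre (ladder Y) (ladder Y x))"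
  let ?s = "FA T \<circ> (\<lambda>Y. incl (H Y) FS)"
  note phi = proj_H[OF n w F]
  have colD: "is_colimit (poset_cat r) C ?D (FO T FS) ?s"
    by (rule preserves_small_reindex[OF T_pres dir inj])
      (use H_colimit(1)[OF W cats(1)] in \<open>simp add: r_def\<close>)
  have colE: "is_colimit (poset_cat r) C ?E (FO D q) (\<lambda>i. Ident C (FO D q))"
    by (rule is_colimit_const[OF dir cats(2) D_obj[OF q]])
  have fac: "Cmp C (proj x q) (?s Y) = ?pi Y" if "Y \<in> Field r" for Y
    using phi(1)[OF that that] by simp
  have nat: "Cmp C (?pi Y') (FA ?D (Y, Y')) = ?pi Y" if YY: "(Y, Y') \<in> r" for Y Y'
  proof -
    note FY = FieldI1[OF YY] FieldI2[OF YY]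
    have co: "is_cocone (poset_cat r) C ?D (FO T FS) ?s" and fD: "is_functor (poset_cat r) C ?D"
      using colD unfolding is_colimit_def by auto
    have 1: "FA ?D (Y, Y') \<in> hom C (FO ?D Y) (FO ?D Y')"
      using fD YY unfolding is_functor_poset[OF po] by blast
    have 2: "?s Y' \<in> hom C (FO ?D Y') (FO T FS)" "Cmp C (?s Y') (FA ?D (Y, Y')) = ?s Y"
      using co YY FY unfolding is_cocone_poset by blast+
    show ?thesis
      using cmp_assoc[OF cats(2) 1 2(1) proj_hom[OF n]] fac[OF FY(1)] fac[OF FY(2)] 2(2) by simp
  qed
  let ?h = "inv_into (Field r) ?g" and ?r = "map_prod ?g ?g ` r"
  have h: "?h (?g Y) = Y" if "Y \<in> Field r" for Y using inj that by (rule inv_into_f_f)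
  have Fr: "Field ?r = ?g ` Field r" by (rule Field_image_rel)
  have dir': "directed ?r" by (rule directed_image_rel[OF dir inj])
  have colD': "is_colimit (poset_cat ?r) C (reindex ?h ?D) (FO T FS) (?s \<circ> ?h)"
    by (rule is_colimit_reindex'(1)[OF po inj, THEN iffD2, OF colD])
  have colE': "is_colimit (poset_cat ?r) C (reindex ?h ?E) (FO D q) ((\<lambda>i. Ident C (FO D q)) \<circ> ?h)"
    by (rule is_colimit_reindex'(1)[OF po inj, THEN iffD2, OF colE])
  have nt: "nat_trans (poset_cat ?r) C (reindex ?h ?D) (reindex ?h ?E) (?pi \<circ> ?h)"
    unfolding nat_trans_def
  proof (intro conjI ballI)
    show "is_functor (poset_cat ?r) C (reindex ?h ?D)" "is_functor (poset_cat ?r) C (reindex ?h ?E)"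
      using colD' colE' unfolding is_colimit_def by auto
    show "(?pi \<circ> ?h) i \<in> hom C (FO (reindex ?h ?D) i) (FO (reindex ?h ?E) i)"
      if "i \<in> Obj (poset_cat ?r)" for i
    proof -
      obtain Y where Y: "Y \<in> Field r" "i = ?g Y" using \<open>i \<in> Obj (poset_cat ?r)\<close> unfolding poset_cat_simps Fr by blast
      show ?thesis using phi(4)[OF Y(1) Y(1)] by (simp add: Y(2) h[OF Y(1)])
    qed
    show "Cmp C ((?pi \<circ> ?h) (Cod (poset_cat ?r) f)) (FA (reindex ?h ?D) f) =
        Cmp C (FA (reindex ?h ?E) f) ((?pi \<circ> ?h) (Dom (poset_cat ?r) f))"
      if "f \<in> Arr (poset_cat ?r)" for f
    proof -
      obtain Y Y' where Y: "(Y, Y') \<in> r" "f = (?g Y, ?g Y')" using \<open>f \<in> Arr (poset_cat ?r)\<close> by auto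
      note FY = FieldI1[OF Y(1)] FieldI2[OF Y(1)]
      show ?thesis
        using nat[OF Y(1)] cmp_ident(2)[OF cats(2) phi(4)[OF FY(1) FY(1)]]
        by (simp add: Y(2) h[OF FY(1)] h[OF FY(2)] reindex_def)
    qed
  qed
  have ps: "\<exists>(K :: nat set) F' pr'. finite K \<and> K \<noteq> {} \<and>
      is_product C K F' (FO (reindex ?h ?D) i) pr' \<and>
      (\<exists>k\<in>K. FO (reindex ?h ?E) i = F' k \<and> (?pi \<circ> ?h) i = pr' k)" if i: "i \<in> Field ?r" for i
  proof -
    obtain Y where Y: "Y \<in> Field r" "i = ?g Y" using i unfolding Fr by blast
    note e = H_prems[OF F(1)[OF Y(1)]]
    have cH: "compact_sbalg P (H Y)" unfolding H_def by (rule part_compact[of _ d, OF e])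
    have "finite (atoms (H Y))"
      using cH finite_subset[of "atoms (H Y)" "bcarrier (H Y)"]
      unfolding compact_sbalg_def atoms_def by auto
    then obtain f where f: "bij_betw f {0..<card (atoms (H Y))} (atoms (H Y))"
      using ex_bij_betw_nat_finite by blast
    let ?K = "{0..<card (atoms (H Y))}"
    have "is_product C ?K ((\<lambda>u. FO D (atom_norm P (H Y) u)) \<circ> f) (FO T (H Y)) (pr (H Y) \<circ> f)"
      by (rule is_product_reindex[OF pr[OF SA_obj[OF H_SA[OF F(1)[OF Y(1)]]] cH] f])
    moreover obtain k where k: "k \<in> ?K" "f k = fibre (ladder Y) (ladder Y x)"
      using phi(2)[OF Y(1) Y(1)] f unfolding bij_betw_def by (metis imageE)
    moreover have "FO (reindex ?h ?D) i = FO T (H Y)" "FO (reindex ?h ?E) i = FO D q"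
      "(?pi \<circ> ?h) i = ?pi Y"
      by (simp_all add: Y(2) h[OF Y(1)])
    ultimately show ?thesis
      using phi(3)[OF Y(1) Y(1)]
      by (intro exI[of _ ?K] exI[of _ "(\<lambda>u. FO D (atom_norm P (H Y) u)) \<circ> f"] exI[of _ "pr (H Y) \<circ> f"])
        (auto intro!: bexI[of _ k])
  qed
  have fs: "Cmp C (proj x q) ((?s \<circ> ?h) i) = Cmp C (((\<lambda>i. Ident C (FO D q)) \<circ> ?h) i) ((?pi \<circ> ?h) i)"
    if i: "i \<in> Field ?r" for i
  proof -
    obtain Y where Y: "Y \<in> Field r" "i = ?g Y" using i unfolding Fr by blast
    show ?thesis
      using fac[OF Y(1)] cmp_ident(2)[OF cats(2) phi(4)[OF Y(1) Y(1)]] by (simp add: Y(2) h[OF Y(1)])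
  qed
  have ar: "proj x q \<in> Arr C" "Dom C (proj x q) = FO T FS" "Cod C (proj x q) = FO D q"
    using proj_hom[OF n] unfolding hom_def by auto
  show ?thesis
    unfolding extended_projection_def ar(2,3)
    by (rule conjI[OF ar(1)], rule exI[of _ ?r], rule exI[of _ "reindex ?h ?D"],
        rule exI[of _ "reindex ?h ?E"], rule exI[of _ "?pi \<circ> ?h"], rule exI[of _ "?s \<circ> ?h"],
        rule exI[of _ "(\<lambda>i. Ident C (FO D q)) \<circ> ?h"], intro conjI ballI,
        rule dir', rule nt, erule ps, rule colD', rule colE', erule fs)
qed

end

section \<open>Small sets\<close>

lemma card_of_less_inj:
  assumes "Card_order mu" "|I| <o mu"
  obtains f where "inj_on f I" "f ` I \<subseteq> Field mu" "|f ` I| <o mu"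
proof -
  have "|I| \<le>o |Field mu|"
    by (rule ordLeq_ordIso_trans[OF ordLess_imp_ordLeq[OF assms(2)]
          ordIso_symmetric[OF card_of_Field_ordIso[OF assms(1)]]])
  from card_of_ordLeq[THEN iffD2, OF this] obtain f where "inj_on f I" "f ` I \<subseteq> Field mu" by blast
  moreover have "|f ` I| <o mu" using ordLeq_ordLess_trans[OF card_of_image assms(2)] .
  ultimately show ?thesis using that by blast
qed

lemma finite_small:
  assumes "Card_order mu" "infinite (Field mu)" "finite A"
  shows "|A| <o mu"
proof -
  have "Well_order mu" using assms(1) unfolding card_order_on_def by blast
  moreover have "finite (Field |A| )" using assms(3) by (simp add: Field_card_of)
  ultimately show ?thesis using finite_ordLess_infinite[OF card_of_Well_order[of A]] assms(2) by blast
qed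

text \<open>By induction there are at most \<open>|A|\<close> subsets with \<open>n\<close>
  elements, each arising from a smaller one by an insertion; then a countable union is
  taken.\<close>

lemma card_of_Fpow_leq:
  assumes "infinite A"
  shows "|Fpow A| \<le>o |A|"
proof -
  define S where "S n = {Y. Y \<subseteq> A \<and> finite Y \<and> card Y = n}" for n
  have "|S n| \<le>o |A|" for n
  proof (induction n)
    case 0
    have "S 0 \<subseteq> {{}}" unfolding S_def by auto
    then have "finite (S 0)" by (rule finite_subset) simp
    then show ?case
      by (intro ordLess_imp_ordLeq finite_small) (use assms in \<open>simp_all add: card_of_Card_order Field_card_of card_of_card_order_on\<close>)
  next
    case (Suc n)
    have "S (Suc n) \<subseteq> (\<lambda>(a, Y). insert a Y) ` (A \<times> S n)"
    proof
      fix Y assume "Y \<in> S (Suc n)"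
      then have Y: "Y \<subseteq> A" "finite Y" "card Y = Suc n" unfolding S_def by auto
      then obtain a where a: "a \<in> Y" by fastforce
      then have "Y - {a} \<in> S n" "Y = insert a (Y - {a})" "a \<in> A" using Y unfolding S_def by auto
      then show "Y \<in> (\<lambda>(a, Y). insert a Y) ` (A \<times> S n)" by (intro image_eqI[of _ _ "(a, Y - {a})"]) auto
    qed
    then have "|S (Suc n)| \<le>o |A \<times> S n|"
      using card_of_image[of "\<lambda>(a, Y). insert a Y" "A \<times> S n"] card_of_mono1 ordLeq_transitive by blast
    moreover have "|A \<times> S n| \<le>o |A|"
      using card_of_Times_mono2[OF Suc.IH, of A] card_of_Times_same_infinite[OF assms]
        ordLeq_ordIso_trans by blast
    ultimately show ?case using ordLeq_transitive by blast
  qed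
  moreover have "|UNIV :: nat set| \<le>o |A|" using assms infinite_iff_card_of_nat by blast
  ultimately have "|\<Union>n. S n| \<le>o |A|"
    by (intro card_of_UNION_ordLeq_infinite[OF assms]) auto
  moreover have "Fpow A = (\<Union>n. S n)" unfolding S_def Fpow_def by auto
  ultimately show ?thesis by simp
qed

lemma small_Fpow:
  assumes mu: "Card_order mu" "infinite (Field mu)" and A: "|A| <o mu"
  shows "|Fpow A| <o mu"
proof (cases "finite A")
  case True
  then have "finite (Fpow A)" by (simp add: Fpow_Pow_finite)
  then show ?thesis by (rule finite_small[OF mu])
next
  case False
  then show ?thesis using ordLeq_ordLess_trans[OF card_of_Fpow_leq A] by blast
qed

text \<open>For infinite \<open>A\<close> the union has cardinality at most \<open>|A|\<close>, so
  singular \<open>mu\<close> is included; for finite \<open>A\<close> it is finite, which covers the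
  countable case.\<close>

lemma small_UN_Fpow:
  assumes mu: "Card_order mu" "infinite (Field mu)" and A: "|A| <o mu"
    and l: "\<And>Y. Y \<in> Fpow A \<Longrightarrow> finite (l Y)"
  shows "|\<Union>Y\<in>Fpow A. l Y| <o mu"
proof (cases "finite A")
  case True
  then have "finite (Fpow A)" by (simp add: Fpow_Pow_finite)
  then have "finite (\<Union>Y\<in>Fpow A. l Y)" using l by blast
  then show ?thesis by (rule finite_small[OF mu])
next
  case False
  have "|l Y| \<le>o |A|" if "Y \<in> Fpow A" for Y
    by (intro ordLess_imp_ordLeq finite_small)
      (use l[OF that] False in \<open>simp_all add: card_of_Card_order Field_card_of card_of_card_order_on\<close>)
  then have "|\<Union>Y\<in>Fpow A. l Y| \<le>o |A|"
    using card_of_Fpow_leq[OF False] by (intro card_of_UNION_ordLeq_infinite[OF False]) auto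
  then show ?thesis using A ordLeq_ordLess_trans by blast
qed

section \<open>Buttresses\<close>

lemma full_subcategory_hom:
  assumes "full_subcategory C' C" "x \<in> Obj C'" "y \<in> Obj C'"
  shows "hom C' x y = hom C x y"
  using assms unfolding full_subcategory_def by blast

text \<open>The colimits granted by a strong larder are those of diagrams in \<open>Bdag L\<close>,
  whereas diagrams of monic objects are first constructed in the ambient category.\<close>

lemma full_subcategory_functor:
  assumes sub: "full_subcategory C' C" and r: "Partial_order r"
    and M: "is_functor (poset_cat r) C M" and obj: "\<And>i. i \<in> Field r \<Longrightarrow> FO M i \<in> Obj C'"
  shows "is_functor (poset_cat r) C' M"
proof -
  have s: "subcategory C' C" using sub unfolding full_subcategory_def by blast
  then have cat: "category C'" unfolding subcategory_def by blast
  have id: "Ident C' x = Ident C x" if "x \<in> Obj C'" for x using s that unfolding subcategory_def by blast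
  have cmp: "Cmp C' g f = Cmp C g f" if "f \<in> hom C' x y" "g \<in> hom C' y z" for f g x y z
    using s that unfolding subcategory_def hom_def by auto
  note m = M[unfolded is_functor_poset[OF r]]
  have h: "FA M (i, j) \<in> hom C' (FO M i) (FO M j)" if "(i, j) \<in> r" for i j
    using m full_subcategory_hom[OF sub obj obj] FieldI1[OF that] FieldI2[OF that] that by blast
  show ?thesis
    unfolding is_functor_poset[OF r]
  proof (intro conjI ballI allI impI)
    show "FO M x \<in> Obj C'" "FA M (x, x) = Ident C' (FO M x)" if "x \<in> Field r" for x
      using obj[OF that] id m that by auto
    show "FA M (x, z) = Cmp C' (FA M (y, z)) (FA M (x, y))" if "(x, y) \<in> r" "(y, z) \<in> r" for x y z
      using cmp[OF h[OF that(1)] h[OF that(2)]] m that by auto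
  qed (use cat h in auto)
qed

lemma functor_subposet:
  assumes M: "is_functor (poset_cat r) C M" and r: "Partial_order r" and q: "Partial_order q" "q \<subseteq> r"
  shows "is_functor (poset_cat q) C M"
  using M mono_Field[OF q(2)] q(2) unfolding is_functor_poset[OF r] is_functor_poset[OF q(1)] by blast

text \<open>A diagram of monic objects over \<open>B\<close> is the same as an isotone map.\<close>

lemma monic_diagram:
  assumes cat: "category C" and r: "Partial_order r"
    and mon: "\<And>u. u \<in> Field r \<Longrightarrow> monic C (\<gamma> u) \<and> Cod C (\<gamma> u) = B"
    and fac: "\<And>u v. (u, v) \<in> r \<Longrightarrow> u \<noteq> v \<Longrightarrow> factors_through C (\<gamma> u) (\<gamma> v)"
  shows "\<exists>M. is_functor (poset_cat r) C M \<and> (\<forall>u. FO M u = Dom C (\<gamma> u)) \<and>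
    (\<forall>u v. (u, v) \<in> r \<longrightarrow> Cmp C (\<gamma> v) (FA M (u, v)) = \<gamma> u)"
proof -
  have g: "\<gamma> u \<in> hom C (Dom C (\<gamma> u)) B" if "u \<in> Field r" for u
    using mon[OF that] unfolding monic_def hom_def by auto
  have ex: "\<exists>h. h \<in> hom C (Dom C (\<gamma> u)) (Dom C (\<gamma> v)) \<and> Cmp C (\<gamma> v) h = \<gamma> u"
    if uv: "(u, v) \<in> r" for u v
  proof (cases "u = v")
    case True
    have "u \<in> Field r" using uv by (rule FieldI1)
    note gu = g[OF this]
    show ?thesis
      using ident_hom[OF cat hom_objs(1)[OF cat gu]] cmp_ident(1)[OF cat gu] True by blast
  next
    case False
    then show ?thesis using fac[OF uv] unfolding factors_through_def by metis
  qed
  define k where "k u v = (SOME h. h \<in> hom C (Dom C (\<gamma> u)) (Dom C (\<gamma> v)) \<and> Cmp C (\<gamma> v) h = \<gamma> u)" for u v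
  have k: "k u v \<in> hom C (Dom C (\<gamma> u)) (Dom C (\<gamma> v))" "Cmp C (\<gamma> v) (k u v) = \<gamma> u"
    if "(u, v) \<in> r" for u v
    using someI_ex[OF ex[OF that]] unfolding k_def by auto
  define M where "M = \<lparr>FO = \<lambda>u. Dom C (\<gamma> u), FA = \<lambda>(u, v). k u v\<rparr>"
  have "is_functor (poset_cat r) C M"
    unfolding is_functor_poset[OF r]
  proof (intro conjI ballI allI impI)
    show "category C" by fact
    fix u assume u: "u \<in> Field r"
    have uu: "(u, u) \<in> r" using partial_orderD(1)[OF r u] .
    note obj = hom_objs(1)[OF cat g[OF u]]
    show "FO M u \<in> Obj C" using obj by (simp add: M_def)
    have "k u u = Ident C (Dom C (\<gamma> u))"
      by (rule monic_cancel[of C "\<gamma> u"])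
        (use mon[OF u] g[OF u] k[OF uu] ident_hom[OF cat obj] cmp_ident(1)[OF cat g[OF u]] in auto)
    then show "FA M (u, u) = Ident C (FO M u)" by (simp add: M_def)
  next
    fix u v assume uv: "(u, v) \<in> r"
    show "FA M (u, v) \<in> hom C (FO M u) (FO M v)" using k(1)[OF uv] by (simp add: M_def)
    fix w assume vw: "(v, w) \<in> r"
    have uw: "(u, w) \<in> r" using partial_orderD(2)[OF r uv vw] .
    note w = FieldI2[OF vw]
    have "Cmp C (\<gamma> w) (Cmp C (k v w) (k u v)) = \<gamma> u"
      using cmp_assoc[OF cat k(1)[OF uv] k(1)[OF vw] g[OF w]] k(2)[OF uv] k(2)[OF vw] by simp
    then have "k u w = Cmp C (k v w) (k u v)"
      using monic_cancel[OF conjunct1[OF mon[OF w]] g[OF w] k(1)[OF uw] hom_cmp[OF cat k(1)[OF uv] k(1)[OF vw]]]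
        k(2)[OF uw] by simp
    then show "FA M (u, w) = Cmp C (FA M (v, w)) (FA M (u, v))" by (simp add: M_def)
  qed
  then show ?thesis using k(2) by (intro exI[of _ M]) (simp add: M_def)
qed

section \<open>Arrows into \<open>B\<close> chosen by the Loewenheim-Skolem property\<close>

locale larder_at =
  fixes mu :: "'m rel" and L :: "('oa, 'aa, 'ob, 'ab, 'os, 'as) larder" and B :: 'ob
  assumes mu: "Card_order mu" "infinite (Field mu)"
    and catB: "category (catB L)" and catS: "category (catS L)"
    and Psi: "is_functor (catB L) (catS L) (Psi L)"
    and Bdag: "full_subcategory (Bdag L) (catB L)" and Sdbl: "subcategory (Sdbl L) (catS L)"
    and LS: "LS mu L B"
begin

definition double_onto_dagger :: "'as \<Rightarrow> bool" where
  "double_onto_dagger \<psi> \<longleftrightarrow> (\<exists>A\<in>Obj (Adag L). double_arrow L \<psi> (FO (Psi L) B) (FO (Phi L) A))"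

lemma double_onto_daggerD:
  assumes "double_onto_dagger \<psi>"
  obtains x where "\<psi> \<in> hom (catS L) (FO (Psi L) B) x"
  using assms unfolding double_onto_dagger_def double_arrow_def by blast

text \<open>\<open>LS\<close> is stated for families indexed by subsets of the type of
  \<open>mu\<close>. A \<open>mu\<close>-small index set embeds into \<open>Field mu\<close>, and
  the family is carried along this injection.\<close>

lemma LS_any:
  assumes \<psi>: "double_onto_dagger \<psi>" and I: "|I| <o mu" "\<And>i. i \<in> I \<Longrightarrow> monic_dagger_object L B (\<gamma> i)"
  obtains \<delta> where "monic_dagger_object L B \<delta>" "\<And>i. i \<in> I \<Longrightarrow> factors_through (catB L) (\<gamma> i) \<delta>"
    "Cmp (catS L) \<psi> (FA (Psi L) \<delta>) \<in> Arr (Sdbl L)"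
proof -
  obtain f where f: "inj_on f I" "f ` I \<subseteq> Field mu" "|f ` I| <o mu"
    by (rule card_of_less_inj[OF mu(1) I(1)])
  define \<gamma>' where "\<gamma>' = \<gamma> \<circ> inv_into I f"
  have \<gamma>': "\<gamma>' (f i) = \<gamma> i" if "i \<in> I" for i using f(1) that by (simp add: \<gamma>'_def)
  obtain A where A: "A \<in> Obj (Adag L)" "double_arrow L \<psi> (FO (Psi L) B) (FO (Phi L) A)"
    using \<psi> unfolding double_onto_dagger_def by blast
  have "|f ` I| <o mu \<and> (\<forall>i\<in>f ` I. monic_dagger_object L B (\<gamma>' i))" using f(3) I(2) \<gamma>' by simp
  from LS[unfolded LS_def, THEN bspec, OF A(1), THEN spec, THEN mp, OF A(2), THEN spec, THEN spec,
      THEN mp, OF this]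
  obtain \<delta> where \<delta>: "monic_dagger_object L B \<delta>" "\<forall>i\<in>f ` I. factors_through (catB L) (\<gamma>' i) \<delta>"
    "Cmp (catS L) \<psi> (FA (Psi L) \<delta>) \<in> Arr (Sdbl L)"
    by blast
  then show ?thesis using that[OF \<delta>(1) _ \<delta>(3)] \<gamma>' by simp
qed

text \<open>A diagram in \<open>Bdag L\<close> with a cocone to \<open>B\<close> whose images under
  \<open>Psi L\<close> compose with \<open>\<phi>\<close> to double arrows. The cocone is not asked
  to be monic: in the strong case its components come from colimits.\<close>

definition buttress where
  "buttress r \<phi> M \<gamma> \<longleftrightarrow> is_functor (poset_cat r) (catB L) M \<and>
     (\<forall>u\<in>Field r. FO M u \<in> Obj (Bdag L) \<and> \<gamma> u \<in> hom (catB L) (FO M u) B \<and>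
        Cmp (catS L) (\<phi> u) (FA (Psi L) (\<gamma> u)) \<in> Arr (Sdbl L)) \<and>
     (\<forall>u v. (u, v) \<in> r \<longrightarrow> Cmp (catB L) (\<gamma> v) (FA M (u, v)) = \<gamma> u)"

lemma monic_dagger_objectD:
  assumes "monic_dagger_object L B \<gamma>"
  shows "monic (catB L) \<gamma>" "Cod (catB L) \<gamma> = B" "Dom (catB L) \<gamma> \<in> Obj (Bdag L)"
    "\<gamma> \<in> hom (catB L) (Dom (catB L) \<gamma>) B"
  using assms unfolding monic_dagger_object_def hom_def by auto

text \<open>Well-founded recursion: at \<open>u\<close>, the Loewenheim-Skolem property is applied
  to the monic objects already chosen at the strict predecessors of \<open>u\<close>, of which there
  are fewer than \<open>mu\<close>.\<close>

lemma monic_choice: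
  assumes wf: "wf {(v, u). (v, u) \<in> r \<and> v \<noteq> u}" and small: "\<And>u. u \<in> Field r \<Longrightarrow> |{v. (v, u) \<in> r \<and> v \<noteq> u}| <o mu"
    and \<phi>: "\<And>u. u \<in> Field r \<Longrightarrow> double_onto_dagger (\<phi> u)"
  shows "\<exists>\<gamma>. (\<forall>u\<in>Field r. monic_dagger_object L B (\<gamma> u) \<and>
      Cmp (catS L) (\<phi> u) (FA (Psi L) (\<gamma> u)) \<in> Arr (Sdbl L)) \<and>
    (\<forall>u v. (u, v) \<in> r \<longrightarrow> u \<noteq> v \<longrightarrow> factors_through (catB L) (\<gamma> u) (\<gamma> v))"
proof -
  define Q where "Q g u \<delta> \<longleftrightarrow> (u \<in> Field r \<longrightarrow> monic_dagger_object L B \<delta> \<and>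
     (\<forall>v. (v, u) \<in> r \<and> v \<noteq> u \<longrightarrow> factors_through (catB L) (g v) \<delta>) \<and>
     Cmp (catS L) (\<phi> u) (FA (Psi L) \<delta>) \<in> Arr (Sdbl L))" for g u \<delta>
  have "\<exists>\<gamma>. \<forall>u. Q \<gamma> u (\<gamma> u)"
  proof (rule dependent_wf_choice[OF wf])
    fix f g :: "'a \<Rightarrow> 'ab" and u \<delta>
    assume "\<And>v. (v, u) \<in> {(v, u). (v, u) \<in> r \<and> v \<noteq> u} \<Longrightarrow> f v = g v"
    then have "(\<forall>v. (v, u) \<in> r \<and> v \<noteq> u \<longrightarrow> factors_through (catB L) (f v) \<delta>) \<longleftrightarrow>
        (\<forall>v. (v, u) \<in> r \<and> v \<noteq> u \<longrightarrow> factors_through (catB L) (g v) \<delta>)" by auto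
    then show "Q f u \<delta> = Q g u \<delta>" unfolding Q_def by (rule arg_cong)
  next
    fix u and f :: "'a \<Rightarrow> 'ab"
    assume IH: "\<And>v. (v, u) \<in> {(v, u). (v, u) \<in> r \<and> v \<noteq> u} \<Longrightarrow> Q f v (f v)"
    show "\<exists>\<delta>. Q f u \<delta>"
    proof (cases "u \<in> Field r")
      case True
      have mon: "monic_dagger_object L B (f v)" if "v \<in> {v. (v, u) \<in> r \<and> v \<noteq> u}" for v
        using IH[of v] that FieldI1[of v u r] unfolding Q_def by auto
      show ?thesis
      proof (rule LS_any[OF \<phi>[OF True] small[OF True] mon])
        fix \<delta> assume "monic_dagger_object L B \<delta>"
          "\<And>v. v \<in> {v. (v, u) \<in> r \<and> v \<noteq> u} \<Longrightarrow> factors_through (catB L) (f v) \<delta>"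
          "Cmp (catS L) (\<phi> u) (FA (Psi L) \<delta>) \<in> Arr (Sdbl L)"
        then have "Q f u \<delta>" unfolding Q_def by simp
        then show ?thesis by (rule exI[of _ \<delta>])
      qed
    next
      case False
      then show ?thesis unfolding Q_def by simp
    qed
  qed
  then obtain \<gamma> where Q: "\<And>u. Q \<gamma> u (\<gamma> u)" by blast
  have "monic_dagger_object L B (\<gamma> u)" "Cmp (catS L) (\<phi> u) (FA (Psi L) (\<gamma> u)) \<in> Arr (Sdbl L)"
    if "u \<in> Field r" for u using Q[of u] that unfolding Q_def by auto
  moreover have "factors_through (catB L) (\<gamma> u) (\<gamma> v)" if "(u, v) \<in> r" "u \<noteq> v" for u v
    using Q[of v] that FieldI2[OF that(1)] unfolding Q_def by auto
  ultimately show ?thesis by blast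
qed

lemma buttress_well_founded:
  assumes r: "Partial_order r" and wf: "wf {(v, u). (v, u) \<in> r \<and> v \<noteq> u}"
    and small: "\<And>u. u \<in> Field r \<Longrightarrow> |{v. (v, u) \<in> r}| <o mu"
    and \<phi>: "\<And>u. u \<in> Field r \<Longrightarrow> double_onto_dagger (\<phi> u)"
  shows "\<exists>M \<gamma>. buttress r \<phi> M \<gamma>"
proof -
  have "|{v. (v, u) \<in> r \<and> v \<noteq> u}| <o mu" if "u \<in> Field r" for u
    using small[OF that] card_of_mono1[of "{v. (v, u) \<in> r \<and> v \<noteq> u}" "{v. (v, u) \<in> r}"]
      ordLeq_ordLess_trans by blast
  from monic_choice[of r \<phi>, OF wf this \<phi>]
  obtain \<gamma> where "\<forall>u\<in>Field r. monic_dagger_object L B (\<gamma> u) \<and>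
      Cmp (catS L) (\<phi> u) (FA (Psi L) (\<gamma> u)) \<in> Arr (Sdbl L)"
    "\<forall>u v. (u, v) \<in> r \<longrightarrow> u \<noteq> v \<longrightarrow> factors_through (catB L) (\<gamma> u) (\<gamma> v)" by blast
  then have \<gamma>: "\<And>u. u \<in> Field r \<Longrightarrow> monic_dagger_object L B (\<gamma> u)"
    "\<And>u v. (u, v) \<in> r \<Longrightarrow> u \<noteq> v \<Longrightarrow> factors_through (catB L) (\<gamma> u) (\<gamma> v)"
    "\<And>u. u \<in> Field r \<Longrightarrow> Cmp (catS L) (\<phi> u) (FA (Psi L) (\<gamma> u)) \<in> Arr (Sdbl L)" by blast+
  have mon: "monic (catB L) (\<gamma> u) \<and> Cod (catB L) (\<gamma> u) = B" if "u \<in> Field r" for u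
    using monic_dagger_objectD[OF \<gamma>(1)[OF that]] by blast
  from monic_diagram[of "catB L" r \<gamma> B, OF catB r mon \<gamma>(2)]
  obtain M where M: "is_functor (poset_cat r) (catB L) M"
    "\<forall>u v. (u, v) \<in> r \<longrightarrow> Cmp (catB L) (\<gamma> v) (FA M (u, v)) = \<gamma> u"
    "\<forall>u. FO M u = Dom (catB L) (\<gamma> u)" by blast
  have M': "FO M u = Dom (catB L) (\<gamma> u)" for u using M(3) by blast
  have "buttress r \<phi> M \<gamma>"
    unfolding buttress_def M' using M(1,2) \<gamma>(3) monic_dagger_objectD(3,4)[OF \<gamma>(1)] by blast
  then show ?thesis by blast
qed

text \<open>In the strong case, monic objects are chosen along the finite nonempty subsets of the poset,
  and the object at \<open>u\<close> is the colimit over those finite sets which have largest element \<open>u\<close>.\<close>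

lemma buttress_strong:
  assumes r: "Partial_order r" and strong: "strong_larder mu L"
    and small: "\<And>u. u \<in> Field r \<Longrightarrow> |{v. (v, u) \<in> r}| <o mu"
    and \<phi>: "\<And>u. u \<in> Field r \<Longrightarrow> double_onto_dagger (\<phi> u)"
  shows "\<exists>M \<gamma>. buttress r \<phi> M \<gamma>"
proof -
  let ?B = "catB L" and ?S = "catS L"
  define Q where "Q = {Z \<in> Fpow (Field r). Z \<noteq> {}}"
  \<comment> \<open>Sets without a largest element occur in \<open>Q\<close>; for them an arbitrary
    member serves as \<open>top Z\<close>, so that the choice of monic objects can be made along all
    of \<open>Q\<close>.\<close>
  define top where "top Z = (SOME u. u \<in> Z \<and> ((\<exists>w\<in>Z. \<forall>v\<in>Z. (v, w) \<in> r) \<longrightarrow> (\<forall>v\<in>Z. (v, u) \<in> r)))" for Z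
  have top: "top Z \<in> Z" "\<And>w. w \<in> Z \<Longrightarrow> \<forall>v\<in>Z. (v, w) \<in> r \<Longrightarrow> top Z = w" if "Z \<noteq> {}" for Z
  proof -
    have "\<exists>u. u \<in> Z \<and> ((\<exists>w\<in>Z. \<forall>v\<in>Z. (v, w) \<in> r) \<longrightarrow> (\<forall>v\<in>Z. (v, u) \<in> r))" using that by blast
    from someI_ex[OF this] have *: "top Z \<in> Z" "(\<exists>w\<in>Z. \<forall>v\<in>Z. (v, w) \<in> r) \<Longrightarrow> \<forall>v\<in>Z. (v, top Z) \<in> r"
      unfolding top_def by auto
    show "top Z \<in> Z" by (rule *)
    show "top Z = w" if "w \<in> Z" "\<forall>v\<in>Z. (v, w) \<in> r" for w
      using partial_orderD(3)[OF r] * that by blast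
  qed
  let ?q = "incl_rel Q"
  have q: "Partial_order ?q" "Field ?q = Q" by (rule Partial_order_incl_rel) simp
  have fin: "finite Z" "Z \<subseteq> Field r" "Z \<noteq> {}" if "Z \<in> Q" for Z using that unfolding Q_def Fpow_def by auto
  have wf: "wf {(Y, Z). (Y, Z) \<in> ?q \<and> Y \<noteq> Z}"
    by (rule wf_subset[OF wf_finite_psubset]) (auto simp: finite_psubset_def Q_def Fpow_def)
  have sm: "|{Y. (Y, Z) \<in> ?q \<and> Y \<noteq> Z}| <o mu" if "Z \<in> Field ?q" for Z
  proof (rule finite_small[OF mu])
    have "finite (Pow Z)" using that fin(1) by simp
    then show "finite {Y. (Y, Z) \<in> ?q \<and> Y \<noteq> Z}" by (rule finite_subset[rotated]) auto
  qed
  have "double_onto_dagger (\<phi> (top Z))" if "Z \<in> Field ?q" for Z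
    using \<phi>[OF subsetD[OF fin(2) top(1)[OF fin(3)]]] that unfolding q(2) by blast
  from monic_choice[of ?q "\<lambda>Z. \<phi> (top Z)", OF wf sm this]
  obtain \<gamma> where "\<forall>Z\<in>Field ?q. monic_dagger_object L B (\<gamma> Z) \<and>
      Cmp ?S (\<phi> (top Z)) (FA (Psi L) (\<gamma> Z)) \<in> Arr (Sdbl L)"
    "\<forall>Y Z. (Y, Z) \<in> ?q \<longrightarrow> Y \<noteq> Z \<longrightarrow> factors_through ?B (\<gamma> Y) (\<gamma> Z)" by blast
  then have \<gamma>: "\<And>Z. Z \<in> Q \<Longrightarrow> monic_dagger_object L B (\<gamma> Z)"
    "\<And>Y Z. (Y, Z) \<in> ?q \<Longrightarrow> Y \<noteq> Z \<Longrightarrow> factors_through ?B (\<gamma> Y) (\<gamma> Z)"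
    "\<And>Z. Z \<in> Q \<Longrightarrow> Cmp ?S (\<phi> (top Z)) (FA (Psi L) (\<gamma> Z)) \<in> Arr (Sdbl L)"
    unfolding q(2) by blast+
  have mon: "monic ?B (\<gamma> Z) \<and> Cod ?B (\<gamma> Z) = B" if "Z \<in> Field ?q" for Z
    using monic_dagger_objectD[OF \<gamma>(1)] that q(2) by blast
  from monic_diagram[of ?B ?q \<gamma> B, OF catB q(1) mon \<gamma>(2)]
  obtain N where "is_functor (poset_cat ?q) ?B N" "\<forall>Z. FO N Z = Dom ?B (\<gamma> Z)"
    "\<forall>Y Z. (Y, Z) \<in> ?q \<longrightarrow> Cmp ?B (\<gamma> Z) (FA N (Y, Z)) = \<gamma> Y" by blast
  then have N: "is_functor (poset_cat ?q) ?B N" "\<And>Z. FO N Z = Dom ?B (\<gamma> Z)"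
    "\<And>Y Z. (Y, Z) \<in> ?q \<Longrightarrow> Cmp ?B (\<gamma> Z) (FA N (Y, Z)) = \<gamma> Y" by blast+
  note Nf = N(1)[unfolded is_functor_poset[OF q(1)] q(2)]
  have \<gamma>h: "\<gamma> Z \<in> hom ?B (FO N Z) B" "FO N Z \<in> Obj (Bdag L)" if "Z \<in> Q" for Z
    using monic_dagger_objectD[OF \<gamma>(1)[OF that]] N(2) by auto
  have Nh: "FA N (Y, Z) \<in> hom ?B (FO N Y) (FO N Z)" if "(Y, Z) \<in> ?q" for Y Z using Nf that by blast
  have Nc: "FA N (Y, W) = Cmp ?B (FA N (Z, W)) (FA N (Y, Z))" if "(Y, Z) \<in> ?q" "(Z, W) \<in> ?q" for Y Z W
    using Nf that by blast
  define down where "down u = {v. (v, u) \<in> r}" for u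
  \<comment> \<open>All members of \<open>R u\<close> have largest element \<open>u\<close>, so
    their monic objects are adapted to the same arrow \<open>\<phi> u\<close>. Adding
    \<open>u\<close> moves any finite nonempty subset of \<open>down u\<close> into
    \<open>R u\<close>, which is the source of the transition arrows.\<close>
  define R where "R u = {Z \<in> Fpow (down u). {u} \<subseteq> Z}" for u
  have down_mono: "down u \<subseteq> down v" if "(u, v) \<in> r" for u v
    using partial_orderD(2)[OF r _ that] unfolding down_def by (intro subsetI) simp
  have self: "u \<in> down u" if "u \<in> Field r" for u using partial_orderD(1)[OF r that] unfolding down_def by blast
  have down_F: "down u \<subseteq> Field r" for u unfolding down_def by (auto simp: FieldI1)
  have RQ: "R u \<subseteq> Q" for u using Fpow_mono[OF down_F[of u]] unfolding R_def Q_def by auto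
  have Rdir: "directed (incl_rel (R u))" if "u \<in> Field r" for u
  proof (rule directed_incl_relI)
    have "{u} \<in> R u" using self[OF that] unfolding R_def Fpow_def by simp
    then show "R u \<noteq> {}" by blast
    show "\<exists>W\<in>R u. Y \<subseteq> W \<and> Z \<subseteq> W" if "Y \<in> R u" "Z \<in> R u" for Y Z
      using that unfolding R_def Fpow_def by (intro bexI[of _ "Y \<union> Z"]) auto
  qed
  have fun_R: "is_functor (poset_cat (incl_rel (R u))) ?B N" for u
    by (rule functor_subposet[OF N(1) q(1) Partial_order_incl_rel])
      (use RQ[of u] in \<open>auto simp: incl_rel_def\<close>)
  have fun_Rd: "is_functor (poset_cat (incl_rel (R u))) (Bdag L) N" for u
    by (rule full_subcategory_functor[OF Bdag Partial_order_incl_rel fun_R])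
      (use \<gamma>h(2) RQ[of u] in auto)
  \<comment> \<open>The last clause is stated for every suitable \<open>f\<close>, as the arrow from
    \<open>c\<close> to \<open>B\<close> is only obtained afterwards from the universal property. It
    follows from right closure: composing with the legs gives the double arrows chosen at the sets
    \<open>Z\<close> with \<open>top Z = u\<close>.\<close>
  have "\<exists>c s. is_colimit (poset_cat (incl_rel (R u))) ?B N c s \<and> c \<in> Obj (Bdag L) \<and>
      (\<forall>f\<in>Arr ?B. Dom ?B f = c \<and> Cod ?B f = B \<and> (\<forall>Z\<in>R u. Cmp ?B f (s Z) = \<gamma> Z) \<longrightarrow>
        Cmp ?S (\<phi> u) (FA (Psi L) f) \<in> Arr (Sdbl L))"
    if u: "u \<in> Field r" for u
  proof -
    let ?R = "incl_rel (R u)"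
    have po: "Partial_order ?R" by (rule Partial_order_incl_rel)
    have "|R u| <o mu"
    proof -
      have "|R u| \<le>o |Fpow (down u)|" by (rule card_of_mono1) (auto simp: R_def)
      then show ?thesis using small_Fpow[OF mu small[OF u]] ordLeq_ordLess_trans unfolding down_def by blast
    qed
    then obtain g where g: "inj_on g (R u)" "g ` R u \<subseteq> Field mu" "|g ` R u| <o mu"
      by (rule card_of_less_inj[OF mu(1)])
    let ?R' = "map_prod g g ` ?R" and ?h = "inv_into (Field ?R) g"
    have g': "inj_on g (Field ?R)" using g(1) by simp
    have sd: "?R' \<in> small_directed_posets mu"
      unfolding small_directed_posets_def using directed_image_rel[OF Rdir[OF u] g'] g(3)
      by (simp add: Field_image_rel)
    have h: "inv_into (R u) g (g Z) = Z" if "Z \<in> R u" for Z using g(1) that by (rule inv_into_f_f)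
    have "is_functor (poset_cat ?R') (Bdag L) (reindex ?h N)"
      by (rule is_colimit_reindex'(2)[OF po g', THEN iffD2, OF fun_Rd])
    then obtain c s' where c: "is_colimit (poset_cat ?R') ?B (reindex ?h N) c s'" "c \<in> Obj (Bdag L)"
      using strong sd unfolding strong_larder_def by blast
    have "is_colimit (poset_cat ?R) ?B (reindex g (reindex ?h N)) c (s' \<circ> g)"
      by (rule is_colimit_reindex[OF po g', THEN iffD1, OF c(1)])
    then have col: "is_colimit (poset_cat ?R) ?B N c (s' \<circ> g)"
      by (rule is_colimit_cong[OF po, THEN iffD1, rotated 3]) (simp_all add: h)
    moreover have "Cmp ?S (\<phi> u) (FA (Psi L) f) \<in> Arr (Sdbl L)"
      if f: "f \<in> Arr ?B" "Dom ?B f = c" "Cod ?B f = B" "\<forall>Z\<in>R u. Cmp ?B f ((s' \<circ> g) Z) = \<gamma> Z" for f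
    proof -
      have fh: "f \<in> hom ?B c B" using f unfolding hom_def by simp
      obtain x where x: "\<phi> u \<in> hom ?S (FO (Psi L) B) x" by (rule double_onto_daggerD[OF \<phi>[OF u]])
      have Pc: "is_colimit (poset_cat ?R') ?S (functor_comp (Psi L) (reindex ?h N)) (FO (Psi L) c) (FA (Psi L) \<circ> s')"
        using strong sd c(1) unfolding strong_larder_def preserves_colimits_over_def by blast
      let ?k = "Cmp ?S (\<phi> u) (FA (Psi L) f)"
      have kh: "?k \<in> hom ?S (FO (Psi L) c) x" by (rule hom_cmp[OF catS functor_hom[OF Psi fh] x])
      have "Cmp ?S ?k ((FA (Psi L) \<circ> s') i) \<in> Arr (Sdbl L)" if i: "i \<in> Field ?R'" for i
      proof -
        obtain Z where Z: "Z \<in> R u" "i = g Z" using i unfolding Field_image_rel by auto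
        have ZQ: "Z \<in> Q" using RQ Z(1) by blast
        have s: "s' (g Z) \<in> hom ?B (FO N Z) c"
          using col Z(1) unfolding is_colimit_def is_cocone_poset by simp
        have "Cmp ?S ?k (FA (Psi L) (s' (g Z))) = Cmp ?S (\<phi> u) (Cmp ?S (FA (Psi L) f) (FA (Psi L) (s' (g Z))))"
          using cmp_assoc[OF catS functor_hom[OF Psi s] functor_hom[OF Psi fh] x] by simp
        also have "\<dots> = Cmp ?S (\<phi> u) (FA (Psi L) (\<gamma> Z))"
          using functor_cmp[OF Psi s fh] f(4) Z(1) by simp
        finally have "Cmp ?S ?k (FA (Psi L) (s' (g Z))) = Cmp ?S (\<phi> u) (FA (Psi L) (\<gamma> Z))" .
        moreover have "top Z = u" using top(2)[OF fin(3)[OF ZQ]] Z(1) unfolding R_def Fpow_def down_def by auto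
        ultimately show ?thesis using \<gamma>(3)[OF ZQ] Z(2) by simp
      qed
      then show ?thesis
        using strong[unfolded strong_larder_def, THEN conjunct2, THEN conjunct1, THEN bspec, OF sd,
            THEN spec, THEN spec, THEN spec, THEN mp, OF Pc, THEN bspec, of ?k] kh
        unfolding hom_def by blast
    qed
    ultimately show ?thesis using c(2) by blast
  qed
  then have "\<forall>u\<in>Field r. \<exists>c s. is_colimit (poset_cat (incl_rel (R u))) ?B N c s \<and> c \<in> Obj (Bdag L) \<and>
      (\<forall>f\<in>Arr ?B. Dom ?B f = c \<and> Cod ?B f = B \<and> (\<forall>Z\<in>R u. Cmp ?B f (s Z) = \<gamma> Z) \<longrightarrow>
        Cmp ?S (\<phi> u) (FA (Psi L) f) \<in> Arr (Sdbl L))" by blast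
  then obtain c where "\<forall>u\<in>Field r. \<exists>s. is_colimit (poset_cat (incl_rel (R u))) ?B N (c u) s \<and> c u \<in> Obj (Bdag L) \<and>
      (\<forall>f\<in>Arr ?B. Dom ?B f = c u \<and> Cod ?B f = B \<and> (\<forall>Z\<in>R u. Cmp ?B f (s Z) = \<gamma> Z) \<longrightarrow>
        Cmp ?S (\<phi> u) (FA (Psi L) f) \<in> Arr (Sdbl L))" by (rule bchoice[THEN exE])
  then obtain s where "\<forall>u\<in>Field r. is_colimit (poset_cat (incl_rel (R u))) ?B N (c u) (s u) \<and> c u \<in> Obj (Bdag L) \<and>
      (\<forall>f\<in>Arr ?B. Dom ?B f = c u \<and> Cod ?B f = B \<and> (\<forall>Z\<in>R u. Cmp ?B f (s u Z) = \<gamma> Z) \<longrightarrow>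
        Cmp ?S (\<phi> u) (FA (Psi L) f) \<in> Arr (Sdbl L))" by (rule bchoice[THEN exE])
  then have col: "\<And>u. u \<in> Field r \<Longrightarrow> is_colimit (poset_cat (incl_rel (R u))) ?B N (c u) (s u)"
    and cd: "\<And>u. u \<in> Field r \<Longrightarrow> c u \<in> Obj (Bdag L)"
    and dbl: "\<And>u f. u \<in> Field r \<Longrightarrow> f \<in> hom ?B (c u) B \<Longrightarrow> (\<And>Z. Z \<in> R u \<Longrightarrow> Cmp ?B f (s u Z) = \<gamma> Z) \<Longrightarrow>
        Cmp ?S (\<phi> u) (FA (Psi L) f) \<in> Arr (Sdbl L)"
    unfolding hom_def by blast+
  have co: "is_cocone (poset_cat (incl_rel (R u))) ?B N (c u) (s u)" if "u \<in> Field r" for u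
    using col[OF that] unfolding is_colimit_def by blast
  have sh: "s u Z \<in> hom ?B (FO N Z) (c u)" if "u \<in> Field r" "Z \<in> R u" for u Z
    using co[OF that(1)] that(2) unfolding is_cocone_poset by simp
  have sc: "Cmp ?B (s u Z) (FA N (Y, Z)) = s u Y" if "u \<in> Field r" "Y \<in> R u" "Z \<in> R u" "Y \<subseteq> Z" for u Y Z
    using co[OF that(1)] that(2-4) unfolding is_cocone_poset by simp
  \<comment> \<open>For \<open>u\<close> below \<open>v\<close>, a member of \<open>R u\<close> lies
    in \<open>down v\<close> but need not contain \<open>v\<close>. The legs of the colimit at
    \<open>v\<close> are therefore extended to all members of \<open>Q\<close> inside
    \<open>down v\<close> by adding \<open>v\<close>.\<close>
  define t where "t u Z = Cmp ?B (s u (insert u Z)) (FA N (Z, insert u Z))" for u Z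
  have ins: "insert u Z \<in> R u" "(Z, insert u Z) \<in> ?q" if "u \<in> Field r" "Z \<in> Q" "Z \<subseteq> down u" for u Z
  proof -
    show "insert u Z \<in> R u" using self that(1,3) fin(1)[OF that(2)] unfolding R_def Fpow_def by auto
    then show "(Z, insert u Z) \<in> ?q" using RQ[of u] that(2) by auto
  qed
  have th: "t u Z \<in> hom ?B (FO N Z) (c u)" if "u \<in> Field r" "Z \<in> Q" "Z \<subseteq> down u" for u Z
    unfolding t_def using hom_cmp[OF catB Nh[OF ins(2)] sh[OF _ ins(1)]] that by blast
  have tc: "Cmp ?B (t u Z) (FA N (Y, Z)) = t u Y"
    if "u \<in> Field r" "Y \<in> Q" "Z \<in> Q" "Y \<subseteq> Z" "Z \<subseteq> down u" for u Y Z
  proof -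
    have Yd: "Y \<subseteq> down u" using that by blast
    note iY = ins[OF that(1,2) Yd] and iZ = ins[OF that(1,3,5)]
    have YZ: "(Y, Z) \<in> ?q" using that by simp
    have YZ': "(insert u Y, insert u Z) \<in> ?q" using that iY iZ by auto
    have "Cmp ?B (t u Z) (FA N (Y, Z)) = Cmp ?B (s u (insert u Z)) (Cmp ?B (FA N (Z, insert u Z)) (FA N (Y, Z)))"
      unfolding t_def by (rule cmp_assoc[OF catB Nh[OF YZ] Nh[OF iZ(2)] sh[OF that(1) iZ(1)], symmetric])
    also have "\<dots> = Cmp ?B (s u (insert u Z)) (Cmp ?B (FA N (insert u Y, insert u Z)) (FA N (Y, insert u Y)))"
      unfolding Nc[OF YZ iZ(2), symmetric] Nc[OF iY(2) YZ', symmetric] ..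
    also have "\<dots> = Cmp ?B (Cmp ?B (s u (insert u Z)) (FA N (insert u Y, insert u Z))) (FA N (Y, insert u Y))"
      by (rule cmp_assoc[OF catB Nh[OF iY(2)] Nh[OF YZ'] sh[OF that(1) iZ(1)]])
    also have "\<dots> = t u Y"
      unfolding t_def sc[OF that(1) iY(1) iZ(1) insert_mono[OF that(4)]] ..
    finally show ?thesis .
  qed
  have ts: "t u Z = s u Z" if "u \<in> Field r" "Z \<in> R u" for u Z
  proof -
    have "insert u Z = Z" using that(2) unfolding R_def by auto
    then show ?thesis unfolding t_def using sc[OF that that(2)] by simp
  qed
  have "\<exists>h. h \<in> hom ?B (c u) (c v) \<and> (\<forall>Z\<in>R u. Cmp ?B h (s u Z) = t v Z)" if uv: "(u, v) \<in> r" for u v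
  proof -
    note F = FieldI1[OF uv] FieldI2[OF uv]
    have d: "Z \<subseteq> down v" "Z \<in> Q" if "Z \<in> R u" for Z
      using that down_mono[OF uv] RQ[of u] unfolding R_def Fpow_def by auto
    have "is_cocone (poset_cat (incl_rel (R u))) ?B N (c v) (t v)"
      unfolding is_cocone_poset
    proof (intro conjI ballI allI impI)
      show "c v \<in> Obj ?B" using co[OF F(2)] unfolding is_cocone_poset by blast
      show "t v Z \<in> hom ?B (FO N Z) (c v)" if "Z \<in> Field (incl_rel (R u))" for Z
        using th[OF F(2)] d that by simp
      show "Cmp ?B (t v Z) (FA N (Y, Z)) = t v Y" if "(Y, Z) \<in> incl_rel (R u)" for Y Z
        using tc[OF F(2)] d that by simp
    qed
    then obtain h where "h \<in> hom ?B (c u) (c v)"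
      "\<And>Z. Z \<in> Field (incl_rel (R u)) \<Longrightarrow> Cmp ?B h (s u Z) = t v Z"
      by (rule is_colimit_mediating[OF col[OF F(1)]]) blast
    then show ?thesis by auto
  qed
  then have "\<exists>h. \<forall>u v. (u, v) \<in> r \<longrightarrow> h u v \<in> hom ?B (c u) (c v) \<and> (\<forall>Z\<in>R u. Cmp ?B (h u v) (s u Z) = t v Z)"
    by metis
  then obtain h where "\<forall>u v. (u, v) \<in> r \<longrightarrow> h u v \<in> hom ?B (c u) (c v) \<and> (\<forall>Z\<in>R u. Cmp ?B (h u v) (s u Z) = t v Z)"
    by blast
  then have h: "\<And>u v. (u, v) \<in> r \<Longrightarrow> h u v \<in> hom ?B (c u) (c v)"
    "\<And>u v Z. (u, v) \<in> r \<Longrightarrow> Z \<in> R u \<Longrightarrow> Cmp ?B (h u v) (s u Z) = t v Z" by blast+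
  have ht: "Cmp ?B (h u v) (t u Z) = t v Z" if uv: "(u, v) \<in> r" and Z: "Z \<in> Q" "Z \<subseteq> down u" for u v Z
  proof -
    note F = FieldI1[OF uv] FieldI2[OF uv]
    note i = ins[OF F(1) Z]
    have "Cmp ?B (h u v) (t u Z) = Cmp ?B (Cmp ?B (h u v) (s u (insert u Z))) (FA N (Z, insert u Z))"
      unfolding t_def by (rule cmp_assoc[OF catB Nh[OF i(2)] sh[OF F(1) i(1)] h(1)[OF uv]])
    also have "\<dots> = Cmp ?B (t v (insert u Z)) (FA N (Z, insert u Z))" unfolding h(2)[OF uv i(1)] ..
    also have "\<dots> = t v Z"
      using tc[OF F(2) Z(1)] i down_mono[OF uv] unfolding R_def Fpow_def by auto
    finally show ?thesis .
  qed
  have "\<exists>f. f \<in> hom ?B (c u) B \<and> (\<forall>Z\<in>R u. Cmp ?B f (s u Z) = \<gamma> Z)" if u: "u \<in> Field r" for u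
  proof -
    obtain Z where Z: "Z \<in> R u" using Rdir[OF u] unfolding directed_def poset_def by auto
    have "is_cocone (poset_cat (incl_rel (R u))) ?B N B \<gamma>"
      unfolding is_cocone_poset using \<gamma>h(1) N(3) RQ[of u] hom_objs(2)[OF catB \<gamma>h(1)] Z by auto
    then obtain f where "f \<in> hom ?B (c u) B"
      "\<And>Z. Z \<in> Field (incl_rel (R u)) \<Longrightarrow> Cmp ?B f (s u Z) = \<gamma> Z"
      by (rule is_colimit_mediating[OF col[OF u]]) blast
    then show ?thesis by auto
  qed
  then have "\<exists>f. \<forall>u\<in>Field r. f u \<in> hom ?B (c u) B \<and> (\<forall>Z\<in>R u. Cmp ?B (f u) (s u Z) = \<gamma> Z)" by metis
  then obtain f where "\<forall>u\<in>Field r. f u \<in> hom ?B (c u) B \<and> (\<forall>Z\<in>R u. Cmp ?B (f u) (s u Z) = \<gamma> Z)" by blast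
  then have f: "\<And>u. u \<in> Field r \<Longrightarrow> f u \<in> hom ?B (c u) B"
    "\<And>u Z. u \<in> Field r \<Longrightarrow> Z \<in> R u \<Longrightarrow> Cmp ?B (f u) (s u Z) = \<gamma> Z" by blast+
  have R_down: "Z \<in> Q" "Z \<subseteq> down u" if "Z \<in> R u" for Z u
    using that RQ[of u] unfolding R_def Fpow_def by auto
  let ?M = "\<lparr>FO = c, FA = \<lambda>(u, v). h u v\<rparr>"
  have "buttress r \<phi> ?M f"
    unfolding buttress_def is_functor_poset[OF r]
  proof (intro conjI ballI allI impI)
    show "category ?B" by (rule catB)
    fix u assume u: "u \<in> Field r"
    have cO: "c u \<in> Obj ?B" using co[OF u] unfolding is_cocone_poset by blast
    then show "FO ?M u \<in> Obj ?B" by simp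
    have uu: "(u, u) \<in> r" using partial_orderD(1)[OF r u] .
    have "h u u = Ident ?B (c u)"
    proof (rule is_colimit_unique[OF col[OF u] h(1)[OF uu] ident_hom[OF catB cO]])
      fix Z assume "Z \<in> Field (incl_rel (R u))"
      then have Z: "Z \<in> R u" by simp
      show "Cmp ?B (h u u) (s u Z) = Cmp ?B (Ident ?B (c u)) (s u Z)"
        using h(2)[OF uu Z] ts[OF u Z] cmp_ident(2)[OF catB sh[OF u Z]] by simp
    qed
    then show "FA ?M (u, u) = Ident ?B (FO ?M u)" by simp
    show "FO ?M u \<in> Obj (Bdag L)" "f u \<in> hom ?B (FO ?M u) B" using cd[OF u] f(1)[OF u] by auto
    show "Cmp ?S (\<phi> u) (FA (Psi L) (f u)) \<in> Arr (Sdbl L)" by (rule dbl[OF u f(1)[OF u] f(2)[OF u]])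
  next
    fix u v assume uv: "(u, v) \<in> r"
    note F = FieldI1[OF uv] FieldI2[OF uv]
    show "FA ?M (u, v) \<in> hom ?B (FO ?M u) (FO ?M v)" using h(1)[OF uv] by simp
    have "Cmp ?B (f v) (h u v) = f u"
    proof (rule is_colimit_unique[OF col[OF F(1)] hom_cmp[OF catB h(1)[OF uv] f(1)[OF F(2)]] f(1)[OF F(1)]])
      fix Z assume "Z \<in> Field (incl_rel (R u))"
      then have Z: "Z \<in> R u" by simp
      have Zv: "Z \<subseteq> down v" using R_down(2)[OF Z] down_mono[OF uv] by blast
      note i = ins[OF F(2) R_down(1)[OF Z] Zv]
      have "Cmp ?B (Cmp ?B (f v) (h u v)) (s u Z) = Cmp ?B (f v) (t v Z)"
        using cmp_assoc[OF catB sh[OF F(1) Z] h(1)[OF uv] f(1)[OF F(2)]] h(2)[OF uv Z] by simp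
      also have "\<dots> = Cmp ?B (Cmp ?B (f v) (s v (insert v Z))) (FA N (Z, insert v Z))"
        unfolding t_def by (rule cmp_assoc[OF catB Nh[OF i(2)] sh[OF F(2) i(1)] f(1)[OF F(2)]])
      also have "\<dots> = \<gamma> Z" using f(2)[OF F(2) i(1)] N(3)[OF i(2)] by simp
      finally show "Cmp ?B (Cmp ?B (f v) (h u v)) (s u Z) = Cmp ?B (f u) (s u Z)"
        using f(2)[OF F(1) Z] by simp
    qed
    then show "Cmp ?B (f v) (FA ?M (u, v)) = f u" by simp
    fix w assume vw: "(v, w) \<in> r"
    have uw: "(u, w) \<in> r" using partial_orderD(2)[OF r uv vw] .
    have "h u w = Cmp ?B (h v w) (h u v)"
    proof (rule is_colimit_unique[OF col[OF F(1)] h(1)[OF uw] hom_cmp[OF catB h(1)[OF uv] h(1)[OF vw]]])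
      fix Z assume "Z \<in> Field (incl_rel (R u))"
      then have Z: "Z \<in> R u" by simp
      have Zv: "Z \<subseteq> down v" using R_down(2)[OF Z] down_mono[OF uv] by blast
      have "Cmp ?B (Cmp ?B (h v w) (h u v)) (s u Z) = Cmp ?B (h v w) (t v Z)"
        using cmp_assoc[OF catB sh[OF F(1) Z] h(1)[OF uv] h(1)[OF vw]] h(2)[OF uv Z] by simp
      also have "\<dots> = t w Z" by (rule ht[OF vw R_down(1)[OF Z] Zv])
      finally show "Cmp ?B (h u w) (s u Z) = Cmp ?B (Cmp ?B (h v w) (h u v)) (s u Z)"
        using h(2)[OF uw Z] by simp
    qed
    then show "FA ?M (u, w) = Cmp ?B (FA ?M (v, w)) (FA ?M (u, v))" by simp
  qed
  then show ?thesis by blast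
qed

end

context condensate
begin

subsection \<open>The condensate as a continuous colimit\<close>

text \<open>Small subsets of \<open>X\<close> are coded by sets of singletons of generators, so that the index posets
  live over the type which measures smallness.\<close>

definition coded_gens :: "'x bterm set set" where "coded_gens = (\<lambda>u. {Gen u}) ` Field X"

definition decode :: "'x bterm set set \<Rightarrow> 'x set" where "decode Z = {u \<in> Field X. {Gen u} \<in> Z}"

lemma decode_sub: "decode Z \<subseteq> Field X"
  unfolding decode_def by blast

lemma decode_card: "|decode Z| \<le>o |Z|"
proof -
  have "inj_on (\<lambda>u. {Gen u}) (decode Z)" by (rule inj_onI) simp
  moreover have "(\<lambda>u. {Gen u}) ` decode Z \<subseteq> Z" unfolding decode_def by blast
  ultimately show ?thesis using card_of_ordLeq[THEN iffD1] by blast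
qed

text \<open>Weak presentability uses index posets of subsets of \<open>coded_gens\<close>, which are
  one type level too high for the preservation hypotheses. Taking unions brings them down and is
  injective, because the members are singletons.\<close>

lemma inj_on_Union_coded: "inj_on Union (Pow coded_gens)"
proof (rule inj_onI)
  have *: "Z = (\<lambda>t. {t}) ` \<Union>Z" if Z: "Z \<in> Pow coded_gens" for Z :: "'x bterm set set"
  proof -
    have "\<exists>t. z = {t}" if "z \<in> Z" for z using Z that unfolding coded_gens_def by blast
    then show ?thesis by fastforce
  qed
  fix Y Z :: "'x bterm set set" assume "Y \<in> Pow coded_gens" "Z \<in> Pow coded_gens" "\<Union>Y = \<Union>Z"
  then show "Y = Z" using *[of Y] *[of Z] by simp
qed

abbreviation GD where "GD \<equiv> diag (\<lambda>Z. G (decode Z))"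

text \<open>Used with \<open>K = G (decode w)\<close> for continuity of the diagram, and with
  \<open>K = FS\<close> for its colimit.\<close>

lemma coded_colimit:
  fixes q :: "'x bterm set set rel"
  assumes Ph: "preserves_small_directed_colimits TYPE('x bterm set) C E Ph"
    and q: "directed q" "Field q \<subseteq> Pow coded_gens" "\<And>Y Z. (Y, Z) \<in> q \<Longrightarrow> Y \<subseteq> Z"
    and W: "W = \<Union>(Field q)"
    and K: "K = sub (bcarrier K) (level K)" "bcarrier K = bcarrier (G (decode W))"
      "\<And>p. p \<in> Field P \<Longrightarrow> level K p = level (G (decode W)) p"
  shows "is_colimit (poset_cat q) E (functor_comp Ph (functor_comp T GD)) (FO Ph (FO T K))
    (\<lambda>Z. FA Ph (FA T (incl (G (decode Z)) K)))"
proof -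
  have inj: "inj_on Union (Field q)" using inj_on_Union_coded q(2) inj_on_subset by blast
  have "is_colimit (poset_cat q) BC GD K (\<lambda>Z. incl (G (decode Z)) K)"
  proof (rule G_colimit(1)[of q decode "decode W", OF q(1) _ _ _ decode_sub K cats(1)])
    show "decode Y \<subseteq> decode Z" if "(Y, Z) \<in> q" for Y Z using q(3)[OF that] unfolding decode_def by blast
    show "decode Z \<subseteq> decode W" if "Z \<in> Field q" for Z using that unfolding W decode_def by blast
    show "decode W \<subseteq> (\<Union>Z\<in>Field q. decode Z)" unfolding W decode_def by blast
  qed
  from preserves_small_reindex[OF Ph q(1) inj preserves_small_reindex[OF T_pres q(1) inj this]]
  show ?thesis by (simp add: comp_def)
qed

text \<open>\<open>G\<close> commutes with directed unions, and the functors \<open>T\<close> and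
  \<open>Ph\<close> preserve the resulting colimits. Hence the condensate is presented in the shape
  required by weak presentability.\<close>

lemma small_diagram:
  fixes lam :: "'l rel"
  assumes lam: "Card_order lam" "infinite (Field lam)"
    and Ph: "is_functor C E Ph" "preserves_small_directed_colimits TYPE('x bterm set) C E Ph"
  defines "r \<equiv> incl_rel (small_subsets lam coded_gens)"
    and "DD \<equiv> functor_comp Ph (functor_comp T GD)"
  shows "continuous_diagram r E DD"
    and "is_colimit (poset_cat r) E DD (FO Ph (FO T FS)) (\<lambda>Z. FA Ph (FA T (incl (G (decode Z)) FS)))"
proof -
  let ?S = "small_subsets lam coded_gens"
  have po: "Partial_order r" unfolding r_def by (rule Partial_order_incl_rel)
  have S: "Z \<subseteq> coded_gens" "|Z| <o lam" if "Z \<in> ?S" for Z using that unfolding small_subsets_def by auto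
  have S': "Z \<in> ?S" if "Z \<subseteq> Z'" "Z' \<in> ?S" for Z Z'
    using that ordLeq_ordLess_trans[OF card_of_mono1] unfolding small_subsets_def by blast
  have fin: "Z \<in> ?S" if "finite Z" "Z \<subseteq> coded_gens" for Z
    using that finite_small[OF lam] unfolding small_subsets_def by blast
  have FSr: "Field r = ?S" unfolding r_def by simp
  have dir: "directed r" unfolding r_def
  proof (rule directed_incl_relI)
    show "?S \<noteq> {}" using fin[of "{}"] by auto
    fix Y Z assume YZ: "Y \<in> ?S" "Z \<in> ?S"
    have "|Y \<union> Z| <o lam" using card_of_Un_ordLess_infinite_Field[OF lam(2,1) S(2)[OF YZ(1)] S(2)[OF YZ(2)]] .
    then show "\<exists>W\<in>?S. Y \<subseteq> W \<and> Z \<subseteq> W" using YZ S(1) unfolding small_subsets_def by blast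
  qed
  have "is_functor (poset_cat r) BC GD"
  proof (rule diag_functor[OF po cats(1)])
    show "G (decode Z) \<in> SA" for Z by (rule G_SA[OF decode_sub])
    show "le (G (decode Y)) (G (decode Z))" if "(Y, Z) \<in> r" for Y Z
      using that unfolding r_def by (intro G_mono) (auto simp: decode_def)
  qed
  then have fDD: "is_functor (poset_cat r) E DD"
    unfolding DD_def by (intro is_functor_comp[OF is_functor_comp[OF _ T] Ph(1)])
  show "continuous_diagram r E DD"
    unfolding continuous_diagram_def
  proof (intro conjI allI impI fDD)
    fix U w assume U: "U \<subseteq> Field r \<and> directed (Restr r U) \<and> is_sup r U w"
    have FU: "Field (Restr r U) = U"
      using U partial_orderD(1)[OF po] unfolding Field_def by blast
    have w: "w \<in> ?S" "\<And>u. u \<in> U \<Longrightarrow> u \<subseteq> w"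
      using U unfolding is_sup_def upper_bounds_def FSr by (auto simp: r_def)
    \<comment> \<open>A supremum in the poset of small subsets could a priori exceed the union. Here
      the union is contained in the small set \<open>w\<close>, so it is small itself and is the
      supremum.\<close>
    have "\<Union>U \<in> ?S" by (rule S'[OF _ w(1)]) (use w(2) in blast)
    then have "\<Union>U \<in> upper_bounds r U" using U unfolding upper_bounds_def FSr by (auto simp: r_def)
    then have "w \<subseteq> \<Union>U" using U unfolding is_sup_def by (auto simp: r_def)
    then have weq: "w = \<Union>(Field (Restr r U))" unfolding FU using w(2) by blast
    have "is_colimit (poset_cat (Restr r U)) E DD (FO Ph (FO T (G (decode w))))
      (\<lambda>Z. FA Ph (FA T (incl (G (decode Z)) (G (decode w)))))"
      unfolding DD_def
    proof (rule coded_colimit[OF Ph(2) _ _ _ weq])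
      show "directed (Restr r U)" using U by blast
      show "Field (Restr r U) \<subseteq> Pow coded_gens" unfolding FU using U S(1) unfolding FSr by blast
      show "Y \<subseteq> Z" if "(Y, Z) \<in> Restr r U" for Y Z using that unfolding r_def by auto
      show "G (decode w) = sub (bcarrier (G (decode w))) (level (G (decode w)))" unfolding G_def by simp
    qed auto
    then show "is_colimit (poset_cat (Restr r U)) E DD (FO DD w) (\<lambda>u. FA DD (u, w))"
      by (simp add: DD_def)
  qed
  have Un: "\<Union>(Field r) = coded_gens"
  proof
    show "\<Union>(Field r) \<subseteq> coded_gens" unfolding FSr using S(1) by blast
    show "coded_gens \<subseteq> \<Union>(Field r)"
    proof
      fix t assume "t \<in> coded_gens"
      then have "{t} \<in> Field r" unfolding FSr by (intro fin) auto
      then show "t \<in> \<Union>(Field r)" by blast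
    qed
  qed
  have dX: "decode coded_gens = Field X" unfolding decode_def coded_gens_def by auto
  show "is_colimit (poset_cat r) E DD (FO Ph (FO T FS)) (\<lambda>Z. FA Ph (FA T (incl (G (decode Z)) FS)))"
    unfolding DD_def
  proof (rule coded_colimit[OF Ph(2) dir _ _ Un[symmetric] FS_G(1)])
    show "Field r \<subseteq> Pow coded_gens" unfolding FSr using S(1) by blast
    show "Y \<subseteq> Z" if "(Y, Z) \<in> r" for Y Z using that unfolding r_def by auto
    show "bcarrier FS = bcarrier (G (decode coded_gens))" unfolding dX by (rule FS_G(2))
    show "level FS p = level (G (decode coded_gens)) p" if "p \<in> Field P" for p
      unfolding dX by (rule FS_G(3)[OF that])
  qed
qed

lemma weakly_presented_factor:
  fixes lam :: "'l rel"
  assumes lam: "Card_order lam" "infinite (Field lam)"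
    and Ph: "is_functor C E Ph" "preserves_small_directed_colimits TYPE('x bterm set) C E Ph"
    and a: "weakly_presented TYPE('x bterm set) lam E a" and f: "f \<in> hom E a (FO Ph (FO T FS))"
  shows "\<exists>Z g. Z \<subseteq> Field X \<and> |Z| <o lam \<and> g \<in> hom E a (FO Ph (FO T (G Z))) \<and>
    f = Cmp E (FA Ph (FA T (incl (G Z) FS))) g"
proof -
  let ?DD = "functor_comp Ph (functor_comp T GD)"
  have "\<exists>Z\<in>small_subsets lam coded_gens. \<exists>g\<in>hom E a (FO ?DD Z).
      f = Cmp E (FA Ph (FA T (incl (G (decode Z)) FS))) g"
    using a[unfolded weakly_presented_def Let_def, THEN conjunct2, THEN spec, THEN spec, THEN spec, THEN spec,
        THEN mp, OF conjI, OF small_diagram[OF lam Ph], THEN bspec, OF f] .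
  then obtain Z g where Z: "Z \<in> small_subsets lam coded_gens" "g \<in> hom E a (FO ?DD Z)"
    "f = Cmp E (FA Ph (FA T (incl (G (decode Z)) FS))) g" by blast
  have "|decode Z| <o lam"
    using Z(1) ordLeq_ordLess_trans[OF decode_card] unfolding small_subsets_def by blast
  then show ?thesis using Z(2,3) decode_sub by (intro exI[of _ "decode Z"] exI[of _ g]) simp
qed

lemma GS_small:
  assumes lam: "Card_order lam" "infinite (Field lam)" and Z: "Z \<subseteq> Field X" "|Z| <o lam"
  shows "GS Z \<in> small_subsets lam (Field X)"
proof -
  have Y: "Y \<in> Fpow (Field X)" if "Y \<in> Fpow Z" for Y using Fpow_mono[OF Z(1)] that by blast
  have "|GS Z| <o lam" unfolding GS_def by (rule small_UN_Fpow[OF lam Z(2) lsupp(1)[OF Y]])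
  moreover have "GS Z \<subseteq> Field X" unfolding GS_def using lsupp(2)[OF Y] by blast
  ultimately show ?thesis unfolding small_subsets_def by blast
qed

lemma sharp_ideal_norm:
  assumes "x \<in> sharp_ideals P X d"
  shows "norm_of x (ideal_norm P d x)"
proof -
  obtain m where m: "poset_ideal X x" "greatest_in P (d ` x) m" using assms unfolding sharp_ideals_def by blast
  have "ideal_norm P d x = m"
    unfolding ideal_norm_def
  proof (rule the_equality[of "greatest_in P (d ` x)", OF m(2)])
    fix m' assume "greatest_in P (d ` x) m'"
    then show "m' = m" using m(2) P_order(3)[OF P_po] unfolding greatest_in_def by blast
  qed
  then show ?thesis using m unfolding norm_of_def by simp
qed

end

section \<open>Projectability\<close>

text \<open>The new objects are the codomains of the epimorphisms in the projectability witnesses,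
  and the new natural equivalence consists of their isomorphisms. The lifting property produces the
  transition arrows; functoriality holds because the epimorphisms can be cancelled.\<close>

lemma projectable_replacement:
  assumes P: "Partial_order P" and proj: "projectable_larder L"
    and BB: "is_functor (poset_cat P) (catB L) BB" and Psi: "is_functor (catB L) (catS L) (Psi L)"
    and nt: "nat_trans (poset_cat P) (catS L) (functor_comp (Psi L) BB) AA \<chi>"
    and dbl: "\<And>p. p \<in> Field P \<Longrightarrow> \<chi> p \<in> Arr (Sdbl L)"
  shows "\<exists>BB' \<chi>' \<eta>. is_functor (poset_cat P) (catB L) BB' \<and>
     nat_trans (poset_cat P) (catS L) (functor_comp (Psi L) BB') AA \<chi>' \<and>
     (\<forall>p\<in>Field P. isomorphism (catS L) (\<chi>' p)) \<and>
     nat_trans (poset_cat P) (catB L) BB BB' \<eta> \<and> (\<forall>p\<in>Field P. epic (catB L) (\<eta> p))"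
proof -
  let ?B = "catB L" and ?S = "catS L"
  note cats = functor_cats[OF Psi]
  have AA: "is_functor (poset_cat P) ?S AA"
    and \<chi>h: "\<And>p. p \<in> Field P \<Longrightarrow> \<chi> p \<in> hom ?S (FO (Psi L) (FO BB p)) (FO AA p)"
    and \<chi>n: "\<And>p q. (p, q) \<in> P \<Longrightarrow> Cmp ?S (\<chi> q) (FA (Psi L) (FA BB (p, q))) = Cmp ?S (FA AA (p, q)) (\<chi> p)"
    using nt unfolding nat_trans_def by auto
  note BBf = BB[unfolded is_functor_poset[OF P]] and AAf = AA[unfolded is_functor_poset[OF P]]
  have "\<exists>a \<epsilon>. projectability_witness ?B ?S (Psi L) (FO BB p) (FO AA p) (\<chi> p) a \<epsilon>" if "p \<in> Field P" for p
  proof -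
    have "FO BB p \<in> Obj ?B" "FO AA p \<in> Obj ?S" using BBf AAf that by auto
    then show ?thesis
      using proj dbl[OF that] \<chi>h[OF that] unfolding projectable_larder_def double_arrow_def by blast
  qed
  then have "\<exists>a \<epsilon>. \<forall>p\<in>Field P. projectability_witness ?B ?S (Psi L) (FO BB p) (FO AA p) (\<chi> p) (a p) (\<epsilon> p)"
    by metis
  then obtain a \<epsilon> where w: "\<forall>p\<in>Field P. projectability_witness ?B ?S (Psi L) (FO BB p) (FO AA p) (\<chi> p) (a p) (\<epsilon> p)"
    by blast
  define c where "c p = Cod ?B (a p)" for p
  have ah: "a p \<in> hom ?B (FO BB p) (c p)" and ep: "epic ?B (a p)"
    and eh: "\<epsilon> p \<in> hom ?S (FO (Psi L) (c p)) (FO AA p)" and iso: "isomorphism ?S (\<epsilon> p)"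
    and fac: "\<chi> p = Cmp ?S (\<epsilon> p) (FA (Psi L) (a p))"
    and lift: "\<And>Y f \<eta>. f \<in> hom ?B (FO BB p) Y \<Longrightarrow> \<eta> \<in> hom ?S (FO (Psi L) (c p)) (FO (Psi L) Y) \<Longrightarrow>
      FA (Psi L) f = Cmp ?S \<eta> (FA (Psi L) (a p)) \<Longrightarrow>
      \<exists>g\<in>hom ?B (c p) Y. f = Cmp ?B g (a p) \<and> \<eta> = FA (Psi L) g"
    if "p \<in> Field P" for p
    using w[THEN bspec, OF that] hom_objs(2)[OF cats(1)]
    unfolding projectability_witness_def c_def hom_def[of ?B "FO BB p" "Cod ?B (a p)"] by auto
  have "\<exists>g. g \<in> hom ?B (c p) (c q) \<and> Cmp ?B g (a p) = Cmp ?B (a q) (FA BB (p, q)) \<and>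
      Cmp ?S (\<epsilon> q) (FA (Psi L) g) = Cmp ?S (FA AA (p, q)) (\<epsilon> p)" if pq: "(p, q) \<in> P" for p q
  proof -
    note F = FieldI1[OF pq] FieldI2[OF pq]
    have \<beta>: "FA BB (p, q) \<in> hom ?B (FO BB p) (FO BB q)" using BBf pq by blast
    have \<alpha>: "FA AA (p, q) \<in> hom ?S (FO AA p) (FO AA q)" using AAf pq by blast
    obtain k where k: "k \<in> hom ?S (FO AA q) (FO (Psi L) (c q))"
      "Cmp ?S k (\<epsilon> q) = Ident ?S (FO (Psi L) (c q))" "Cmp ?S (\<epsilon> q) k = Ident ?S (FO AA q)"
      using iso[OF F(2)] eh[OF F(2)] unfolding isomorphism_def hom_def by auto
    \<comment> \<open>With \<open>k\<close> the inverse of \<open>\<epsilon> q\<close>, the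
      composite of \<open>k\<close> and \<open>\<theta>\<close> is the transition arrow of
      \<open>AA\<close> transported along the isomorphisms. It is the arrow \<open>\<eta>\<close> to
      which the lifting property is applied.\<close>
    define \<theta> where "\<theta> = Cmp ?S (FA AA (p, q)) (\<epsilon> p)"
    have \<theta>: "\<theta> \<in> hom ?S (FO (Psi L) (c p)) (FO AA q)"
      unfolding \<theta>_def by (rule hom_cmp[OF cats(2) eh[OF F(1)] \<alpha>])
    note Pa = functor_hom[OF Psi ah[OF F(1)]] functor_hom[OF Psi ah[OF F(2)]]
    note P\<beta> = functor_hom[OF Psi \<beta>]
    have "Cmp ?S (Cmp ?S k \<theta>) (FA (Psi L) (a p)) = Cmp ?S k (Cmp ?S \<theta> (FA (Psi L) (a p)))"
      using cmp_assoc[OF cats(2) Pa(1) \<theta> k(1)] by simp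
    also have "Cmp ?S \<theta> (FA (Psi L) (a p)) = Cmp ?S (FA AA (p, q)) (\<chi> p)"
      unfolding \<theta>_def fac[OF F(1)] using cmp_assoc[OF cats(2) Pa(1) eh[OF F(1)] \<alpha>] by simp
    also have "\<dots> = Cmp ?S (Cmp ?S (\<epsilon> q) (FA (Psi L) (a q))) (FA (Psi L) (FA BB (p, q)))"
      unfolding \<chi>n[OF pq, symmetric] fac[OF F(2)] ..
    also have "\<dots> = Cmp ?S (\<epsilon> q) (FA (Psi L) (Cmp ?B (a q) (FA BB (p, q))))"
      using cmp_assoc[OF cats(2) P\<beta> Pa(2) eh[OF F(2)]] functor_cmp[OF Psi \<beta> ah[OF F(2)]] by simp
    also have "Cmp ?S k \<dots> = FA (Psi L) (Cmp ?B (a q) (FA BB (p, q)))"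
    proof -
      note h = functor_hom[OF Psi hom_cmp[OF cats(1) \<beta> ah[OF F(2)]]]
      show ?thesis using cmp_assoc[OF cats(2) h eh[OF F(2)] k(1)] k(2) cmp_ident(2)[OF cats(2) h] by simp
    qed
    finally have "FA (Psi L) (Cmp ?B (a q) (FA BB (p, q))) = Cmp ?S (Cmp ?S k \<theta>) (FA (Psi L) (a p))" by simp
    from lift[OF F(1) hom_cmp[OF cats(1) \<beta> ah[OF F(2)]] hom_cmp[OF cats(2) \<theta> k(1)] this]
    obtain g where g: "g \<in> hom ?B (c p) (c q)" "Cmp ?B (a q) (FA BB (p, q)) = Cmp ?B g (a p)"
      "Cmp ?S k \<theta> = FA (Psi L) g" by blast
    have "Cmp ?S (\<epsilon> q) (FA (Psi L) g) = \<theta>"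
      unfolding g(3)[symmetric]
      using cmp_assoc[OF cats(2) \<theta> k(1) eh[OF F(2)]] k(3) cmp_ident(2)[OF cats(2) \<theta>] by simp
    then show ?thesis using g unfolding \<theta>_def by metis
  qed
  then have "\<exists>g. \<forall>p q. (p, q) \<in> P \<longrightarrow> g p q \<in> hom ?B (c p) (c q) \<and>
      Cmp ?B (g p q) (a p) = Cmp ?B (a q) (FA BB (p, q)) \<and>
      Cmp ?S (\<epsilon> q) (FA (Psi L) (g p q)) = Cmp ?S (FA AA (p, q)) (\<epsilon> p)" by metis
  then obtain g where "\<forall>p q. (p, q) \<in> P \<longrightarrow> g p q \<in> hom ?B (c p) (c q) \<and>
      Cmp ?B (g p q) (a p) = Cmp ?B (a q) (FA BB (p, q)) \<and>
      Cmp ?S (\<epsilon> q) (FA (Psi L) (g p q)) = Cmp ?S (FA AA (p, q)) (\<epsilon> p)" by blast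
  then have g: "\<And>p q. (p, q) \<in> P \<Longrightarrow> g p q \<in> hom ?B (c p) (c q)"
    "\<And>p q. (p, q) \<in> P \<Longrightarrow> Cmp ?B (g p q) (a p) = Cmp ?B (a q) (FA BB (p, q))"
    "\<And>p q. (p, q) \<in> P \<Longrightarrow> Cmp ?S (\<epsilon> q) (FA (Psi L) (g p q)) = Cmp ?S (FA AA (p, q)) (\<epsilon> p)" by blast+
  let ?BB' = "\<lparr>FO = c, FA = \<lambda>(p, q). g p q\<rparr>"
  have f': "is_functor (poset_cat P) ?B ?BB'"
    unfolding is_functor_poset[OF P]
  proof (intro conjI ballI allI impI)
    show "category ?B" by (rule cats)
    fix p assume p: "p \<in> Field P"
    have pp: "(p, p) \<in> P" using partial_orderD(1)[OF P p] .
    have cO: "c p \<in> Obj ?B" by (rule hom_objs(2)[OF cats(1) ah[OF p]])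
    then show "FO ?BB' p \<in> Obj ?B" by simp
    have "g p p = Ident ?B (c p)"
    proof (rule epic_cancel[OF ep[OF p] ah[OF p] g(1)[OF pp] ident_hom[OF cats(1) cO]])
      show "Cmp ?B (g p p) (a p) = Cmp ?B (Ident ?B (c p)) (a p)"
        using g(2)[OF pp] BBf p cmp_ident[OF cats(1) ah[OF p]] by simp
    qed
    then show "FA ?BB' (p, p) = Ident ?B (FO ?BB' p)" by simp
  next
    fix p q assume pq: "(p, q) \<in> P"
    show "FA ?BB' (p, q) \<in> hom ?B (FO ?BB' p) (FO ?BB' q)" using g(1)[OF pq] by simp
    fix w assume qw: "(q, w) \<in> P"
    note pw = partial_orderD(2)[OF P pq qw]
    note F = FieldI1[OF pq] FieldI2[OF pq] FieldI2[OF qw]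
    have \<beta>: "FA BB (p, q) \<in> hom ?B (FO BB p) (FO BB q)" "FA BB (q, w) \<in> hom ?B (FO BB q) (FO BB w)"
      "FA BB (p, w) = Cmp ?B (FA BB (q, w)) (FA BB (p, q))"
      using BBf pq qw by blast+
    have "Cmp ?B (Cmp ?B (g q w) (g p q)) (a p) = Cmp ?B (g q w) (Cmp ?B (a q) (FA BB (p, q)))"
      using cmp_assoc[OF cats(1) ah[OF F(1)] g(1)[OF pq] g(1)[OF qw]] g(2)[OF pq] by simp
    also have "\<dots> = Cmp ?B (Cmp ?B (a w) (FA BB (q, w))) (FA BB (p, q))"
      using cmp_assoc[OF cats(1) \<beta>(1) ah[OF F(2)] g(1)[OF qw]] g(2)[OF qw] by simp
    also have "\<dots> = Cmp ?B (g p w) (a p)"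
      using cmp_assoc[OF cats(1) \<beta>(1,2) ah[OF F(3)]] g(2)[OF pw] \<beta>(3) by simp
    finally have "g p w = Cmp ?B (g q w) (g p q)"
      using epic_cancel[OF ep[OF F(1)] ah[OF F(1)] g(1)[OF pw] hom_cmp[OF cats(1) g(1)[OF pq] g(1)[OF qw]]]
      by simp
    then show "FA ?BB' (p, w) = Cmp ?B (FA ?BB' (q, w)) (FA ?BB' (p, q))" by simp
  qed
  have "nat_trans (poset_cat P) ?S (functor_comp (Psi L) ?BB') AA \<epsilon>"
    unfolding nat_trans_def using is_functor_comp[OF f' Psi] AA eh g(3) by auto
  moreover have "nat_trans (poset_cat P) ?B BB ?BB' a"
    unfolding nat_trans_def using f' BB ah g(2) by auto
  ultimately show ?thesis using f' iso ep by blast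
qed

section \<open>The Condensate Lifting Lemma\<close>

theorem mainTheorem1:
  fixes lam :: "'l rel" and mu :: "'m rel"
    and L :: "('oa, 'aa, 'ob, 'ab, 'os, 'as) larder" and B :: 'ob
    and P :: "'p rel" and X :: "'x rel" and d :: "'x \<Rightarrow> 'p" and XX :: "'x set set"
    and A :: "('p, 'oa, 'aa) diagram"
    and T :: "(('x bterm set, 'p) sbalg,
               ('x bterm set, 'p) sbalg \<times> ('x bterm set \<Rightarrow> 'x bterm set) \<times> ('x bterm set, 'p) sbalg,
               'oa, 'aa) cfunctor"
    and \<chi> :: 'as
  assumes "Card_order lam" "infinite (Field lam)"
    and "Card_order mu" "infinite (Field mu)"
    and "is_larder TYPE('x bterm set) lam mu L B"
    and "poset P" and "is_lifter lam P X d XX"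
    and "is_functor (poset_cat P) (catA L) A"
    and "\<forall>p\<in>Field P. \<not> maximal_in P p \<longrightarrow> FO A p \<in> Obj (Adag L)"
    and "is_tensor_functor P (catA L) A T"
    and "double_arrow L \<chi> (FO (Psi L) B) (FO (Phi L) (FO T (F_scaled P X d)))"
    and "(mu =o natLeq \<and> lower_finite (incl_rel (nonmax_part P d XX))) \<or>
         (mu =o cf lam \<and> well_founded (incl_rel (nonmax_part P d XX))) \<or>
         (mu =o cf lam \<and> strong_larder mu L)"
  shows "\<exists>(BB :: ('p, 'ob, 'ab) diagram) \<chi>s.
    is_functor (poset_cat P) (catB L) BB \<and>
    nat_trans (poset_cat P) (catS L) (functor_comp (Psi L) BB) (functor_comp (Phi L) A) \<chi>s \<and>
    (\<forall>p\<in>Field P. \<chi>s p \<in> Arr (Sdbl L)) \<and>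
    (\<forall>p\<in>Field P. \<not> maximal_in P p \<longrightarrow> FO BB p \<in> Obj (Bdag L)) \<and>
    (\<forall>p\<in>Field P. maximal_in P p \<longrightarrow> FO BB p = B) \<and>
    (projectable_larder L \<longrightarrow>
      (\<exists>(BB' :: ('p, 'ob, 'ab) diagram) \<chi>s' \<eta>.
        is_functor (poset_cat P) (catB L) BB' \<and>
        nat_trans (poset_cat P) (catS L) (functor_comp (Psi L) BB') (functor_comp (Phi L) A) \<chi>s' \<and>
        (\<forall>p\<in>Field P. isomorphism (catS L) (\<chi>s' p)) \<and>
        nat_trans (poset_cat P) (catB L) BB BB' \<eta> \<and>
        (\<forall>p\<in>Field P. epic (catB L) (\<eta> p))))"
proof -
  let ?A = "catA L" and ?B = "catB L" and ?S = "catS L" and ?\<Phi> = "Phi L" and ?\<Psi> = "Psi L"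
  let ?N = "nonmax_part P d XX" and ?n = "ideal_norm P d" and ?F = "F_scaled P X d"
  note lam = assms(1,2) and mu = assms(3,4) and lifter = assms(7)[unfolded is_lifter_def]
  have catA: "category ?A" and catB: "category ?B" and catS: "category ?S" and B: "B \<in> Obj ?B"
    and Phi: "is_functor ?A ?S ?\<Phi>" and Psi: "is_functor ?B ?S ?\<Psi>"
    and Bdag: "full_subcategory (Bdag L) ?B" and Sdbl: "subcategory (Sdbl L) ?S"
    and Phi_pres: "preserves_small_directed_colimits TYPE('x bterm set) ?A ?S ?\<Phi>"
    and ext: "\<And>f. extended_projection TYPE('x bterm set) ?A f \<Longrightarrow> FA ?\<Phi> f \<in> Arr (Sdbl L)"
    and wp: "\<And>C. C \<in> Obj (Bdag L) \<Longrightarrow> weakly_presented TYPE('x bterm set) lam ?S (FO ?\<Psi> C)"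
    and LS: "LS mu L B"
    using assms(5) unfolding is_larder_def by auto
  obtain pr where T: "is_functor (Bool_cat_nt P) ?A T"
      "preserves_small_directed_colimits TYPE('x bterm set) (Bool_cat_nt P) ?A T"
    and pr: "\<forall>K\<in>Obj (Bool_cat_nt P). compact_sbalg P K \<longrightarrow>
        is_product ?A (atoms K) (\<lambda>u. FO A (atom_norm P K u)) (FO T K) (pr K)"
      "\<forall>(K, f, K')\<in>Arr (Bool_cat_nt P). compact_sbalg P K \<and> compact_sbalg P K' \<longrightarrow>
        (\<forall>v\<in>atoms K'. let u = (THE u. u \<in> atoms K \<and> ble K' v (f u)) in
          Cmp ?A (pr K' v) (FA T (K, f, K')) =
          Cmp ?A (FA A (atom_norm P K u, atom_norm P K' v)) (pr K u))"
    using assms(10) unfolding is_tensor_functor_def by blast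
  interpret condensate P X d ?A A T pr
  proof
    show "poset P" "norm_covering P X d" using assms(6) lifter[THEN conjunct1] by blast+
    show "is_functor (poset_cat P) ?A A" by (rule assms(8))
    show "is_functor (Bool_cat_nt P) ?A T"
      "preserves_small_directed_colimits TYPE('x bterm set) (Bool_cat_nt P) ?A T" by (rule T)+
    show "is_product ?A (atoms K) (\<lambda>u. FO A (atom_norm P K u)) (FO T K) (pr K)"
      if "K \<in> Obj (Bool_cat_nt P)" "compact_sbalg P K" for K using pr(1) that by blast
    show "Cmp ?A (pr K' v) (FA T (K, f, K')) =
        (let u = (THE u. u \<in> atoms K \<and> ble K' v (f u)) in
          Cmp ?A (FA A (atom_norm P K u, atom_norm P K' v)) (pr K u))"
      if "(K, f, K') \<in> Arr (Bool_cat_nt P)" "compact_sbalg P K" "compact_sbalg P K'" "v \<in> atoms K'"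
      for K f K' v
      using bspec[OF pr(2) that(1)] that(2-4) by (simp add: Let_def)
  qed
  interpret larder_at mu L B
    by unfold_locales (rule mu catB catS Psi Bdag Sdbl LS)+

  have norm: "norm_of x (?n x)" if "x \<in> XX" for x
    using sharp_ideal_norm[OF subsetD[OF lifter[THEN conjunct2, THEN conjunct1] that]] .
  have N: "x \<in> XX" "\<not> maximal_in P (?n x)" if "x \<in> ?N" for x
    using that unfolding nonmax_part_def by auto
  have \<chi>: "\<chi> \<in> Arr (Sdbl L)" "\<chi> \<in> hom ?S (FO ?\<Psi> B) (FO ?\<Phi> (FO T ?F))"
    using assms(11) unfolding double_arrow_def by auto
  define \<phi> where "\<phi> x = Cmp ?S (FA ?\<Phi> (proj x (?n x))) \<chi>" for x
  have projh: "FA ?\<Phi> (proj x (?n x)) \<in> hom ?S (FO ?\<Phi> (FO T ?F)) (FO ?\<Phi> (FO A (?n x)))" if "x \<in> XX" for x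
    by (rule functor_hom[OF Phi proj_hom[OF norm[OF that]]])
  have \<phi>h: "\<phi> x \<in> hom ?S (FO ?\<Psi> B) (FO ?\<Phi> (FO A (?n x)))" if "x \<in> XX" for x
    unfolding \<phi>_def by (rule hom_cmp[OF catS \<chi>(2) projh[OF that]])
  have \<phi>d: "\<phi> x \<in> Arr (Sdbl L)" if x: "x \<in> XX" for x
  proof -
    have e: "FA ?\<Phi> (proj x (?n x)) \<in> Arr (Sdbl L)" by (rule ext[OF proj_extended[OF norm[OF x]]])
    have "Cod (Sdbl L) \<chi> = Dom (Sdbl L) (FA ?\<Phi> (proj x (?n x)))"
      using Sdbl e \<chi> projh[OF x] unfolding subcategory_def hom_def by auto
    then have "Cmp (Sdbl L) (FA ?\<Phi> (proj x (?n x))) \<chi> \<in> Arr (Sdbl L)"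
      "Cmp (Sdbl L) (FA ?\<Phi> (proj x (?n x))) \<chi> = \<phi> x"
      using Sdbl e \<chi>(1) unfolding subcategory_def category_def hom_def \<phi>_def by auto
    then show ?thesis by simp
  qed
  \<comment> \<open>At a maximal norm the target need not come from \<open>Adag L\<close>, so the
    Loewenheim-Skolem property is available on \<open>nonmax_part\<close> only.\<close>
  have \<phi>onto: "double_onto_dagger (\<phi> x)" if x: "x \<in> Field (incl_rel ?N)" for x
  proof -
    have x': "x \<in> XX" "\<not> maximal_in P (?n x)" using N x by auto
    have "FO A (?n x) \<in> Obj (Adag L)" using assms(9) norm_ofD(2)[OF norm[OF x'(1)]] x'(2) by blast
    then show ?thesis
      unfolding double_onto_dagger_def double_arrow_def using \<phi>h[OF x'(1)] \<phi>d[OF x'(1)] by blast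
  qed

  have cf: "|{y. (y, x) \<in> incl_rel ?N}| <o mu" if "mu =o cf lam" "x \<in> Field (incl_rel ?N)" for x
  proof -
    have "|{y \<in> XX. y \<subseteq> x}| <o cf lam"
      using lifter[THEN conjunct2, THEN conjunct2, THEN conjunct1] that(2) unfolding Field_incl_rel by blast
    then have "|{y \<in> XX. y \<subseteq> x}| <o mu" using ordLess_ordIso_trans ordIso_symmetric[OF that(1)] by blast
    moreover have "{y. (y, x) \<in> incl_rel ?N} \<subseteq> {y \<in> XX. y \<subseteq> x}" using N by auto
    ultimately show ?thesis using ordLeq_ordLess_trans[OF card_of_mono1] by blast
  qed
  have "\<exists>M \<gamma>. buttress (incl_rel ?N) \<phi> M \<gamma>"
    using assms(12)
  proof (elim disjE conjE)
    assume fin: "lower_finite (incl_rel ?N)"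
    have f: "finite {y. (y, x) \<in> incl_rel ?N}" if "x \<in> Field (incl_rel ?N)" for x
      using fin that unfolding lower_finite_def by blast
    \<comment> \<open>In a lower finite poset, the number of elements below strictly increases along
      strict inclusions, and it serves as a measure.\<close>
    have "wf {(v, u). (v, u) \<in> incl_rel ?N \<and> v \<noteq> u}"
    proof (rule wf_subset[OF wf_measure[of "\<lambda>u. card {y. (y, u) \<in> incl_rel ?N}"]], clarify)
      fix v u assume vu: "(v, u) \<in> incl_rel ?N" "v \<noteq> u"
      have "{y. (y, v) \<in> incl_rel ?N} \<subset> {y. (y, u) \<in> incl_rel ?N}" using vu by auto
      then show "(v, u) \<in> measure (\<lambda>u. card {y. (y, u) \<in> incl_rel ?N})"
        using psubset_card_mono[OF f[OF FieldI2[OF vu(1)]]] by simp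
    qed
    then show ?thesis
      by (rule buttress_well_founded[OF Partial_order_incl_rel _ finite_small[OF mu f] \<phi>onto])
  next
    assume m: "mu =o cf lam" and w: "well_founded (incl_rel ?N)"
    have "wf {(v, u). (v, u) \<in> incl_rel ?N \<and> v \<noteq> u}"
    proof (rule wfI_min)
      fix x Q assume x: "x \<in> (Q :: 'x set set)"
      show "\<exists>z\<in>Q. \<forall>y. (y, z) \<in> {(v, u). (v, u) \<in> incl_rel ?N \<and> v \<noteq> u} \<longrightarrow> y \<notin> Q"
      proof (cases "x \<in> ?N")
        case True
        then have "minimal_elems (incl_rel ?N) (Q \<inter> ?N) \<noteq> {}"
          using w[unfolded well_founded_def, rule_format, of "Q \<inter> ?N"] x by auto
        then obtain z where "z \<in> minimal_elems (incl_rel ?N) (Q \<inter> ?N)" by blast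
        then show ?thesis unfolding minimal_elems_def by auto
      next
        case False
        then show ?thesis using x by auto
      qed
    qed
    then show ?thesis
      by (rule buttress_well_founded[OF Partial_order_incl_rel _ cf[OF m] \<phi>onto])
  next
    assume m: "mu =o cf lam" and s: "strong_larder mu L"
    show ?thesis by (rule buttress_strong[OF Partial_order_incl_rel s cf[OF m] \<phi>onto])
  qed
  then obtain M \<gamma> where Mg: "buttress (incl_rel ?N) \<phi> M \<gamma>" by blast
  have Mfun: "is_functor (poset_cat (incl_rel ?N)) ?B M" using Mg unfolding buttress_def by blast
  note Mf = Mfun[unfolded is_functor_poset[OF Partial_order_incl_rel]]
  have M: "FO M x \<in> Obj (Bdag L)" "\<gamma> x \<in> hom ?B (FO M x) B"
      "Cmp ?S (\<phi> x) (FA ?\<Psi> (\<gamma> x)) \<in> Arr (Sdbl L)" if "x \<in> ?N" for x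
    using Mg that unfolding buttress_def by auto
  have M\<gamma>: "Cmp ?B (\<gamma> y) (FA M (x, y)) = \<gamma> x" if "(x, y) \<in> incl_rel ?N" for x y
    using Mg that unfolding buttress_def by blast

  have "\<exists>Z g. Z \<subseteq> Field X \<and> |Z| <o lam \<and> g \<in> hom ?S (FO ?\<Psi> (FO M x)) (FO ?\<Phi> (FO T (G Z))) \<and>
      Cmp ?S \<chi> (FA ?\<Psi> (\<gamma> x)) = Cmp ?S (FA ?\<Phi> (FA T (incl (G Z) ?F))) g" if x: "x \<in> ?N" for x
    by (rule weakly_presented_factor[OF lam Phi Phi_pres wp[OF M(1)[OF x]]
          hom_cmp[OF catS functor_hom[OF Psi M(2)[OF x]] \<chi>(2)]])
  then have "\<exists>Z g. \<forall>x\<in>?N. Z x \<subseteq> Field X \<and> |Z x| <o lam \<and>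
      g x \<in> hom ?S (FO ?\<Psi> (FO M x)) (FO ?\<Phi> (FO T (G (Z x)))) \<and>
      Cmp ?S \<chi> (FA ?\<Psi> (\<gamma> x)) = Cmp ?S (FA ?\<Phi> (FA T (incl (G (Z x)) ?F))) (g x)" by metis
  then obtain Z g where Zg: "\<forall>x\<in>?N. Z x \<subseteq> Field X \<and> |Z x| <o lam \<and>
      g x \<in> hom ?S (FO ?\<Psi> (FO M x)) (FO ?\<Phi> (FO T (G (Z x)))) \<and>
      Cmp ?S \<chi> (FA ?\<Psi> (\<gamma> x)) = Cmp ?S (FA ?\<Phi> (FA T (incl (G (Z x)) ?F))) (g x)" by blast
  \<comment> \<open>The lifter is applied to \<open>GS (Z x)\<close> instead of \<open>Z x\<close>:
    equal evaluations on \<open>G (Z x)\<close> require equal traces on the supports of all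
    labellings that enter it.\<close>
  have "\<forall>x\<in>?N. GS (Z x) \<in> small_subsets lam (Field X)" using GS_small[OF lam] Zg by blast
  then obtain \<sigma> where \<sigma>: "\<forall>p\<in>Field P. \<sigma> p \<in> XX \<and> ?n (\<sigma> p) = p" "\<forall>(p, q)\<in>P. \<sigma> p \<subseteq> \<sigma> q"
    "\<forall>(a, b)\<in>P. a \<noteq> b \<longrightarrow> GS (Z (\<sigma> a)) \<inter> \<sigma> b \<subseteq> \<sigma> a"
    using lifter[THEN conjunct2, THEN conjunct2, THEN conjunct2, THEN conjunct1, THEN spec[of _ "\<lambda>x. GS (Z x)"]]
    by blast
  have \<sigma>X: "\<sigma> p \<in> XX" "?n (\<sigma> p) = p" if "p \<in> Field P" for p using \<sigma>(1) that by auto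
  have \<sigma>N: "\<sigma> p \<in> ?N" if "p \<in> Field P" "\<not> maximal_in P p" for p
    using \<sigma>X[OF that(1)] that(2) unfolding nonmax_part_def by simp
  have \<sigma>le: "(\<sigma> p, \<sigma> q) \<in> incl_rel ?N" if "(p, q) \<in> P" "\<not> maximal_in P p" "\<not> maximal_in P q" for p q
    using \<sigma>(2) \<sigma>N FieldI1[OF that(1)] FieldI2[OF that(1)] that by auto
  have nonmax: "\<not> maximal_in P p" if "(p, q) \<in> P" "p \<noteq> q" for p q
    using that unfolding maximal_in_def by blast

  \<comment> \<open>The evaluations at \<open>\<sigma> a\<close> and \<open>\<sigma> b\<close>
    differ on the condensate, but after composition with \<open>\<gamma> (\<sigma> a)\<close> the
    arrow \<open>\<chi>\<close> factors through \<open>G (Z (\<sigma> a))\<close>, where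
    \<open>proj_natural\<close> applies.\<close>
  have key: "Cmp ?S (FA ?\<Phi> (FA A (a, b))) (Cmp ?S (\<phi> (\<sigma> a)) (FA ?\<Psi> (\<gamma> (\<sigma> a)))) =
      Cmp ?S (\<phi> (\<sigma> b)) (FA ?\<Psi> (\<gamma> (\<sigma> a)))" if ab: "(a, b) \<in> P" "a \<noteq> b" for a b
  proof -
    let ?x = "\<sigma> a" and ?y = "\<sigma> b"
    note F = FieldI1[OF ab(1)] FieldI2[OF ab(1)]
    note x = \<sigma>X[OF F(1)] and y = \<sigma>X[OF F(2)] and xN = \<sigma>N[OF F(1) nonmax[OF ab]]
    let ?i = "FA T (incl (G (Z ?x)) ?F)"
    have Zx: "Z ?x \<subseteq> Field X" and gx: "g ?x \<in> hom ?S (FO ?\<Psi> (FO M ?x)) (FO ?\<Phi> (FO T (G (Z ?x))))"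
      and fac: "Cmp ?S \<chi> (FA ?\<Psi> (\<gamma> ?x)) = Cmp ?S (FA ?\<Phi> ?i) (g ?x)"
      using Zg xN by auto
    have nx: "norm_of ?x a" using norm[OF x(1)] unfolding x(2) .
    have ny: "norm_of ?y b" using norm[OF y(1)] unfolding y(2) .
    have "?x \<subseteq> ?y" "GS (Z ?x) \<inter> ?y \<subseteq> ?x"
      using bspec[OF \<sigma>(2) ab(1)] bspec[OF \<sigma>(3) ab(1)] ab(2) by simp_all
    then have eq: "?x \<inter> GS (Z ?x) = ?y \<inter> GS (Z ?x)" by blast
    have i: "?i \<in> hom ?A (FO T (G (Z ?x))) (FO T ?F)"
      by (rule functor_hom[OF T(1) incl_hom[OF G_SA[OF Zx] FS_SA G_FS[OF Zx]]])
    note \<Phi>i = functor_hom[OF Phi i]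
    note \<gamma>x = functor_hom[OF Psi M(2)[OF xN]]
    have \<phi>\<gamma>: "Cmp ?S (Cmp ?S (FA ?\<Phi> f) \<chi>) (FA ?\<Psi> (\<gamma> ?x)) = Cmp ?S (FA ?\<Phi> (Cmp ?A f ?i)) (g ?x)"
      if f: "f \<in> hom ?A (FO T ?F) c" for f c
    proof -
      note \<Phi>f = functor_hom[OF Phi f]
      have "Cmp ?S (Cmp ?S (FA ?\<Phi> f) \<chi>) (FA ?\<Psi> (\<gamma> ?x)) = Cmp ?S (FA ?\<Phi> f) (Cmp ?S (FA ?\<Phi> ?i) (g ?x))"
        unfolding fac[symmetric] by (rule cmp_assoc[OF catS \<gamma>x \<chi>(2) \<Phi>f, symmetric])
      also have "\<dots> = Cmp ?S (Cmp ?S (FA ?\<Phi> f) (FA ?\<Phi> ?i)) (g ?x)" by (rule cmp_assoc[OF catS gx \<Phi>i \<Phi>f])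
      finally show ?thesis unfolding functor_cmp[OF Phi i f] .
    qed
    note pi = hom_cmp[OF catA i proj_hom[OF nx]]
    have "Cmp ?S (FA ?\<Phi> (FA A (a, b))) (Cmp ?S (\<phi> ?x) (FA ?\<Psi> (\<gamma> ?x))) =
        Cmp ?S (FA ?\<Phi> (FA A (a, b))) (Cmp ?S (FA ?\<Phi> (Cmp ?A (proj ?x a) ?i)) (g ?x))"
      unfolding \<phi>_def x(2) \<phi>\<gamma>[OF proj_hom[OF nx]] ..
    also have "\<dots> = Cmp ?S (FA ?\<Phi> (Cmp ?A (FA A (a, b)) (Cmp ?A (proj ?x a) ?i))) (g ?x)"
      unfolding functor_cmp[OF Phi pi D_hom[OF ab(1)]]
      by (rule cmp_assoc[OF catS gx functor_hom[OF Phi pi] functor_hom[OF Phi D_hom[OF ab(1)]]])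
    also have "\<dots> = Cmp ?S (FA ?\<Phi> (Cmp ?A (proj ?y b) ?i)) (g ?x)"
      unfolding proj_natural[OF nx ny ab(1) Zx eq] ..
    also have "\<dots> = Cmp ?S (\<phi> ?y) (FA ?\<Psi> (\<gamma> ?x))"
      unfolding \<phi>_def y(2) \<phi>\<gamma>[OF proj_hom[OF ny]] ..
    finally show ?thesis .
  qed

  \<comment> \<open>For distinct comparable elements the smaller one is not maximal, so
    \<open>\<gamma>\<close> and \<open>M\<close> are available where \<open>\<beta>\<close> calls
    for them. The diagonal is treated apart, as \<open>M\<close> has no value at a maximal element.
    In effect the cocone \<open>\<gamma>\<close> turns \<open>B\<close> into a top vertex, repeated
    at every maximal element.\<close>
  define BO where "BO p = (if maximal_in P p then B else FO M (\<sigma> p))" for p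
  define \<iota> where "\<iota> p = (if maximal_in P p then Ident ?B B else \<gamma> (\<sigma> p))" for p
  define \<beta> where "\<beta> p q = (if p = q then Ident ?B (BO p)
     else if maximal_in P q then \<gamma> (\<sigma> p) else FA M (\<sigma> p, \<sigma> q))" for p q
  let ?BB = "\<lparr>FO = BO, FA = \<lambda>(p, q). \<beta> p q\<rparr>"
  have \<iota>: "\<iota> p \<in> hom ?B (BO p) B" if "p \<in> Field P" for p
    using ident_hom[OF catB B] M(2)[OF \<sigma>N[OF that]] unfolding \<iota>_def BO_def by simp
  have BO: "BO p \<in> Obj ?B" if "p \<in> Field P" for p by (rule hom_objs(1)[OF catB \<iota>[OF that]])
  have \<beta>h: "\<beta> p q \<in> hom ?B (BO p) (BO q)" if pq: "(p, q) \<in> P" for p q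
  proof (cases "p = q")
    case True
    then show ?thesis using ident_hom[OF catB BO[OF FieldI1[OF pq]]] unfolding \<beta>_def by simp
  next
    case False
    note np = nonmax[OF pq False]
    show ?thesis
    proof (cases "maximal_in P q")
      case True
      then show ?thesis using M(2)[OF \<sigma>N[OF FieldI1[OF pq] np]] np False unfolding \<beta>_def BO_def by simp
    next
      case nq: False
      have "FA M (\<sigma> p, \<sigma> q) \<in> hom ?B (FO M (\<sigma> p)) (FO M (\<sigma> q))" using Mf \<sigma>le[OF pq np nq] by blast
      then show ?thesis using np nq False unfolding \<beta>_def BO_def by simp
    qed
  qed
  have \<iota>\<beta>: "Cmp ?B (\<iota> q) (\<beta> p q) = \<iota> p" if pq: "(p, q) \<in> P" for p q
  proof (cases "p = q")
    case True
    then show ?thesis using cmp_ident(1)[OF catB \<iota>[OF FieldI1[OF pq]]] unfolding \<beta>_def by simp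
  next
    case False
    note np = nonmax[OF pq False]
    show ?thesis
      using cmp_ident(2)[OF catB M(2)[OF \<sigma>N[OF FieldI1[OF pq] np]]] M\<gamma>[OF \<sigma>le[OF pq np]] np False
      unfolding \<iota>_def \<beta>_def by simp
  qed
  have \<beta>c: "\<beta> p w = Cmp ?B (\<beta> q w) (\<beta> p q)" if pq: "(p, q) \<in> P" and qw: "(q, w) \<in> P" for p q w
  proof (cases "p = q \<or> q = w")
    case True
    then show ?thesis using cmp_ident[OF catB \<beta>h[OF pq]] cmp_ident[OF catB \<beta>h[OF qw]] unfolding \<beta>_def by auto
  next
    case False
    have pw: "(p, w) \<in> P" "p \<noteq> w" using P_order(2,3)[OF P_po] pq qw False by blast+
    have np: "\<not> maximal_in P p" and nq: "\<not> maximal_in P q" using nonmax pq qw False by auto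
    show ?thesis
    proof (cases "maximal_in P w")
      case True
      then show ?thesis using M\<gamma>[OF \<sigma>le[OF pq np nq]] False nq pw(2) unfolding \<beta>_def by simp
    next
      case nw: False
      have "FA M (\<sigma> p, \<sigma> w) = Cmp ?B (FA M (\<sigma> q, \<sigma> w)) (FA M (\<sigma> p, \<sigma> q))"
        using Mf \<sigma>le[OF pq np nq] \<sigma>le[OF qw nq nw] by blast
      then show ?thesis using False nq nw pw(2) unfolding \<beta>_def by simp
    qed
  qed
  have BBf: "is_functor (poset_cat P) ?B ?BB"
    unfolding is_functor_poset[OF P_po] using catB BO \<beta>h \<beta>c by (simp add: \<beta>_def)
  define \<chi>s where "\<chi>s p = Cmp ?S (\<phi> (\<sigma> p)) (FA ?\<Psi> (\<iota> p))" for p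
  have \<phi>p: "\<phi> (\<sigma> p) \<in> hom ?S (FO ?\<Psi> B) (FO ?\<Phi> (FO A p))" if "p \<in> Field P" for p
    using \<phi>h[OF \<sigma>X(1)[OF that]] \<sigma>X(2)[OF that] by simp
  have \<chi>sh: "\<chi>s p \<in> hom ?S (FO ?\<Psi> (BO p)) (FO ?\<Phi> (FO A p))" if "p \<in> Field P" for p
    unfolding \<chi>s_def by (rule hom_cmp[OF catS functor_hom[OF Psi \<iota>[OF that]] \<phi>p[OF that]])
  \<comment> \<open>At a maximal element the component is \<open>\<phi> (\<sigma> p)\<close> itself,
    a composite of \<open>\<chi>\<close> with the image of an extended projection. Elsewhere the
    double arrow is part of the buttress.\<close>
  have \<chi>sd: "\<chi>s p \<in> Arr (Sdbl L)" if p: "p \<in> Field P" for p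
  proof (cases "maximal_in P p")
    case True
    then have "\<chi>s p = \<phi> (\<sigma> p)"
      unfolding \<chi>s_def \<iota>_def using functor_obj(2)[OF Psi B] cmp_ident(1)[OF catS \<phi>p[OF p]] by simp
    then show ?thesis using \<phi>d[OF \<sigma>X(1)[OF p]] by simp
  next
    case False
    then show ?thesis unfolding \<chi>s_def \<iota>_def using M(3)[OF \<sigma>N[OF p False]] by simp
  qed
  have \<chi>sn: "Cmp ?S (\<chi>s q) (FA ?\<Psi> (\<beta> p q)) = Cmp ?S (FA ?\<Phi> (FA A (p, q))) (\<chi>s p)" if pq: "(p, q) \<in> P" for p q
  proof -
    note F = FieldI1[OF pq] FieldI2[OF pq]
    have "Cmp ?S (\<chi>s q) (FA ?\<Psi> (\<beta> p q)) = Cmp ?S (\<phi> (\<sigma> q)) (Cmp ?S (FA ?\<Psi> (\<iota> q)) (FA ?\<Psi> (\<beta> p q)))"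
      unfolding \<chi>s_def
      by (rule cmp_assoc[OF catS functor_hom[OF Psi \<beta>h[OF pq]] functor_hom[OF Psi \<iota>[OF F(2)]] \<phi>p[OF F(2)], symmetric])
    also have "\<dots> = Cmp ?S (\<phi> (\<sigma> q)) (FA ?\<Psi> (\<iota> p))"
      unfolding functor_cmp[OF Psi \<beta>h[OF pq] \<iota>[OF F(2)], symmetric] \<iota>\<beta>[OF pq] ..
    also have "\<dots> = Cmp ?S (FA ?\<Phi> (FA A (p, q))) (\<chi>s p)"
    proof (cases "p = q")
      case True
      have "FA ?\<Phi> (FA A (p, q)) = Ident ?S (FO ?\<Phi> (FO A p))"
        unfolding True[symmetric] D_ident[OF F(1)] by (rule functor_obj(2)[OF Phi D_obj[OF F(1)]])
      then show ?thesis using cmp_ident(2)[OF catS \<chi>sh[OF F(1)]] True unfolding \<chi>s_def by simp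
    next
      case False
      then show ?thesis
        using key[OF pq False] nonmax[OF pq False] unfolding \<chi>s_def \<iota>_def by simp
    qed
    finally show ?thesis .
  qed
  have nt: "nat_trans (poset_cat P) ?S (functor_comp ?\<Psi> ?BB) (functor_comp ?\<Phi> A) \<chi>s"
    unfolding nat_trans_def
    using is_functor_comp[OF BBf Psi] is_functor_comp[OF assms(8) Phi] \<chi>sh \<chi>sn by auto
  show ?thesis
  proof (rule exI[of _ ?BB], rule exI[of _ \<chi>s], intro conjI ballI impI)
    show "is_functor (poset_cat P) ?B ?BB" by (rule BBf)
    show "nat_trans (poset_cat P) ?S (functor_comp ?\<Psi> ?BB) (functor_comp ?\<Phi> A) \<chi>s" by (rule nt)
    show "\<chi>s p \<in> Arr (Sdbl L)" if "p \<in> Field P" for p by (rule \<chi>sd[OF that])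
    show "FO ?BB p \<in> Obj (Bdag L)" if "p \<in> Field P" "\<not> maximal_in P p" for p
      using M(1)[OF \<sigma>N[OF that]] that(2) by (simp add: BO_def)
    show "FO ?BB p = B" if "maximal_in P p" for p using that by (simp add: BO_def)
    assume "projectable_larder L"
    from projectable_replacement[OF P_po this BBf Psi nt \<chi>sd]
    show "\<exists>BB' \<chi>s' \<eta>. is_functor (poset_cat P) ?B BB' \<and>
        nat_trans (poset_cat P) ?S (functor_comp ?\<Psi> BB') (functor_comp ?\<Phi> A) \<chi>s' \<and>
        (\<forall>p\<in>Field P. isomorphism ?S (\<chi>s' p)) \<and> nat_trans (poset_cat P) ?B ?BB BB' \<eta> \<and>
        (\<forall>p\<in>Field P. epic ?B (\<eta> p))" .
  qed
qed

end
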